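(* Let $n=2$ or $n=3$, let $\varepsilon>0$, and let $K$ and $L$ be origin-symmetric convex bodies in $\mathbb{R}^{2n}$ that are invariant with respect to all $R_\theta$. If for every $\xi\in S^{2n-1}$ $$\mathrm{Vol}_{2n-2}(K\cap H_\xi)\le \mathrm{Vol}_{2n-2}(L\cap H_\xi)+\varepsilon,$$ then $$\mathrm{Vol}_{2n}(K)^{\frac{n-1}{n}}\le \mathrm{Vol}_{2n}(L)^{\frac{n-1}{n}}+\varepsilon.$$
   Context: $\mathbb{C}^n$ is identified with $\mathbb{R}^{2n}$ via $(\xi_1,\dots,\xi_n)=(\xi_{11}+i\xi_{12},\dots,\xi_{n1}+i\xi_{n2})\mapsto(\xi_{11},\xi_{12},\dots,\xi_{n1},\xi_{n2})$. $S^{2n-1}$ is the Euclidean unit sphere of $\mathbb{R}^{2n}$. For $\xi\in S^{2n-1}$, regarded as a unit vector in $\mathbb{C}^n$, $H_\xi=\{z\in\mathbb{C}^n:\sum_{k=1}^n z_k\overline{\xi_k}=0\}$ is the complex hyperplane through the origin perpendicular to $\xi$; under the identification it is a $(2n-2)$-dimensional real linear subspace of $\mathbb{R}^{2n}$. $\mathrm{Vol}_{2n}$ is Lebesgue measure on $\mathbb{R}^{2n}$ and $\mathrm{Vol}_{2n-2}$ is the $(2n-2)$-dimensional Lebesgue (Euclidean) volume on the subspace $H_\xi$. A convex body is a compact convex set with nonempty interior. For an origin-symmetric convex body $K$ in $\mathbb{R}^{2n}$, $\|\cdot\|_K$ denotes the norm whose closed unit ball is $K$. $R_\theta$ denotes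 the counterclockwise rotation of $\mathbb{R}^2$ by the angle $\theta$ about the origin. $K$ is invariant with respect to all $R_\theta$ if for every $\theta\in[0,2\pi]$ and every $\xi=(\xi_{11},\xi_{12},\dots,\xi_{n1},\xi_{n2})\in\mathbb{R}^{2n}$, $$\|\xi\|_K=\|(R_\theta(\xi_{11},\xi_{12}),\dots,R_\theta(\xi_{n1},\xi_{n2}))\|_K.$$ *)

theory Defs
  imports "HOL-Analysis.Analysis"
begin

text \<open>
  The space R^{2n} = C^n is the type \<open>complex ^ 'n\<close> with n = \<open>CARD('n)\<close>. Its real inner product,
  Euclidean norm and Lebesgue measure are those of R^{2n} in the coordinates
  \<open>Re (x $ k)\<close>, \<open>Im (x $ k)\<close>.
\<close>

definition convex_body :: "'a::euclidean_space set \<Rightarrow> bool" where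
  "convex_body K \<longleftrightarrow> compact K \<and> convex K \<and> interior K \<noteq> {}"

definition origin_symmetric :: "'a::euclidean_space set \<Rightarrow> bool" where
  "origin_symmetric K \<longleftrightarrow> uminus ` K = K"

text \<open>The Minkowski functional; for an origin-symmetric convex body this is the norm with closed
  unit ball \<open>K\<close>.\<close>

definition body_norm :: "'a::euclidean_space set \<Rightarrow> 'a \<Rightarrow> real" where
  "body_norm K x = Inf {t. t \<ge> 0 \<and> x \<in> (\<lambda>y. t *\<^sub>R y) ` K}"

definition rotation :: "real \<Rightarrow> complex \<Rightarrow> complex" where
  "rotation \<theta> z = Complex (cos \<theta> * Re z - sin \<theta> * Im z) (sin \<theta> * Re z + cos \<theta> * Im z)"

lemma rotation_eq_cis: "rotation \<theta> z = cis \<theta> * z"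
  by (simp add: rotation_def complex_eq_iff algebra_simps)

definition rotation_invariant :: "(complex ^ 'n) set \<Rightarrow> bool" where
  "rotation_invariant K \<longleftrightarrow>
     (\<forall>\<theta>\<in>{0..2*pi}. \<forall>\<xi>. body_norm K \<xi> = body_norm K (\<chi> k. rotation \<theta> (\<xi> $ k)))"

definition complex_hyperplane :: "complex ^ 'n \<Rightarrow> (complex ^ 'n) set" where
  "complex_hyperplane \<xi> = {z. (\<Sum>k\<in>UNIV. z $ k * cnj (\<xi> $ k)) = 0}"

definition orthonormal_basis_of :: "'a::euclidean_space set \<Rightarrow> 'a set \<Rightarrow> bool" where
  "orthonormal_basis_of S B \<longleftrightarrow> pairwise orthogonal B \<and> (\<forall>b\<in>B. norm b = 1) \<and> span B = S"

lemma orthonormal_basis_of_exists: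
  assumes "subspace S"
  shows "\<exists>B. orthonormal_basis_of S B"
  using orthonormal_basis_subspace[OF assms] unfolding orthonormal_basis_of_def by metis

text \<open>
  The Lebesgue measure of dimension \<open>dim S\<close> on a linear subspace \<open>S\<close>, as a measure on the ambient
  space that is concentrated on \<open>S\<close>. It is built like \<open>lborel\<close>, with an orthonormal basis of \<open>S\<close>
  in place of \<open>Basis\<close>; it does not depend on the chosen basis, since Lebesgue measure is invariant
  under orthogonal maps.
\<close>

definition subspace_lborel :: "'a::euclidean_space set \<Rightarrow> 'a measure" where
  "subspace_lborel S = (let B = (SOME B. orthonormal_basis_of S B) in
     distr (\<Pi>\<^sub>M b\<in>B. (lborel :: real measure)) borel (\<lambda>f. \<Sum>b\<in>B. f b *\<^sub>R b))"

abbreviation subspace_lebesgue :: "'a::euclidean_space set \<Rightarrow> 'a measure" where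
  "subspace_lebesgue S \<equiv> completion (subspace_lborel S)"

end

theory Submission
  imports Defs
begin

text \<open>
  The volume of a body is read off its slices by complex lines through the origin. For \<open>x \<noteq> 0\<close> put
  \<open>s\<^sub>K x = area {l \<in> C. l x \<in> K}\<close> (\<open>slice_area\<close>), a function homogeneous of degree -2. By Fubini,
  \<open>\<integral>\<^sub>D s\<^sub>K = \<integral> vol (D \<inter> l\<^sup>-\<^sup>1 K) dl\<close>; since \<open>vol (l\<^sup>-\<^sup>1 K) = \<bar>l\<bar>\<^sup>-\<^sup>2\<^sup>n vol K\<close>, bounding the
  integrand by the smaller of the two volumes and rescaling \<open>l\<close> gives
  \<open>\<integral>\<^sub>D s\<^sub>K \<le> c vol(D)^((n-1)/n) vol(K)^(1/n)\<close>, and equality holds for \<open>D = K\<close> when \<open>K\<close> is stable under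
  multiplication by the closed complex unit disc, which is what rotation invariance and convexity give
  (\<open>slice_integral_le\<close>, \<open>slice_integral_self\<close>). So the theorem follows from
  \<open>\<integral>\<^sub>K s\<^sub>K \<le> \<integral>\<^sub>L s\<^sub>K + \<integral>\<^sub>B s\<^sub>K\<close>, where \<open>B\<close> is the centred ball whose hyperplane sections through the
  origin have volume \<open>\<epsilon>\<close>: the explicit volumes of unit balls show \<open>vol(B)^((n-1)/n) \<le> \<epsilon>\<close>.

  For \<open>n = 2\<close> a complex hyperplane is a complex line, so the hypothesis says
  \<open>s\<^sub>K \<le> s\<^sub>L + s\<^sub>B\<close> pointwise. Integration over \<open>K\<close> gives a variant of the inequality
  that serves equally well.

  For \<open>n = 3\<close> the inequality solves a Busemann-Petty problem: \<open>D \<mapsto> \<integral>\<^sub>D s\<^sub>K\<close> has to be approximated by a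
  superposition, with nonnegative weights, of section functionals \<open>D \<mapsto> vol (D \<inter> H)\<close>. The weight of a
  hyperplane is the amount by which the central section of \<open>K\<close> exceeds the average of the parallel sections
  in a slab whose width is proportional to a small \<open>t\<close> (\<open>section_deficit\<close>). It is nonnegative because the central section of
  a symmetric convex body is the largest among its parallel sections (\<open>section_central_max\<close>); this is proved
  by Steiner symmetrization. Interchanging the roles of points and planes (\<open>point_plane_duality\<close>) turns the
  superposition into an integral over \<open>x \<in> D\<close> of a total weight of the pencil of all hyperplanes through \<open>x\<close>. That
  weight can be computed exactly (\<open>pencil_deficit\<close>): it is the integral of the areas of the slices of \<open>K\<close> by the
  complex lines parallel to \<open>x\<close>, against the kernel \<open>max 0 (1/\<bar>p\<bar>\<^sup>2 - 1/t\<^sup>2)\<close> in the displacement \<open>p\<close> of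
  the line. The kernel is integrable, nonnegative and supported in \<open>\<bar>p\<bar> < t\<close>, so for small \<open>t\<close> the total weight
  is \<open>s\<^sub>K x\<close> up to a factor that depends on \<open>t\<close> only and cancels. As the slice through the
  origin is again the largest, the upper bound holds without error; the lower bound holds up to a factor \<open>(1 - d)\<^sup>2\<close>
  that tends to 1.

  Hyperplanes are written in the affine chart \<open>v = m u + b w\<close> of the coordinates \<open>(u, v, w)\<close> of \<open>C\<^sup>3\<close>, where all
  these interchanges are applications of Fubini's theorem and of affine substitutions in one complex variable.
  Sections are measured by the Lebesgue measure of their \<open>(u, w)\<close>-projection (\<open>plane_area\<close>). This differs from the
  intrinsic volume by a constant that depends on the hyperplane alone, and the hypothesis compares \<open>K\<close>, \<open>L\<close> and \<open>B\<close> in the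
  same hyperplane, so the constant cancels.
\<close>

section \<open>Lebesgue integrals under translations, isometries and complex multiplication\<close>

lemma nn_integral_lborel_pair:
  fixes f :: "'a::euclidean_space \<times> 'b::euclidean_space \<Rightarrow> ennreal"
  assumes "f \<in> borel_measurable borel"
  shows "(\<integral>\<^sup>+x. f x \<partial>lborel) = (\<integral>\<^sup>+a. \<integral>\<^sup>+b. f (a, b) \<partial>lborel \<partial>lborel)"
  using assms lborel.nn_integral_fst[of f "lborel :: 'a measure"] by (simp add: lborel_prod)

lemma nn_integral_lborel_translate:
  fixes f :: "'a::euclidean_space \<Rightarrow> ennreal"
  assumes [measurable]: "f \<in> borel_measurable borel"
  shows "(\<integral>\<^sup>+x. f (a + x) \<partial>lborel) = (\<integral>\<^sup>+x. f x \<partial>lborel)"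
proof -
  have "(\<integral>\<^sup>+x. f x \<partial>lborel) = (\<integral>\<^sup>+x. f x \<partial>distr lborel borel (\<lambda>x. a + x))"
    by (simp add: lborel_distr_plus)
  also have "\<dots> = (\<integral>\<^sup>+x. f (a + x) \<partial>lborel)" by (rule nn_integral_distr) auto
  finally show ?thesis ..
qed

lemma nn_integral_lborel_reflect:
  fixes f :: "'a::euclidean_space \<Rightarrow> ennreal"
  assumes [measurable]: "f \<in> borel_measurable borel"
  shows "(\<integral>\<^sup>+x. f (a - x) \<partial>lborel) = (\<integral>\<^sup>+x. f x \<partial>lborel)"
proof -
  have "(\<integral>\<^sup>+x. f x \<partial>lborel) = (\<integral>\<^sup>+x. f x \<partial>distr lborel borel (\<lambda>x. a + (-1) *\<^sub>R x))"
    using lborel_affine[of "-1" a] by (simp add: density_1)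
  also have "\<dots> = (\<integral>\<^sup>+x. f (a - x) \<partial>lborel)" by (subst nn_integral_distr) auto
  finally show ?thesis ..
qed

text \<open>
  Uniqueness of Lebesgue measure up to a factor: integrate \<open>1\<^sub>A x * 1\<^sub>B (y - x)\<close>, with \<open>B\<close> the unit
  ball, over both variables in the two orders; substituting \<open>x + y\<close> for \<open>x\<close> moves the translation to \<open>A\<close>.
\<close>

lemma translation_invariant_proportional:
  fixes M :: "'a::euclidean_space measure"
  assumes sets[measurable_cong]: "sets M = sets borel"
    and fin: "\<And>r. emeasure M (cball 0 r) < \<infinity>"
    and inv: "\<And>a. distr M borel (\<lambda>x. x + a) = M"
    and A[measurable]: "A \<in> sets borel"
  shows "emeasure M A * emeasure lborel (cball 0 1 :: 'a set) = emeasure M (cball 0 1) * emeasure lborel A"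
proof -
  let ?B = "cball 0 1 :: 'a set"
  have [measurable]: "?B \<in> sets borel" by simp
  have "sigma_finite_measure M"
  proof
    show "\<exists>A. countable A \<and> A \<subseteq> sets M \<and> \<Union>A = space M \<and> (\<forall>a\<in>A. emeasure M a \<noteq> \<infinity>)"
      using fin sets sets_eq_imp_space_eq[OF sets]
      by (intro exI[of _ "range (\<lambda>n::nat. cball (0::'a) (real n))"])
         (auto simp: less_top real_arch_simple)
  qed
  then interpret M: sigma_finite_measure M .
  interpret P: pair_sigma_finite M "lborel :: 'a measure" ..
  have eq1: "(\<integral>\<^sup>+y. indicator ?B (y - x) \<partial>lborel) = emeasure lborel ?B" for x :: 'a
  proof -
    have "(\<integral>\<^sup>+y. indicator ?B (y - x) \<partial>lborel) = (\<integral>\<^sup>+y. indicator ?B (- x + y) \<partial>lborel)"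
      by simp
    also have "\<dots> = (\<integral>\<^sup>+y. indicator ?B y \<partial>lborel)"
      by (rule nn_integral_lborel_translate) (intro borel_measurable_indicator, simp)
    finally show ?thesis by simp
  qed
  have eq2: "(\<integral>\<^sup>+y. indicator A (x + y) \<partial>lborel) = emeasure lborel A" for x :: 'a
    by (subst nn_integral_lborel_translate) auto
  have "emeasure M A * emeasure lborel ?B = (\<integral>\<^sup>+x. indicator A x * emeasure lborel ?B \<partial>M)"
    by (simp add: nn_integral_multc)
  also have "\<dots> = (\<integral>\<^sup>+x. \<integral>\<^sup>+y. indicator A x * indicator ?B (y - x) \<partial>lborel \<partial>M)"
    by (intro nn_integral_cong, subst nn_integral_cmult) (auto simp: eq1)
  also have "\<dots> = (\<integral>\<^sup>+y. \<integral>\<^sup>+x. indicator A x * indicator ?B (y - x) \<partial>M \<partial>lborel)"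
    by (rule P.Fubini'[symmetric]) measurable
  also have "\<dots> = (\<integral>\<^sup>+y. \<integral>\<^sup>+x. indicator A (x + y) * indicator ?B x \<partial>M \<partial>lborel)"
  proof (rule nn_integral_cong)
    fix y :: 'a
    have "(\<integral>\<^sup>+x. indicator A x * indicator ?B (y - x) \<partial>M)
        = (\<integral>\<^sup>+x. indicator A x * indicator ?B (y - x) \<partial>distr M borel (\<lambda>x. x + y))"
      by (simp add: inv)
    also have "\<dots> = (\<integral>\<^sup>+x. indicator A (x + y) * indicator ?B (y - (x + y)) \<partial>M)"
      by (rule nn_integral_distr) measurable
    finally show "(\<integral>\<^sup>+x. indicator A x * indicator ?B (y - x) \<partial>M)
        = (\<integral>\<^sup>+x. indicator A (x + y) * indicator ?B x \<partial>M)"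
      by (simp add: indicator_def)
  qed
  also have "\<dots> = (\<integral>\<^sup>+x. \<integral>\<^sup>+y. indicator ?B x * indicator A (x + y) \<partial>lborel \<partial>M)"
    by (subst P.Fubini') (measurable, simp add: mult.commute)
  also have "\<dots> = (\<integral>\<^sup>+x. indicator ?B x * emeasure lborel A \<partial>M)"
    by (simp add: nn_integral_cmult eq2)
  also have "\<dots> = emeasure M ?B * emeasure lborel A"
    by (simp add: nn_integral_multc sets)
  finally show ?thesis .
qed

lemma translation_invariant_eq_lborel:
  fixes M :: "'a::euclidean_space measure"
  assumes sets: "sets M = sets borel"
    and inv: "\<And>a. distr M borel (\<lambda>x. x + a) = M"
    and ball: "\<And>r. emeasure M (cball 0 r) = emeasure lborel (cball 0 r :: 'a set)"
  shows "M = lborel"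
proof (rule measure_eqI)
  fix A assume "A \<in> sets M"
  then have A: "A \<in> sets borel" by (simp add: sets)
  have "emeasure lborel (cball 0 1 :: 'a set) \<noteq> 0" "emeasure lborel (cball 0 1 :: 'a set) \<noteq> \<infinity>"
    using emeasure_lborel_cball_finite[of "0::'a" 1] unit_ball_vol_pos[of "DIM('a)"]
    by (auto simp: emeasure_cball simp del: unit_ball_vol_pos)
  moreover have "emeasure M A * emeasure lborel (cball 0 1 :: 'a set) = emeasure lborel A * emeasure lborel (cball 0 1 :: 'a set)"
    using translation_invariant_proportional[OF sets _ inv A] ball emeasure_lborel_cball_finite
    by (metis mult.commute)
  ultimately show "emeasure M A = emeasure lborel A"
    using mult_divide_eq_ennreal[of "emeasure lborel (cball 0 1 :: 'a set)"]
    by (auto simp: less_top dest: arg_cong[where f = "\<lambda>z. z / emeasure lborel (cball 0 1 :: 'a set)"])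
qed (simp add: sets)

text \<open>
  The image measure is translation invariant and agrees with Lebesgue measure on centred balls.
\<close>

lemma distr_lborel_isometry:
  fixes f :: "'a::euclidean_space \<Rightarrow> 'b::euclidean_space"
  assumes lin: "linear f" and iso: "\<And>x. norm (f x) = norm x" and dim: "DIM('a) = DIM('b)"
  shows "distr lborel borel f = lborel"
proof (rule translation_invariant_eq_lborel)
  have [measurable]: "f \<in> borel_measurable borel"
    by (intro borel_measurable_continuous_onI linear_continuous_on linear_linear[THEN iffD2] lin)
  have inj: "inj f"
    using lin iso by (metis linear_injective_0 norm_eq_zero)
  have "dim (range f) = DIM('b)"
    using dim_image_eq[OF lin, of UNIV] inj dim by simp
  then have surj: "range f = UNIV"
    using dim_eq_full[of "range f"] linear_subspace_image[OF lin, of UNIV]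
    by (metis span_eq_iff subspace_UNIV)
  show "distr (distr lborel borel f) borel (\<lambda>x. x + a) = distr lborel borel f" for a
  proof -
    obtain c where c: "a = f c" using surj by auto
    have "distr (distr lborel borel f) borel (\<lambda>x. x + a) = distr lborel borel (\<lambda>x. f x + a)"
      by (subst distr_distr) (auto simp: comp_def)
    also have "\<dots> = distr lborel borel (\<lambda>x. f (c + x))"
      by (simp add: c linear_add[OF lin] add.commute)
    also have "\<dots> = distr (distr lborel borel (\<lambda>x. c + x)) borel f"
      by (subst distr_distr) (auto simp: comp_def)
    finally show ?thesis by (simp add: lborel_distr_plus)
  qed
  show "emeasure (distr lborel borel f) (cball 0 r) = emeasure lborel (cball 0 r :: 'b set)" for r
  proof (cases "r < 0")
    case False
    have "f -` cball 0 r = cball 0 r" by (auto simp: iso)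
    then show ?thesis using False by (simp add: emeasure_distr emeasure_cball dim)
  qed simp
qed simp

lemma nn_integral_lborel_isometry:
  fixes f :: "'a::euclidean_space \<Rightarrow> 'b::euclidean_space"
  assumes lin: "linear f" and iso: "\<And>x. norm (f x) = norm x" and dim: "DIM('a) = DIM('b)"
    and g[measurable]: "g \<in> borel_measurable borel"
  shows "(\<integral>\<^sup>+x. g (f x) \<partial>lborel) = (\<integral>\<^sup>+x. g x \<partial>lborel)"
proof -
  have [measurable]: "f \<in> borel_measurable borel"
    by (intro borel_measurable_continuous_onI linear_continuous_on linear_linear[THEN iffD2] lin)
  have "(\<integral>\<^sup>+x. g x \<partial>lborel) = (\<integral>\<^sup>+x. g x \<partial>distr lborel borel f)"
    by (simp add: distr_lborel_isometry[OF lin iso dim])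
  also have "\<dots> = (\<integral>\<^sup>+x. g (f x) \<partial>lborel)" by (rule nn_integral_distr) auto
  finally show ?thesis ..
qed

lemma nn_integral_lborel_scaleR:
  fixes g :: "'a::euclidean_space \<Rightarrow> ennreal"
  assumes [measurable]: "g \<in> borel_measurable borel" and "r > 0"
  shows "(\<integral>\<^sup>+x. g x \<partial>lborel) = ennreal (r ^ DIM('a)) * (\<integral>\<^sup>+x. g (r *\<^sub>R x) \<partial>lborel)"
proof -
  have "(lborel :: 'a measure) = density (distr lborel borel (\<lambda>x. r *\<^sub>R x)) (\<lambda>_. ennreal (r ^ DIM('a)))"
    using lborel_affine[of r "0::'a"] assms(2) by simp
  then have "(\<integral>\<^sup>+x. g x \<partial>lborel)
      = (\<integral>\<^sup>+x. g x \<partial>density (distr lborel borel (\<lambda>x. r *\<^sub>R x)) (\<lambda>_. ennreal (r ^ DIM('a))))"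
    by metis
  also have "\<dots> = ennreal (r ^ DIM('a)) * (\<integral>\<^sup>+x. g (r *\<^sub>R x) \<partial>lborel)"
    by (simp add: nn_integral_density nn_integral_distr nn_integral_cmult)
  finally show ?thesis .
qed

text \<open>
  Multiplication by \<open>c\<close> is a rotation followed by a real scaling.
\<close>

lemma nn_integral_complex_mult:
  fixes g :: "complex \<Rightarrow> ennreal"
  assumes [measurable]: "g \<in> borel_measurable borel" and "c \<noteq> 0"
  shows "(\<integral>\<^sup>+z. g z \<partial>lborel) = ennreal ((norm c)\<^sup>2) * (\<integral>\<^sup>+z. g (c * z) \<partial>lborel)"
proof -
  define e where "e = c / of_real (norm c)"
  have e: "norm e = 1" "c = of_real (norm c) * e" using assms by (auto simp: e_def norm_divide)
  have "(\<integral>\<^sup>+z. g z \<partial>lborel) = (\<integral>\<^sup>+z. g (e * z) \<partial>lborel)"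
    by (rule nn_integral_lborel_isometry[symmetric])
       (auto simp: norm_mult e(1) intro!: linearI simp: algebra_simps)
  also have "\<dots> = ennreal ((norm c)\<^sup>2) * (\<integral>\<^sup>+z. g (e * (norm c *\<^sub>R z)) \<partial>lborel)"
    by (subst nn_integral_lborel_scaleR[of _ "norm c"]) (use assms in auto)
  also have "(\<lambda>z. e * (norm c *\<^sub>R z)) = (\<lambda>z. c * z)"
    using e(2) by (metis mult.assoc mult.commute scaleR_conv_of_real)
  finally show ?thesis by (metis (no_types, lifting) nn_integral_cong)
qed

declare open_ball[THEN borel_open, measurable] closed_cball[THEN borel_closed, measurable]

abbreviation complex_lborel :: "complex measure" where
  "complex_lborel \<equiv> lborel"

text \<open>
  Integrability at infinity by comparison with a geometric series over dyadic discs. The maximum with 1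
  keeps the integrand meaningful at the origin.
\<close>

lemma nn_integral_inverse_fourth_power_finite:
  "(\<integral>\<^sup>+z. ennreal (1 / max 1 (norm z ^ 4)) \<partial>complex_lborel) < \<infinity>"
proof -
  let ?f = "\<lambda>z::complex. ennreal (1 / max 1 (norm z ^ 4))"
  let ?g = "\<lambda>n (z::complex). ennreal ((1/16) ^ n) * indicator (cball 0 (2 ^ Suc n)) z"
  have le: "?f z \<le> (\<Sum>n. ?g n z) + indicator (cball 0 1) z" for z
  proof (cases "norm z \<le> 1")
    case True
    have "?f z \<le> 1" by (simp add: divide_le_eq_1 less_max_iff_disj)
    then show ?thesis using True by (simp add: add_increasing)
  next
    case False
    obtain n where n: "norm z \<le> 2 ^ n" using real_arch_pow[of 2 "norm z"] by (auto intro: less_imp_le)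
    \<comment> \<open>The dyadic shell that contains \<open>z\<close>.\<close>
    define N where "N = (LEAST n. norm z \<le> 2 ^ n)"
    have N: "norm z \<le> 2 ^ N" "\<And>k. k < N \<Longrightarrow> \<not> norm z \<le> 2 ^ k"
      using LeastI[of "\<lambda>n. norm z \<le> 2 ^ n", OF n] not_less_Least by (auto simp: N_def)
    have "N \<noteq> 0" using N(1) False by (intro notI) simp
    then obtain k where k: "N = Suc k" by (cases N) auto
    have h16: "(2::real) ^ 4 = 16" by simp
    have kz: "2 ^ k < norm z" using N(2)[of k] k by simp
    have "(2 ^ k) ^ 4 \<le> norm z ^ 4" using kz by (intro power_mono) auto
    moreover have "((2::real) ^ k) ^ 4 = 16 ^ k" by (metis power_mult mult.commute h16)
    moreover have "0 < norm z ^ 4 * 16 ^ k" using False by (intro mult_pos_pos) auto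
    ultimately have "1 / norm z ^ 4 \<le> 1 / 16 ^ k" by (intro divide_left_mono) simp_all
    moreover have "max 1 (norm z ^ 4) = norm z ^ 4" using False by (intro max_absorb2) (simp add: one_le_power)
    ultimately have "?f z \<le> ennreal ((1/16) ^ k)" by (intro ennreal_leI) (simp add: power_divide)
    also have "\<dots> = ?g k z" using N(1) k by simp
    also have "\<dots> \<le> (\<Sum>n. ?g n z)"
    proof -
      have "sum (\<lambda>n. ?g n z) {k} \<le> (\<Sum>n. ?g n z)" by (rule sum_le_suminf) auto
      then show ?thesis by (simp only: sum.insert finite.intros sum.empty empty_iff not_False_eq_True add_0_right)
    qed
    finally show ?thesis by (simp add: add_increasing2)
  qed
  have "(\<integral>\<^sup>+z. ?f z \<partial>lborel) \<le> (\<integral>\<^sup>+z. (\<Sum>n. ?g n z) + indicator (cball 0 1) z \<partial>lborel)"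
    by (intro nn_integral_mono le)
  also have "\<dots> = (\<Sum>n. \<integral>\<^sup>+z. ?g n z \<partial>lborel) + emeasure lborel (cball 0 1 :: complex set)"
  proof -
    have "(\<integral>\<^sup>+z. (\<Sum>n. ?g n z) + indicator (cball 0 1) z \<partial>lborel)
      = (\<integral>\<^sup>+z. (\<Sum>n. ?g n z) \<partial>lborel) + (\<integral>\<^sup>+z. indicator (cball 0 1) z \<partial>complex_lborel)"
      by (rule nn_integral_add) measurable
    moreover have "(\<integral>\<^sup>+z. (\<Sum>n. ?g n z) \<partial>lborel) = (\<Sum>n. \<integral>\<^sup>+z. ?g n z \<partial>lborel)"
      by (rule nn_integral_suminf) measurable
    ultimately show ?thesis by simp
  qed
  also have "(\<Sum>n. \<integral>\<^sup>+z. ?g n z \<partial>lborel) = (\<Sum>n. ennreal (unit_ball_vol 2 * 4 * (1/4) ^ n))"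
  proof (intro suminf_cong)
    fix n
    have "(\<integral>\<^sup>+z. ?g n z \<partial>lborel) = ennreal ((1/16) ^ n) * emeasure lborel (cball 0 (2 ^ Suc n) :: complex set)"
      by (simp add: nn_integral_cmult)
    also have "\<dots> = ennreal ((1/16) ^ n * (unit_ball_vol 2 * (2 ^ Suc n)\<^sup>2))"
      by (simp add: emeasure_cball ennreal_mult)
    also have "(1/16) ^ n * (unit_ball_vol 2 * (2 ^ Suc n)\<^sup>2) = unit_ball_vol 2 * 4 * (1/4) ^ n"
    proof -
      have "(2::real)\<^sup>2 = 4" by simp
      then have h4: "((2::real) ^ n)\<^sup>2 = 4 ^ n" by (metis power_mult mult.commute)
      have "((2::real) ^ Suc n)\<^sup>2 = 4 * 4 ^ n" using h4 by (simp add: power_mult_distrib)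
      moreover have "(1/16::real) ^ n * 4 ^ n = (1/4) ^ n" by (simp add: power_mult_distrib[symmetric])
      ultimately show ?thesis by (simp add: algebra_simps)
    qed
    finally show "(\<integral>\<^sup>+z. ?g n z \<partial>lborel) = ennreal (unit_ball_vol 2 * 4 * (1/4) ^ n)" .
  qed
  also have "\<dots> = ennreal (\<Sum>n. unit_ball_vol 2 * 4 * (1/4) ^ n)"
    by (intro suminf_ennreal2) (auto intro!: summable_mult summable_geometric)
  also have "\<dots> + emeasure lborel (cball 0 1 :: complex set) < \<infinity>"
    using emeasure_lborel_cball_finite[of "0::complex" 1] by (simp add: ennreal_add_less_top)
  finally show ?thesis .
qed

lemma measurable_fst_borel [measurable (raw)]:
  fixes f :: "'c \<Rightarrow> 'a::second_countable_topology \<times> 'b::second_countable_topology"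
  assumes "f \<in> borel_measurable M"
  shows "(\<lambda>x. fst (f x)) \<in> borel_measurable M" "(\<lambda>x. snd (f x)) \<in> borel_measurable M"
  using assms by (auto intro!: borel_measurable_continuous_on[of _ f] continuous_intros)

lemma nn_integral_swap:
  fixes f :: "'a::euclidean_space \<Rightarrow> 'b::euclidean_space \<Rightarrow> ennreal"
  assumes "(\<lambda>p. f (fst p) (snd p)) \<in> borel_measurable (borel \<Otimes>\<^sub>M borel)"
  shows "(\<integral>\<^sup>+a. \<integral>\<^sup>+b. f a b \<partial>lborel \<partial>lborel) = (\<integral>\<^sup>+b. \<integral>\<^sup>+a. f a b \<partial>lborel \<partial>lborel)"
  by (rule lborel_pair.Fubini'[symmetric]) (use assms in \<open>simp add: case_prod_beta'\<close>)

lemma measurable_ternary: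
  assumes f: "(\<lambda>(a, b, c). f a b c) \<in> borel_measurable (borel \<Otimes>\<^sub>M borel \<Otimes>\<^sub>M borel)"
    and "p \<in> borel_measurable M" "q \<in> borel_measurable M" "r \<in> borel_measurable M"
  shows "(\<lambda>x. f (p x) (q x) (r x)) \<in> borel_measurable M"
proof -
  have "(\<lambda>x. (p x, q x, r x)) \<in> M \<rightarrow>\<^sub>M borel \<Otimes>\<^sub>M borel \<Otimes>\<^sub>M borel" using assms(2-4) by measurable
  from measurable_compose[OF this f] show ?thesis by simp
qed

lemma
  fixes f :: "'a::euclidean_space \<Rightarrow> 'b::euclidean_space \<Rightarrow> 'c::euclidean_space \<Rightarrow> ennreal"
  assumes f: "(\<lambda>(a, b, c). f a b c) \<in> borel_measurable (borel \<Otimes>\<^sub>M borel \<Otimes>\<^sub>M borel)"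
  shows nn_integral_rotate: "(\<integral>\<^sup>+a. \<integral>\<^sup>+b. \<integral>\<^sup>+c. f a b c \<partial>lborel \<partial>lborel \<partial>lborel) = (\<integral>\<^sup>+b. \<integral>\<^sup>+c. \<integral>\<^sup>+a. f a b c \<partial>lborel \<partial>lborel \<partial>lborel)" (is "?abc = ?bca")
    and nn_integral_reverse: "(\<integral>\<^sup>+a. \<integral>\<^sup>+b. \<integral>\<^sup>+c. f a b c \<partial>lborel \<partial>lborel \<partial>lborel) = (\<integral>\<^sup>+c. \<integral>\<^sup>+b. \<integral>\<^sup>+a. f a b c \<partial>lborel \<partial>lborel \<partial>lborel)" (is "_ = ?cba")
proof -
  note [measurable (raw)] = measurable_ternary[OF f]
  have "?abc = (\<integral>\<^sup>+b. \<integral>\<^sup>+a. \<integral>\<^sup>+c. f a b c \<partial>lborel \<partial>lborel \<partial>lborel)"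
    by (rule nn_integral_swap) measurable
  also have "\<dots> = ?bca"
    by (intro nn_integral_cong nn_integral_swap) measurable
  finally show "?abc = ?bca" .
  also have "\<dots> = ?cba"
    by (rule nn_integral_swap) measurable
  finally show "?abc = ?cba" .
qed

lemma nn_integral_complex_affine:
  fixes g :: "complex \<Rightarrow> ennreal"
  assumes [measurable]: "g \<in> borel_measurable borel" and "c \<noteq> 0"
  shows "(\<integral>\<^sup>+z. g z \<partial>lborel) = ennreal ((norm c)\<^sup>2) * (\<integral>\<^sup>+z. g (a + c * z) \<partial>lborel)"
  using nn_integral_complex_mult[of "\<lambda>z. g (a + z)" c] nn_integral_lborel_translate[of g a] assms by simp

section \<open>Integrals along orthonormal directions\<close>

text \<open>
  The integral of the indicator of \<open>K\<close> over the flat through \<open>y\<close> spanned by an orthonormal set \<open>B\<close>.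
  Keeping \<open>y\<close> as an argument allows induction over \<open>B\<close>.
\<close>

definition fiber_integral :: "'a::euclidean_space set \<Rightarrow> 'a set \<Rightarrow> 'a \<Rightarrow> ennreal" where
  "fiber_integral B K y = (\<integral>\<^sup>+f. indicator K (y + (\<Sum>b\<in>B. f b *\<^sub>R b)) \<partial>(\<Pi>\<^sub>M b\<in>B. (lborel :: real measure)))"

text \<open>
  The integration over the new direction \<open>e\<close> can be done last or first; the symmetrization argument uses both
  orders, because it treats one direction at a time and must leave the others alone.
\<close>

lemma fiber_integral_insert:
  fixes K :: "'a::euclidean_space set"
  assumes fin: "finite B" and e: "e \<notin> B" and K[measurable]: "K \<in> sets borel"
  shows "fiber_integral (insert e B) K y = (\<integral>\<^sup>+s. fiber_integral B K (y + s *\<^sub>R e) \<partial>lborel)"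
    and "fiber_integral (insert e B) K y
      = (\<integral>\<^sup>+f. (\<integral>\<^sup>+s. indicator K (y + (\<Sum>b\<in>B. f b *\<^sub>R b) + s *\<^sub>R e) \<partial>lborel) \<partial>(\<Pi>\<^sub>M b\<in>B. (lborel :: real measure)))"
proof -
  interpret product_sigma_finite "\<lambda>_::'a. lborel :: real measure" by standard
  have sum: "(\<Sum>b\<in>B. (if b = e then s else f b) *\<^sub>R b) = (\<Sum>b\<in>B. f b *\<^sub>R b)" for f :: "'a \<Rightarrow> real" and s
    using e by (intro sum.cong) auto
  have [measurable]: "(\<lambda>f. \<Sum>b\<in>B. f b *\<^sub>R b) \<in> borel_measurable (\<Pi>\<^sub>M b\<in>B. (lborel :: real measure))"
    by measurable
  have [measurable]: "(\<lambda>f. \<Sum>b\<in>insert e B. f b *\<^sub>R b) \<in> borel_measurable (\<Pi>\<^sub>M b\<in>insert e B. (lborel :: real measure))"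
    by measurable
  show "fiber_integral (insert e B) K y = (\<integral>\<^sup>+s. fiber_integral B K (y + s *\<^sub>R e) \<partial>lborel)"
    unfolding fiber_integral_def
    by (subst product_nn_integral_insert_rev[OF fin e])
       (auto simp: fin e sum add.assoc[symmetric] intro!: nn_integral_cong)
  show "fiber_integral (insert e B) K y
      = (\<integral>\<^sup>+f. (\<integral>\<^sup>+s. indicator K (y + (\<Sum>b\<in>B. f b *\<^sub>R b) + s *\<^sub>R e) \<partial>lborel) \<partial>(\<Pi>\<^sub>M b\<in>B. (lborel :: real measure)))"
    unfolding fiber_integral_def
    by (subst product_nn_integral_insert[OF fin e])
       (auto simp: fin e sum add_ac intro!: nn_integral_cong)
qed

lemma fiber_integral_empty: "fiber_integral {} K y = indicator K y"
  by (simp add: fiber_integral_def PiM_empty nn_integral_count_space_finite)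

lemma measurable_fiber_integral [measurable]:
  assumes "finite B" and [measurable]: "K \<in> sets borel"
  shows "fiber_integral B K \<in> borel_measurable borel"
  using assms(1)
proof induction
  case empty
  show ?case by (simp add: fiber_integral_empty[abs_def] assms(2))
next
  case (insert e B)
  have [measurable]: "fiber_integral B K \<in> borel_measurable borel" by fact
  show ?case
    unfolding fiber_integral_insert(1)[OF insert(1,2) assms(2), THEN ext[of "fiber_integral (insert e B) K"]]
    by measurable
qed

lemma fiber_integral_translate:
  fixes B :: "'a::euclidean_space set"
  assumes "finite B" and [measurable]: "K \<in> sets borel"
  shows "fiber_integral B K (y + (\<Sum>b\<in>B. c b *\<^sub>R b)) = fiber_integral B K y"
  using assms(1)
proof (induction arbitrary: y)
  case empty
  then show ?case by simp
next
  case (insert e B)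
  have [measurable]: "fiber_integral B K \<in> borel_measurable borel"
    by (rule measurable_fiber_integral) (use insert assms in auto)
  have "fiber_integral (insert e B) K (y + (\<Sum>b\<in>insert e B. c b *\<^sub>R b))
      = (\<integral>\<^sup>+s. fiber_integral B K (y + (c e + s) *\<^sub>R e + (\<Sum>b\<in>B. c b *\<^sub>R b)) \<partial>lborel)"
    using insert by (simp add: fiber_integral_insert(1) algebra_simps)
  also have "\<dots> = (\<integral>\<^sup>+s. fiber_integral B K (y + (c e + s) *\<^sub>R e) \<partial>lborel)"
    by (simp add: insert.IH)
  also have "\<dots> = (\<integral>\<^sup>+s. fiber_integral B K (y + s *\<^sub>R e) \<partial>lborel)"
    by (rule nn_integral_lborel_translate) measurable
  finally show ?case using insert by (simp add: fiber_integral_insert(1))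
qed

section \<open>Steiner symmetrization and the largest section\<close>

lemma emeasure_bounded_convex_real:
  fixes S :: "real set"
  assumes "convex S" "bounded S" "S \<noteq> {}"
  shows "emeasure lborel S = ennreal (Sup S - Inf S)"
proof -
  have bd: "bdd_above S" "bdd_below S"
    using assms(2) by (auto intro: bounded_imp_bdd_above bounded_imp_bdd_below)
  have sub: "S \<subseteq> {Inf S..Sup S}"
    using bd by (auto intro: cInf_lower cSup_upper)
  have sup: "{Inf S<..<Sup S} \<subseteq> S"
  proof
    fix x assume "x \<in> {Inf S<..<Sup S}"
    then obtain a b where "a \<in> S" "b \<in> S" "a < x" "x < b"
      using bd assms(3) by (auto simp: cInf_less_iff less_cSup_iff)
    then show "x \<in> S"
      using assms(1) by (meson convex_contains_segment closed_segment_subset atLeastAtMost_iff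
          closed_segment_eq_real_ivl less_imp_le mem_is_interval_1_I is_interval_convex_1)
  qed
  have le: "Inf S \<le> Sup S" using bd assms(3) by (meson cInf_le_cSup)
  have S: "S \<in> sets borel"
    using assms(1) by (simp add: is_interval_convex_1[symmetric] real_interval_borel_measurable)
  have "emeasure lborel S \<le> emeasure lborel {Inf S..Sup S}"
    using sub by (intro emeasure_mono) auto
  moreover have "emeasure lborel {Inf S<..<Sup S} \<le> emeasure lborel S"
    using sup S by (intro emeasure_mono) auto
  ultimately show ?thesis using le by simp
qed

lemma measure_bounded_convex_real:
  fixes S :: "real set"
  assumes "convex S" "bounded S" "S \<noteq> {}"
  shows "measure lborel S = Sup S - Inf S"
  using emeasure_bounded_convex_real[OF assms] assms
  by (simp add: measure_def cInf_le_cSup bounded_imp_bdd_above bounded_imp_bdd_below)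

text \<open>
  One-dimensional Brunn-Minkowski inequality for intervals, which holds because lengths are differences of
  suprema and infima. It makes chord length concave, hence symmetrization preserves convexity.
\<close>

lemma measure_convex_real_concave:
  fixes A B C :: "real set"
  assumes "convex A" "bounded A" "A \<noteq> {}" "convex B" "bounded B" "B \<noteq> {}" "convex C" "bounded C"
    and uv: "u \<ge> 0" "v \<ge> 0"
    and sub: "\<And>a b. a \<in> A \<Longrightarrow> b \<in> B \<Longrightarrow> u * a + v * b \<in> C"
  shows "u * measure lborel A + v * measure lborel B \<le> measure lborel C"
proof -
  have C: "C \<noteq> {}" using assms by blast
  have bdC: "bdd_above C" "bdd_below C"
    using assms by (auto intro: bounded_imp_bdd_above bounded_imp_bdd_below)
  have bd: "bdd_above A" "bdd_below A" "bdd_above B" "bdd_below B"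
    using assms by (auto intro: bounded_imp_bdd_above bounded_imp_bdd_below)
  have half: "u * a + v * Sup B \<le> Sup C" "Inf C \<le> u * a + v * Inf B" if a: "a \<in> A" for a
  proof -
    show "u * a + v * Sup B \<le> Sup C"
    proof (cases "v = 0")
      case True
      then show ?thesis using sub[OF a] assms(6) bdC by (auto intro!: cSup_upper)
    next
      case False
      have "Sup B \<le> (Sup C - u * a) / v"
        using False uv assms(6) cSup_upper[OF sub[OF a] bdC(1)]
        by (intro cSup_least) (auto simp: field_simps)
      then show ?thesis using False uv by (auto simp: field_simps)
    qed
    show "Inf C \<le> u * a + v * Inf B"
    proof (cases "v = 0")
      case True
      then show ?thesis using sub[OF a] assms(6) bdC by (auto intro!: cInf_lower)
    next
      case False
      have "(Inf C - u * a) / v \<le> Inf B"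
        using False uv assms(6) cInf_lower[OF sub[OF a] bdC(2)]
        by (intro cInf_greatest) (auto simp: field_simps)
      then show ?thesis using False uv by (auto simp: field_simps)
    qed
  qed
  have "u * Sup A + v * Sup B \<le> Sup C"
  proof (cases "u = 0")
    case True
    then show ?thesis using half assms(3) by auto
  next
    case False
    have "Sup A \<le> (Sup C - v * Sup B) / u"
      using False uv assms(3) half by (intro cSup_least) (auto simp: field_simps)
    then show ?thesis using False uv by (auto simp: field_simps)
  qed
  moreover have "Inf C \<le> u * Inf A + v * Inf B"
  proof (cases "u = 0")
    case True
    then show ?thesis using half assms(3) by auto
  next
    case False
    have "(Inf C - v * Inf B) / u \<le> Inf A"
      using False uv assms(3) half by (intro cInf_greatest) (auto simp: field_simps)
    then show ?thesis using False uv by (auto simp: field_simps)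
  qed
  ultimately show ?thesis
    using assms C by (simp add: measure_bounded_convex_real algebra_simps)
qed

definition chord :: "'a::euclidean_space \<Rightarrow> 'a set \<Rightarrow> 'a \<Rightarrow> real set" where
  "chord e K x = {s. x + s *\<^sub>R e \<in> K}"

text \<open>
  The strict inequality forces chords of members to be nonempty, so that concavity of chord length
  applies, and it does not change the length of any chord.
\<close>

definition steiner :: "'a::euclidean_space \<Rightarrow> 'a set \<Rightarrow> 'a set" where
  "steiner e K = {x. 2 * \<bar>x \<bullet> e\<bar> < measure lborel (chord e K x)}"

lemma emeasure_chord:
  assumes [measurable]: "K \<in> sets borel"
  shows "emeasure lborel (chord e K x) = (\<integral>\<^sup>+s. indicator K (x + s *\<^sub>R e) \<partial>lborel)"
proof -
  have "chord e K x \<in> sets lborel" unfolding chord_def by measurable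
  then have "emeasure lborel (chord e K x) = (\<integral>\<^sup>+s. indicator (chord e K x) s \<partial>lborel)" by simp
  then show ?thesis by (simp add: chord_def indicator_def)
qed

lemma chord_shift:
  assumes [measurable]: "K \<in> sets borel"
  shows "measure lborel (chord e K (x + s *\<^sub>R e)) = measure lborel (chord e K x)"
  using nn_integral_lborel_translate[of "\<lambda>t. indicator K (x + t *\<^sub>R e)" s]
  by (simp add: measure_def emeasure_chord algebra_simps)

lemma convex_chord: "convex K \<Longrightarrow> convex (chord e K x)"
proof (rule convexI)
  fix s t u v :: real
  assume *: "convex K" "s \<in> chord e K x" "t \<in> chord e K x" "0 \<le> u" "0 \<le> v" "u + v = 1"
  have "u *\<^sub>R (x + s *\<^sub>R e) + v *\<^sub>R (x + t *\<^sub>R e) \<in> K"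
    using * by (intro convexD) (auto simp: chord_def)
  also have "u *\<^sub>R (x + s *\<^sub>R e) + v *\<^sub>R (x + t *\<^sub>R e) = x + (u *\<^sub>R s + v *\<^sub>R t) *\<^sub>R e"
    using \<open>u + v = 1\<close> by (simp add: algebra_simps flip: scaleR_add_left)
  finally show "u *\<^sub>R s + v *\<^sub>R t \<in> chord e K x" by (simp add: chord_def)
qed

lemma bounded_chord:
  assumes "bounded K" "norm e = 1" shows "bounded (chord e K x)"
proof -
  obtain R where R: "\<And>y. y \<in> K \<Longrightarrow> norm y \<le> R" using assms(1) by (auto simp: bounded_iff)
  have "\<bar>s\<bar> \<le> R + norm x" if "s \<in> chord e K x" for s
    using R[of "x + s *\<^sub>R e"] that norm_triangle_ineq[of "x + s *\<^sub>R e" "- x"] assms(2) by (auto simp: chord_def)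
  then show ?thesis by (auto simp: bounded_iff)
qed

lemma measurable_chord [measurable]:
  assumes [measurable]: "K \<in> sets borel"
  shows "(\<lambda>x. measure lborel (chord e K x)) \<in> borel_measurable borel"
  unfolding measure_def emeasure_chord[OF assms] by measurable

lemma sets_steiner [measurable]: "K \<in> sets borel \<Longrightarrow> steiner e K \<in> sets borel"
  using borel_measurable_less[of "\<lambda>x. 2 * \<bar>x \<bullet> e\<bar>" borel "\<lambda>x. measure lborel (chord e K x)", OF _ measurable_chord]
  by (simp add: steiner_def)

lemma convex_steiner:
  assumes "convex K" "bounded K" "norm e = 1"
  shows "convex (steiner e K)"
proof (rule convexI)
  fix x y and u v :: real
  assume x: "x \<in> steiner e K" and y: "y \<in> steiner e K" and uv: "0 \<le> u" "0 \<le> v" "u + v = 1"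
  let ?m = "\<lambda>x. measure lborel (chord e K x)"
  have ne: "chord e K x \<noteq> {}" "chord e K y \<noteq> {}"
    using x y by (auto simp: steiner_def)
  have conc: "u * ?m x + v * ?m y \<le> ?m (u *\<^sub>R x + v *\<^sub>R y)"
  proof (rule measure_convex_real_concave)
    fix a b assume "a \<in> chord e K x" "b \<in> chord e K y"
    then have "u *\<^sub>R (x + a *\<^sub>R e) + v *\<^sub>R (y + b *\<^sub>R e) \<in> K"
      using assms(1) uv by (intro convexD) (auto simp: chord_def)
    then show "u * a + v * b \<in> chord e K (u *\<^sub>R x + v *\<^sub>R y)"
      by (simp add: chord_def algebra_simps)
  qed (use ne uv convex_chord[OF assms(1)] bounded_chord[OF assms(2,3)] in auto)
  have xy: "2 * \<bar>x \<bullet> e\<bar> < ?m x" "2 * \<bar>y \<bullet> e\<bar> < ?m y" using x y by (auto simp: steiner_def)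
  have "2 * \<bar>(u *\<^sub>R x + v *\<^sub>R y) \<bullet> e\<bar> \<le> u * (2 * \<bar>x \<bullet> e\<bar>) + v * (2 * \<bar>y \<bullet> e\<bar>)"
    using uv abs_triangle_ineq[of "u * (x \<bullet> e)" "v * (y \<bullet> e)"] by (simp add: inner_add_left abs_mult)
  also have "\<dots> < u * ?m x + v * ?m y"
  proof (cases "u = 0")
    case True
    then show ?thesis using xy uv by simp
  next
    case False
    then show ?thesis using xy uv by (intro add_less_le_mono mult_strict_left_mono mult_left_mono) auto
  qed
  finally show "u *\<^sub>R x + v *\<^sub>R y \<in> steiner e K" using conc by (simp add: steiner_def)
qed

text \<open>
  A member \<open>x\<close> lies on a line in direction \<open>e\<close> that meets \<open>K\<close>, and its component along \<open>e\<close> is at most half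
  the length of a chord of \<open>K\<close>.
\<close>

lemma bounded_steiner:
  assumes "convex K" "bounded K" "norm e = 1"
  shows "bounded (steiner e K)"
proof -
  obtain R where R: "\<And>y. y \<in> K \<Longrightarrow> norm y \<le> R" using assms(2) by (auto simp: bounded_iff)
  have "norm x \<le> 3 * R" if x: "x \<in> steiner e K" for x
  proof -
    have ne: "chord e K x \<noteq> {}" using x by (auto simp: steiner_def)
    have ee: "e \<bullet> e = 1" using assms(3) by (simp add: norm_eq_1)
    have s: "\<bar>x \<bullet> e + s\<bar> \<le> R \<and> norm (x + s *\<^sub>R e) \<le> R" if "s \<in> chord e K x" for s
      using R[of "x + s *\<^sub>R e"] that Cauchy_Schwarz_ineq2[of "x + s *\<^sub>R e" e] assms(3)
      by (auto simp: chord_def inner_add_left ee)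
    have "Sup (chord e K x) \<le> R - x \<bullet> e"
      using s by (intro cSup_least[OF ne]) (fastforce simp: abs_le_iff)
    moreover have "- R - x \<bullet> e \<le> Inf (chord e K x)"
      using s by (intro cInf_greatest[OF ne]) (fastforce simp: abs_le_iff)
    ultimately have "measure lborel (chord e K x) \<le> 2 * R"
      using assms ne by (simp add: measure_bounded_convex_real convex_chord bounded_chord)
    then have 1: "\<bar>x \<bullet> e\<bar> \<le> R" using x by (auto simp: steiner_def)
    obtain t where t: "t \<in> chord e K x" using ne by auto
    have "\<bar>t\<bar> \<le> 2 * R" using s[OF t] 1 by linarith
    moreover have "norm x \<le> norm (x + t *\<^sub>R e) + norm (t *\<^sub>R e)"
      using norm_triangle_ineq4[of "x + t *\<^sub>R e" "t *\<^sub>R e"] by simp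
    ultimately show ?thesis using s[OF t] assms(3) by simp
  qed
  then show ?thesis by (auto simp: bounded_iff)
qed

text \<open>
  Each chord is replaced by an interval of the same length, centred at the hyperplane orthogonal to \<open>e\<close>.
\<close>

lemma chord_steiner:
  assumes K[measurable]: "K \<in> sets borel" and "convex K" "bounded K" "norm e = 1"
  shows "(\<integral>\<^sup>+s. indicator (steiner e K) (x + s *\<^sub>R e) \<partial>lborel) = (\<integral>\<^sup>+s. indicator K (x + s *\<^sub>R e) \<partial>lborel)"
proof -
  let ?m = "measure lborel (chord e K x)"
  have ee: "e \<bullet> e = 1" using assms(4) by (simp add: norm_eq_1)
  have "(\<integral>\<^sup>+s. indicator (steiner e K) (x + s *\<^sub>R e) \<partial>lborel)
      = (\<integral>\<^sup>+s. indicator {- ?m / 2 - x \<bullet> e <..< ?m / 2 - x \<bullet> e} s \<partial>lborel)"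
  proof (rule nn_integral_cong)
    fix s
    have "x + s *\<^sub>R e \<in> steiner e K \<longleftrightarrow> s \<in> {- ?m / 2 - x \<bullet> e <..< ?m / 2 - x \<bullet> e}"
    proof -
      have "2 * \<bar>p + s\<bar> < m \<longleftrightarrow> - m / 2 - p < s \<and> s < m / 2 - p" for p m :: real
        by (cases "p + s \<ge> 0") (auto simp: field_simps)
      then show ?thesis
        unfolding steiner_def mem_Collect_eq chord_shift[OF K] inner_add_left inner_scaleR_left ee by simp
    qed
    then show "indicator (steiner e K) (x + s *\<^sub>R e) = (indicator {- ?m / 2 - x \<bullet> e <..< ?m / 2 - x \<bullet> e} s :: ennreal)"
      by (simp add: indicator_def)
  qed
  also have "\<dots> = ennreal ?m" by simp
  also have "\<dots> = emeasure lborel (chord e K x)"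
    using emeasure_bounded_finite[OF bounded_chord[OF assms(3,4)], of x]
    by (intro emeasure_eq_ennreal_measure[symmetric]) (auto simp: less_top)
  also have "\<dots> = (\<integral>\<^sup>+s. indicator K (x + s *\<^sub>R e) \<partial>lborel)"
    by (rule emeasure_chord) fact
  finally show ?thesis .
qed

definition reflection :: "'a::euclidean_space \<Rightarrow> 'a \<Rightarrow> 'a" where
  "reflection b x = x - (2 * (x \<bullet> b)) *\<^sub>R b"

lemma steiner_uminus:
  assumes [measurable]: "K \<in> sets borel" and "\<And>x. x \<in> K \<Longrightarrow> - x \<in> K" and "x \<in> steiner e K"
  shows "- x \<in> steiner e K"
proof -
  have iff: "- z \<in> K \<longleftrightarrow> z \<in> K" for z using assms(2)[of z] assms(2)[of "- z"] by auto
  have "emeasure lborel (chord e K (- x)) = (\<integral>\<^sup>+s. indicator K (- x + (0 - s) *\<^sub>R e) \<partial>lborel)"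
    unfolding emeasure_chord[OF assms(1)] by (rule nn_integral_lborel_reflect[symmetric]) measurable
  also have "\<dots> = emeasure lborel (chord e K x)"
    unfolding emeasure_chord[OF assms(1)] using iff[of "x + _ *\<^sub>R e"]
    by (intro nn_integral_cong) (simp add: indicator_def)
  finally show ?thesis using assms(3) by (simp add: steiner_def measure_def)
qed

lemma steiner_reflection_self:
  assumes "K \<in> sets borel" "norm e = 1" "x \<in> steiner e K"
  shows "reflection e x \<in> steiner e K"
proof -
  have "e \<bullet> e = 1" using assms(2) by (simp add: norm_eq_1)
  then show ?thesis
    using assms(3) chord_shift[OF assms(1), of e x "- (2 * (x \<bullet> e))"]
    by (simp add: steiner_def reflection_def inner_diff_left)
qed

lemma steiner_reflection_orthogonal:
  assumes "\<And>x. x \<in> K \<Longrightarrow> reflection b x \<in> K" "norm b = 1" "orthogonal e b" "x \<in> steiner e K"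
  shows "reflection b x \<in> steiner e K"
proof -
  have bb: "b \<bullet> b = 1" using assms(2) by (simp add: norm_eq_1)
  have eb: "e \<bullet> b = 0" "b \<bullet> e = 0" using assms(3) by (auto simp: orthogonal_def inner_commute)
  have invol: "reflection b (reflection b z) = z" for z
    by (simp add: reflection_def inner_diff_left bb)
  have iff: "reflection b z \<in> K \<longleftrightarrow> z \<in> K" for z
    using assms(1)[of z] assms(1)[of "reflection b z"] invol by auto
  have "chord e K (reflection b x) = chord e K x"
    unfolding chord_def
  proof (intro Collect_cong)
    fix s
    have "reflection b x + s *\<^sub>R e = reflection b (x + s *\<^sub>R e)"
      by (simp add: reflection_def inner_add_left eb)
    then show "(reflection b x + s *\<^sub>R e \<in> K) = (x + s *\<^sub>R e \<in> K)" by (simp add: iff)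
  qed
  then show ?thesis using assms(4) by (simp add: steiner_def reflection_def inner_diff_left eb)
qed

text \<open>
  Symmetrizing in one direction keeps the reflections in orthogonal directions, so successive symmetrization in
  all directions of \<open>B\<close> collects all reflections without changing the measure of any section parallel to \<open>span B\<close>.
\<close>

lemma steiner_symmetrization_exists:
  fixes B :: "'a::euclidean_space set"
  assumes "finite B" "\<And>b. b \<in> B \<Longrightarrow> norm b = 1" "pairwise orthogonal B"
    and "K \<in> sets borel" "convex K" "bounded K" "\<And>x. x \<in> K \<Longrightarrow> - x \<in> K"
  shows "\<exists>S. S \<in> sets borel \<and> convex S \<and> bounded S \<and> (\<forall>x\<in>S. - x \<in> S)
    \<and> (\<forall>b\<in>B. \<forall>x\<in>S. reflection b x \<in> S) \<and> (\<forall>y. fiber_integral B S y = fiber_integral B K y)"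
  using assms(1-3)
proof (induction B)
  case empty
  then show ?case using assms(4-7) by auto
next
  case (insert e B)
  then obtain S where S: "S \<in> sets borel" "convex S" "bounded S" "\<And>x. x \<in> S \<Longrightarrow> - x \<in> S"
     "\<And>b x. b \<in> B \<Longrightarrow> x \<in> S \<Longrightarrow> reflection b x \<in> S" "\<And>y. fiber_integral B S y = fiber_integral B K y"
    by (auto simp: pairwise_insert)
  have e: "norm e = 1" "\<And>b. b \<in> B \<Longrightarrow> orthogonal e b" "\<And>b. b \<in> B \<Longrightarrow> norm b = 1"
    using insert.prems insert.hyps by (auto simp: pairwise_insert)
  have "fiber_integral (insert e B) (steiner e S) y = fiber_integral (insert e B) K y" for y
  proof -
    have "fiber_integral (insert e B) (steiner e S) y = fiber_integral (insert e B) S y"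
      using insert.hyps S
      by (simp add: fiber_integral_insert(2) sets_steiner chord_steiner e(1))
    also have "\<dots> = fiber_integral (insert e B) K y"
      using insert.hyps S assms(4) by (simp add: fiber_integral_insert(1))
    finally show ?thesis .
  qed
  then show ?case
    using S e
    by (intro exI[of _ "steiner e S"])
       (auto simp: sets_steiner convex_steiner bounded_steiner steiner_uminus steiner_reflection_self
         intro: steiner_reflection_orthogonal)
qed

text \<open>
  The consequence of the Brunn-Minkowski inequality that is needed. For a body \<open>S\<close> symmetric under all
  reflections in \<open>B\<close> as well as under \<open>x \<mapsto> -x\<close>, membership of \<open>y + h\<close> implies that of \<open>-y + h\<close>, and so
  convexity gives the midpoint \<open>h\<close>: the section at \<open>y\<close> is contained in the central one.
\<close>

lemma fiber_integral_central_max: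
  fixes B :: "'a::euclidean_space set"
  assumes B: "finite B" "\<And>b. b \<in> B \<Longrightarrow> norm b = 1" "pairwise orthogonal B"
    and K: "K \<in> sets borel" "convex K" "bounded K" "\<And>x. x \<in> K \<Longrightarrow> - x \<in> K"
    and y: "\<And>b. b \<in> B \<Longrightarrow> y \<bullet> b = 0"
  shows "fiber_integral B K y \<le> fiber_integral B K 0"
proof -
  obtain S where S: "S \<in> sets borel" "convex S" "bounded S" "\<And>x. x \<in> S \<Longrightarrow> - x \<in> S"
     "\<And>b x. b \<in> B \<Longrightarrow> x \<in> S \<Longrightarrow> reflection b x \<in> S" "\<And>y. fiber_integral B S y = fiber_integral B K y"
    using steiner_symmetrization_exists[OF B K] by auto
  have "(\<Sum>b\<in>B. f b *\<^sub>R b) \<in> S" if f: "y + (\<Sum>b\<in>B. f b *\<^sub>R b) \<in> S" for f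
  proof -
    let ?h = "\<Sum>b\<in>B. f b *\<^sub>R b"
    have inner: "(\<Sum>b\<in>A. f b *\<^sub>R b) \<bullet> c = (if c \<in> A then f c else 0)" if "A \<subseteq> B" "c \<in> B" for A c
    proof -
      have "(\<Sum>b\<in>A. f b *\<^sub>R b) \<bullet> c = (\<Sum>b\<in>A. if b = c then f c else 0)"
        unfolding inner_sum_left
      proof (rule sum.cong)
        fix b assume "b \<in> A"
        then show "f b *\<^sub>R b \<bullet> c = (if b = c then f c else 0)"
          using B(2)[of c] B(3) that by (auto simp: pairwise_def orthogonal_def norm_eq_1)
      qed simp
      also have "\<dots> = (if c \<in> A then f c else 0)"
        using finite_subset[OF that(1) B(1)] by simp
      finally show ?thesis .
    qed
    \<comment> \<open>Reflecting \<open>-(y + h)\<close> in the members of \<open>A\<close> flips the corresponding components of \<open>-h\<close>.\<close>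
    have "- y - ?h + 2 *\<^sub>R (\<Sum>b\<in>A. f b *\<^sub>R b) \<in> S" if "finite A" "A \<subseteq> B" for A
      using that
    proof (induction A)
      case empty
      show ?case using S(4)[OF f] by simp
    next
      case (insert c A)
      let ?z = "- y - ?h + 2 *\<^sub>R (\<Sum>b\<in>A. f b *\<^sub>R b)"
      have "?z \<bullet> c = - f c"
        using insert y[of c] by (simp add: inner_add_left inner_diff_left inner)
      then have "reflection c ?z = - y - ?h + 2 *\<^sub>R (\<Sum>b\<in>insert c A. f b *\<^sub>R b)"
        using insert by (simp only: reflection_def) (simp add: algebra_simps)
      then show ?case using S(5)[of c ?z] insert by auto
    qed
    from this[of B] have "- y + ?h \<in> S" using B(1) by (simp add: algebra_simps scaleR_2)
    then have "(1/2) *\<^sub>R (y + ?h) + (1/2) *\<^sub>R (- y + ?h) \<in> S"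
      using f S(2) by (intro convexD) auto
    also have "(1/2) *\<^sub>R (y + ?h) + (1/2) *\<^sub>R (- y + ?h) = ?h"
      by (simp add: algebra_simps flip: scaleR_add_left)
    finally show ?thesis .
  qed
  then have "fiber_integral B S y \<le> fiber_integral B S 0"
    unfolding fiber_integral_def by (intro nn_integral_mono) (auto simp: indicator_def)
  then show ?thesis by (simp add: S(6))
qed

section \<open>Lebesgue measure on a subspace\<close>

lemma fiber_integral_cball:
  fixes B :: "'a::euclidean_space set"
  assumes B: "finite B" "\<And>b. b \<in> B \<Longrightarrow> norm b = 1" "pairwise orthogonal B" and "r > 0"
  shows "fiber_integral B (cball 0 r) 0 = ennreal (unit_ball_vol (card B) * r ^ card B)"
proof -
  let ?P = "\<Pi>\<^sub>M b\<in>B. (lborel :: real measure)"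
  have norm: "norm (\<Sum>b\<in>B. f b *\<^sub>R b) = sqrt (\<Sum>b\<in>B. (f b)\<^sup>2)" for f
  proof -
    have "(norm (\<Sum>b\<in>B. f b *\<^sub>R b))\<^sup>2 = (\<Sum>b\<in>B. (norm (f b *\<^sub>R b))\<^sup>2)"
      using B by (intro norm_sum_Pythagorean) (auto simp: pairwise_def orthogonal_clauses)
    also have "\<dots> = (\<Sum>b\<in>B. (f b)\<^sup>2)" using B by (intro sum.cong) auto
    finally show ?thesis by (metis norm_ge_zero real_sqrt_unique)
  qed
  have "fiber_integral B (cball 0 r) 0 = (\<integral>\<^sup>+f. indicator ({f. sqrt (\<Sum>i\<in>B. (f i)\<^sup>2) \<le> r} \<inter> space ?P) f \<partial>?P)"
    unfolding fiber_integral_def by (intro nn_integral_cong) (simp add: indicator_def norm)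
  also have "\<dots> = emeasure ?P ({f. sqrt (\<Sum>i\<in>B. (f i)\<^sup>2) \<le> r} \<inter> space ?P)"
    by (rule nn_integral_indicator) measurable
  finally show ?thesis using emeasure_cball_aux[OF B(1) assms(4)] by simp
qed

text \<open>
  A linear parametrization \<open>g\<close> of \<open>span B\<close> transports the product measure along \<open>B\<close> to a translation
  invariant measure, hence to a multiple of Lebesgue measure. The factor is the Jacobian of \<open>g\<close>.
\<close>

lemma fiber_integral_eq_lborel:
  fixes B :: "'a::euclidean_space set" and g :: "'e::euclidean_space \<Rightarrow> 'a"
  assumes B: "finite B" "\<And>b. b \<in> B \<Longrightarrow> norm b = 1" "pairwise orthogonal B"
    and g: "linear g" "inj g" and span: "span B = range g"
  shows "\<exists>c>0. \<forall>K\<in>sets borel. \<forall>y. fiber_integral B K y = ennreal c * (\<integral>\<^sup>+x. indicator K (y + g x) \<partial>lborel)"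
proof -
  let ?P = "\<Pi>\<^sub>M b\<in>B. (lborel :: real measure)"
  let ?S = "\<lambda>f. \<Sum>b\<in>B. f b *\<^sub>R b"
  let ?D = "cball 0 1 :: 'e set"
  obtain g' where g': "linear g'" "g' \<circ> g = id" using linear_injective_left_inverse[OF g] by auto
  have [measurable]: "g \<in> borel_measurable borel" "g' \<in> borel_measurable borel"
    using g(1) g'(1) by (auto intro!: borel_measurable_continuous_onI linear_continuous_on simp: linear_linear)
  have [measurable]: "?S \<in> borel_measurable ?P" by measurable
  have gg': "g (g' z) = z" if "z \<in> span B" for z
    using that g'(2) by (auto simp: span fun_eq_iff)
  have S: "?S f \<in> span B" for f by (intro span_sum span_scale span_base)
  define N where "N = distr ?P borel (\<lambda>f. g' (?S f))"
  have N: "emeasure N A = fiber_integral B (g' -` A) 0" if "A \<in> sets borel" for A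
  proof -
    have "emeasure N A = (\<integral>\<^sup>+f. indicator A (g' (?S f)) \<partial>?P)"
    proof -
      have [measurable]: "A \<in> sets borel" by fact
      have "emeasure N A = (\<integral>\<^sup>+x. indicator A x \<partial>N)"
        using that by (intro nn_integral_indicator[symmetric]) (simp add: N_def)
      also have "\<dots> = (\<integral>\<^sup>+f. indicator A (g' (?S f)) \<partial>?P)"
        unfolding N_def by (rule nn_integral_distr) measurable
      finally show ?thesis .
    qed
    then show ?thesis by (simp add: fiber_integral_def indicator_def)
  qed
  have pre: "g' -` A \<in> sets borel" if "A \<in> sets borel" for A
    using measurable_sets_borel[of g' borel A] that by simp
  have inv: "distr N borel (\<lambda>x. x + a) = N" for a
  proof (rule measure_eqI)
    fix A assume "A \<in> sets (distr N borel (\<lambda>x. x + a))"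
    then have A[measurable]: "A \<in> sets borel" by simp
    have "g a \<in> span B" using span by auto
    then obtain c where c: "g a = ?S c"
      using B(1) by (auto simp: span_finite)
    have "g' (0 + ?S c + z) = a + g' z" for z
      using g'(2) by (auto simp: c[symmetric] linear_add[OF g'(1)] fun_eq_iff)
    then have 1: "fiber_integral B {z. g' z + a \<in> A} 0 = fiber_integral B (g' -` A) (0 + ?S c)"
      unfolding fiber_integral_def by (intro nn_integral_cong) (simp add: indicator_def add.commute)
    have "emeasure (distr N borel (\<lambda>x. x + a)) A = emeasure N ((\<lambda>x. x + a) -` A)"
      by (subst emeasure_distr) (auto simp: N_def)
    also have "\<dots> = fiber_integral B (g' -` A) (0 + ?S c)"
      using 1 measurable_sets_borel[of "\<lambda>x. x + a" borel A] by (subst N) (auto simp: vimage_def)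
    also have "\<dots> = emeasure N A"
      by (subst fiber_integral_translate[OF B(1) pre]) (auto simp: N)
    finally show "emeasure (distr N borel (\<lambda>x. x + a)) A = emeasure N A" .
  qed (simp add: N_def)
  have fin: "emeasure N (cball 0 r) < \<infinity>" for r
  proof -
    obtain C where C: "C > 0" "\<And>x. norm (g x) \<le> C * norm x"
      using linear_bounded_pos[OF g(1)] by auto
    have "\<bar>r\<bar> + 1 > 0" by simp
    have "?S f \<in> cball 0 (C * (\<bar>r\<bar> + 1))" if "g' (?S f) \<in> cball 0 r" for f
    proof -
      have "norm (?S f) \<le> C * norm (g' (?S f))" using C(2)[of "g' (?S f)"] gg'[OF S] by simp
      also have "\<dots> \<le> C * (\<bar>r\<bar> + 1)" using that C(1) by (intro mult_left_mono) auto
      finally show ?thesis by simp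
    qed
    then have "emeasure N (cball 0 r) \<le> fiber_integral B (cball 0 (C * (\<bar>r\<bar> + 1))) 0"
      unfolding N[OF borel_closed[OF closed_cball]] fiber_integral_def
      by (intro nn_integral_mono) (auto simp: indicator_def)
    also have "\<dots> < \<infinity>" using C by (subst fiber_integral_cball[OF B]) auto
    finally show ?thesis .
  qed
  have proportional: "emeasure N A * emeasure lborel ?D = emeasure N ?D * emeasure lborel A" if "A \<in> sets borel" for A
    using that by (intro translation_invariant_proportional fin inv) (simp_all add: N_def)
  define d where "d = unit_ball_vol (DIM('e))"
  have d: "d > 0" "emeasure lborel ?D = ennreal d" by (simp_all add: d_def emeasure_cball)
  obtain n where n: "n \<ge> 0" "emeasure N ?D = ennreal n" using fin[of 1] by (cases "emeasure N ?D") auto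
  \<comment> \<open>Otherwise the whole measure would vanish, but the unit ball of the span has positive volume.\<close>
  have "n \<noteq> 0"
  proof
    assume "n = 0"
    have [measurable]: "{x. norm (g x) \<le> 1} \<in> sets borel" by measurable
    have "emeasure N {x. norm (g x) \<le> 1} * ennreal d = 0" using proportional[of "{x. norm (g x) \<le> 1}"] n d \<open>n = 0\<close> by simp
    then have "emeasure N {x. norm (g x) \<le> 1} = 0" using d by simp
    moreover have "emeasure N {x. norm (g x) \<le> 1} = fiber_integral B (cball 0 1) 0"
      unfolding N[OF \<open>{x. norm (g x) \<le> 1} \<in> sets borel\<close>] fiber_integral_def
      by (intro nn_integral_cong) (simp add: indicator_def gg'[OF S])
    ultimately show False using fiber_integral_cball[OF B, of 1] unit_ball_vol_pos[of "card B"]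
      by (simp del: unit_ball_vol_pos)
  qed
  then have n0: "n > 0" using n by simp
  have main: "emeasure N A = ennreal (n / d) * emeasure lborel A" if "A \<in> sets borel" for A
  proof -
    have "ennreal n = ennreal d * ennreal (n / d)" using d(1) n(1) by (simp flip: ennreal_mult)
    then have "emeasure N A * ennreal d = ennreal (n / d) * emeasure lborel A * ennreal d"
      using proportional[OF that] by (simp only: n(2) d(2) mult_ac)
    then show ?thesis using d by (simp add: mult_right_ennreal_cancel)
  qed
  have "fiber_integral B K y = ennreal (n / d) * (\<integral>\<^sup>+x. indicator K (y + g x) \<partial>lborel)"
    if [measurable]: "K \<in> sets borel" for K y
  proof -
    have m: "{x. y + g x \<in> K} \<in> sets borel" by measurable
    have "fiber_integral B K y = emeasure N {x. y + g x \<in> K}"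
      unfolding N[OF m] fiber_integral_def by (intro nn_integral_cong) (simp add: indicator_def gg'[OF S])
    also have "\<dots> = ennreal (n / d) * (\<integral>\<^sup>+x. indicator {x. y + g x \<in> K} x \<partial>lborel)"
      using m by (simp add: main)
    finally show ?thesis by (simp add: indicator_def)
  qed
  then show ?thesis using n0 d by (intro exI[of _ "n / d"]) auto
qed

lemma orthonormal_basis_ofD:
  assumes "orthonormal_basis_of S B"
  shows "finite B" "\<And>b. b \<in> B \<Longrightarrow> norm b = 1" "pairwise orthogonal B" "span B = S" "card B = dim S"
proof -
  show 1: "\<And>b. b \<in> B \<Longrightarrow> norm b = 1" "pairwise orthogonal B" "span B = S"
    using assms by (auto simp: orthonormal_basis_of_def)
  have "0 \<notin> B" using 1(1)[of 0] by auto
  then have ind: "independent B" by (rule pairwise_orthogonal_independent[OF 1(2)])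
  then show "finite B" by (rule independent_imp_finite)
  show "card B = dim S" using dim_span_eq_card_independent[OF ind] 1(3) by simp
qed

text \<open>
  Orthogonality is removed by splitting \<open>y\<close> into a component in the range of \<open>g\<close>, which only shifts the
  integration variable, and an orthogonal one.
\<close>

lemma section_central_max:
  fixes g :: "'e::euclidean_space \<Rightarrow> 'a::euclidean_space"
  assumes g: "linear g" "inj g"
    and K: "K \<in> sets borel" "convex K" "bounded K" "\<forall>x\<in>K. - x \<in> K"
  shows "(\<integral>\<^sup>+x. indicator K (y + g x) \<partial>lborel) \<le> (\<integral>\<^sup>+x. indicator K (g x) \<partial>lborel)"
proof -
  have sub: "subspace (range g)" using linear_subspace_image[OF g(1) subspace_UNIV] .
  obtain B where "orthonormal_basis_of (range g) B" using orthonormal_basis_of_exists[OF sub] by auto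
  note B = orthonormal_basis_ofD[OF this]
  obtain c where c: "c > 0"
    "\<And>K y. K \<in> sets borel \<Longrightarrow> fiber_integral B K y = ennreal c * (\<integral>\<^sup>+x. indicator K (y + g x) \<partial>lborel)"
    using fiber_integral_eq_lborel[OF B(1-3) g B(4)] by blast
  obtain p q where pq: "p \<in> span (range g)" "\<And>w. w \<in> span (range g) \<Longrightarrow> orthogonal q w" "y = p + q"
    by (rule orthogonal_subspace_decomp_exists[of "range g" y]) blast
  have spB: "span (range g) = span B" using span_span[of B] by (simp add: B(4))
  have "p \<in> span B" using pq(1) by (simp add: spB)
  then obtain a where a: "p = (\<Sum>b\<in>B. a b *\<^sub>R b)" using B(1) by (auto simp: span_finite)
  have "fiber_integral B K y = fiber_integral B K q"
    using fiber_integral_translate[OF B(1) K(1), of q a] by (simp add: pq(3) a add.commute)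
  also have "\<dots> \<le> fiber_integral B K 0"
  proof (rule fiber_integral_central_max[OF B(1-3) K(1-3) bspec[OF K(4)]])
    fix b assume "b \<in> B"
    then have "b \<in> span (range g)" by (simp add: spB span_base)
    then show "q \<bullet> b = 0" using pq(2) by (simp add: orthogonal_def)
  qed
  finally have "ennreal (inverse c) * (ennreal c * (\<integral>\<^sup>+x. indicator K (y + g x) \<partial>lborel))
      \<le> ennreal (inverse c) * (ennreal c * (\<integral>\<^sup>+x. indicator K (0 + g x) \<partial>lborel))"
    unfolding c(2)[OF K(1)] by (rule mult_left_mono) simp
  moreover have "ennreal (inverse c) * (ennreal c * z) = z" for z
  proof -
    have "ennreal (inverse c) * ennreal c = 1" using c(1) by (simp flip: ennreal_mult)
    then show ?thesis by (metis mult.assoc mult_1)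
  qed
  ultimately show ?thesis by simp
qed

text \<open>
  The factor \<open>c\<close> depends on \<open>g\<close> only, so it cancels when sections of several sets by one subspace are compared. Sections
  of centred balls keep their Euclidean volume, which lets a ball represent a prescribed section volume.
\<close>

lemma emeasure_subspace_lborel_range:
  fixes g :: "'e::euclidean_space \<Rightarrow> 'a::euclidean_space"
  assumes g: "linear g" "inj g"
  shows "\<exists>c>0. \<forall>K\<in>sets borel. emeasure (subspace_lborel (range g)) K = ennreal c * (\<integral>\<^sup>+x. indicator K (g x) \<partial>lborel)"
    and "r > 0 \<Longrightarrow> emeasure (subspace_lborel (range g)) (cball 0 r) = ennreal (unit_ball_vol DIM('e) * r ^ DIM('e))"
proof -
  have sub: "subspace (range g)" using linear_subspace_image[OF g(1) subspace_UNIV] .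
  define B where "B = (SOME B. orthonormal_basis_of (range g) B)"
  have "orthonormal_basis_of (range g) B"
    unfolding B_def using orthonormal_basis_of_exists[OF sub] by (rule someI_ex)
  note B = orthonormal_basis_ofD[OF this]
  have sf: "emeasure (subspace_lborel (range g)) K = fiber_integral B K 0" if K[measurable]: "K \<in> sets borel" for K
  proof -
    let ?P = "\<Pi>\<^sub>M b\<in>B. (lborel :: real measure)"
    let ?S = "\<lambda>f. \<Sum>b\<in>B. f b *\<^sub>R b"
    have [measurable]: "?S \<in> borel_measurable ?P" by measurable
    have "emeasure (distr ?P borel ?S) K = (\<integral>\<^sup>+x. indicator K x \<partial>distr ?P borel ?S)"
      using K by (intro nn_integral_indicator[symmetric]) simp
    also have "\<dots> = (\<integral>\<^sup>+f. indicator K (?S f) \<partial>?P)"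
      by (rule nn_integral_distr) measurable
    finally show ?thesis
      by (simp add: subspace_lborel_def B_def[symmetric] Let_def fiber_integral_def)
  qed
  obtain c where c: "c > 0"
    "\<And>K y. K \<in> sets borel \<Longrightarrow> fiber_integral B K y = ennreal c * (\<integral>\<^sup>+x. indicator K (y + g x) \<partial>lborel)"
    using fiber_integral_eq_lborel[OF B(1-3) g B(4)] by blast
  show "\<exists>c>0. \<forall>K\<in>sets borel. emeasure (subspace_lborel (range g)) K = ennreal c * (\<integral>\<^sup>+x. indicator K (g x) \<partial>lborel)"
    using c(1) by (intro exI[of _ c] conjI ballI) (simp_all add: sf c(2))
  have "card B = DIM('e)" using B(5) dim_image_eq[OF g(1), of UNIV] g(2) by simp
  then show "emeasure (subspace_lborel (range g)) (cball 0 r) = ennreal (unit_ball_vol DIM('e) * r ^ DIM('e))" if "r > 0"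
    using fiber_integral_cball[OF B(1-3) that] by (simp add: sf)
qed

section \<open>Points and planes in complex three-space\<close>

text \<open>
  Projection to \<open>(u, w)\<close> makes every section of \<open>D\<close> by a plane \<open>v = m u + b w\<close> a subset of the same space; the
  measure obtained is the intrinsic one divided by \<open>1 + \<bar>m\<bar>\<^sup>2 + \<bar>b\<bar>\<^sup>2\<close>.
\<close>

definition plane_area :: "(complex \<times> complex \<times> complex) set \<Rightarrow> complex \<Rightarrow> complex \<Rightarrow> ennreal" where
  "plane_area D m b = (\<integral>\<^sup>+u. \<integral>\<^sup>+w. indicator D (u, m * u + b * w, w) \<partial>lborel \<partial>lborel)"

lemma measurable_plane_area [measurable (raw)]:
  assumes [measurable]: "D \<in> sets borel" "f \<in> borel_measurable M" "g \<in> borel_measurable M"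
  shows "(\<lambda>x. plane_area D (f x) (g x)) \<in> borel_measurable M"
  unfolding plane_area_def by measurable

text \<open>
  Integrating over all planes and then over the points of each plane is the same as integrating over all points
  \<open>(u, v, w)\<close> and then over the planes through each point, which are indexed by the slope \<open>m\<close> because
  \<open>b = (v - m u) / w\<close> is then determined; \<open>1/\<bar>w\<bar>\<^sup>2\<close> is the Jacobian of the substitution of \<open>v\<close> for \<open>b\<close>. The convention
  \<open>1/0 = 0\<close> concerns the null set \<open>w = 0\<close>.
\<close>

lemma point_plane_duality:
  assumes [measurable]: "D \<in> sets borel" and [measurable]: "case_prod G \<in> borel_measurable (borel \<Otimes>\<^sub>M borel)"
  shows "(\<integral>\<^sup>+m. \<integral>\<^sup>+b. plane_area D m b * G m b \<partial>lborel \<partial>lborel)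
    = (\<integral>\<^sup>+u. \<integral>\<^sup>+v. \<integral>\<^sup>+w. indicator D (u, v, w) * ennreal (1 / (norm w)\<^sup>2)
         * (\<integral>\<^sup>+m. G m ((v - m * u) / w) \<partial>lborel) \<partial>lborel \<partial>lborel \<partial>lborel)"
proof -
  let ?F = "\<lambda>m u v w. indicator D (u, v, w) * ennreal (1 / (norm w)\<^sup>2) * G m ((v - m * u) / w)"
  have "(\<integral>\<^sup>+m. \<integral>\<^sup>+b. plane_area D m b * G m b \<partial>lborel \<partial>lborel)
     = (\<integral>\<^sup>+m. \<integral>\<^sup>+b. \<integral>\<^sup>+u. \<integral>\<^sup>+w. indicator D (u, m * u + b * w, w) * G m b \<partial>lborel \<partial>lborel \<partial>lborel \<partial>lborel)"
    unfolding plane_area_def by (simp add: nn_integral_multc)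
  also have "\<dots> = (\<integral>\<^sup>+m. \<integral>\<^sup>+u. \<integral>\<^sup>+w. \<integral>\<^sup>+b. indicator D (u, m * u + b * w, w) * G m b \<partial>lborel \<partial>lborel \<partial>lborel \<partial>lborel)"
    by (intro nn_integral_cong nn_integral_rotate) measurable
  also have "\<dots> = (\<integral>\<^sup>+m. \<integral>\<^sup>+u. \<integral>\<^sup>+w. \<integral>\<^sup>+v. ?F m u v w \<partial>lborel \<partial>lborel \<partial>lborel \<partial>lborel)"
  proof (rule nn_integral_cong, rule nn_integral_cong)
    fix m u :: complex
    show "(\<integral>\<^sup>+w. \<integral>\<^sup>+b. indicator D (u, m * u + b * w, w) * G m b \<partial>lborel \<partial>lborel)
      = (\<integral>\<^sup>+w. \<integral>\<^sup>+v. ?F m u v w \<partial>lborel \<partial>lborel)"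
    proof (rule nn_integral_cong_AE, use AE_lborel_singleton[of "0::complex"] in eventually_elim)
      fix w :: complex assume w: "w \<noteq> 0"
      have "(\<integral>\<^sup>+v. ?F m u v w \<partial>lborel)
         = ennreal ((norm w)\<^sup>2) * (\<integral>\<^sup>+b. ?F m u (m * u + w * b) w \<partial>lborel)"
        by (rule nn_integral_complex_affine[OF _ w]) measurable
      also have "\<dots> = (\<integral>\<^sup>+b. ennreal ((norm w)\<^sup>2) * (?F m u (m * u + w * b) w) \<partial>lborel)"
        by (rule nn_integral_cmult[symmetric]) measurable
      also have "\<dots> = (\<integral>\<^sup>+b. indicator D (u, m * u + b * w, w) * G m b \<partial>lborel)"
      proof (intro nn_integral_cong)
        fix b
        have "ennreal ((norm w)\<^sup>2) * ennreal (1 / (norm w)\<^sup>2) = 1" using w by (simp flip: ennreal_mult)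
        then show "ennreal ((norm w)\<^sup>2) * (?F m u (m * u + w * b) w)
          = indicator D (u, m * u + b * w, w) * G m b"
          using w by (simp add: mult_ac indicator_def)
      qed
      finally show "(\<integral>\<^sup>+b. indicator D (u, m * u + b * w, w) * G m b \<partial>lborel)
        = (\<integral>\<^sup>+v. ?F m u v w \<partial>lborel)" ..
    qed
  qed
  also have "\<dots> = (\<integral>\<^sup>+u. \<integral>\<^sup>+m. \<integral>\<^sup>+w. \<integral>\<^sup>+v. ?F m u v w \<partial>lborel \<partial>lborel \<partial>lborel \<partial>lborel)"
    by (rule nn_integral_swap) measurable
  also have "\<dots> = (\<integral>\<^sup>+u. \<integral>\<^sup>+v. \<integral>\<^sup>+w. \<integral>\<^sup>+m. ?F m u v w \<partial>lborel \<partial>lborel \<partial>lborel \<partial>lborel)"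
    by (intro nn_integral_cong nn_integral_reverse) measurable
  also have "\<dots> = (\<integral>\<^sup>+u. \<integral>\<^sup>+v. \<integral>\<^sup>+w. indicator D (u, v, w) * ennreal (1 / (norm w)\<^sup>2)
         * (\<integral>\<^sup>+m. G m ((v - m * u) / w) \<partial>lborel) \<partial>lborel \<partial>lborel \<partial>lborel)"
    by (intro nn_integral_cong nn_integral_cmult) measurable
  finally show ?thesis .
qed

text \<open>
  The area of the slice by the complex line in direction \<open>(x1, x2, 1)\<close> through \<open>(p1, p2, 0)\<close>, with its third
  coordinate as parameter.
\<close>

definition line_area :: "(complex \<times> complex \<times> complex) set \<Rightarrow> complex \<Rightarrow> complex \<Rightarrow> complex \<Rightarrow> complex \<Rightarrow> ennreal" where
  "line_area K x1 x2 p1 p2 = (\<integral>\<^sup>+l. indicator K (p1 + l * x1, p2 + l * x2, l) \<partial>lborel)"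

lemma measurable_line_area [measurable (raw)]:
  assumes [measurable]: "K \<in> sets borel" "f \<in> borel_measurable M" "g \<in> borel_measurable M"
  shows "(\<lambda>x. line_area K x1 x2 (f x) (g x)) \<in> borel_measurable M"
  unfolding line_area_def by measurable

text \<open>
  The plane of slope \<open>m\<close> through \<open>(x1, x2, 1)\<close> is foliated by the lines parallel to this vector; they
  meet \<open>w = 0\<close> in the points \<open>(p1, m p1, 0)\<close>.
\<close>

lemma plane_area_pencil:
  assumes [measurable]: "K \<in> sets borel"
  shows "plane_area K m (x2 - m * x1) = (\<integral>\<^sup>+p1. line_area K x1 x2 p1 (m * p1) \<partial>lborel)"
proof -
  have "plane_area K m (x2 - m * x1) = (\<integral>\<^sup>+w. \<integral>\<^sup>+u. indicator K (u, m * u + (x2 - m * x1) * w, w) \<partial>lborel \<partial>lborel)"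
    unfolding plane_area_def by (rule nn_integral_swap) measurable
  also have "\<dots> = (\<integral>\<^sup>+w. \<integral>\<^sup>+u. indicator K (w * x1 + u, m * (w * x1 + u) + (x2 - m * x1) * w, w) \<partial>lborel \<partial>lborel)"
    by (intro nn_integral_cong nn_integral_lborel_translate[symmetric]) measurable
  also have "\<dots> = (\<integral>\<^sup>+w. \<integral>\<^sup>+u. indicator K (u + w * x1, m * u + w * x2, w) \<partial>lborel \<partial>lborel)"
    by (simp add: algebra_simps)
  also have "\<dots> = (\<integral>\<^sup>+p1. line_area K x1 x2 p1 (m * p1) \<partial>lborel)"
    unfolding line_area_def by (rule nn_integral_swap) measurable
  finally show ?thesis .
qed

text \<open>
  The substitution \<open>p2 = m p1\<close> sweeps out all displacements \<open>p\<close>. With the weight \<open>1/(1 + \<bar>m\<bar>\<^sup>2)\<close> the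
  resulting kernel \<open>1/\<bar>p\<bar>\<^sup>2\<close> is invariant under unitary maps of \<open>p\<close>.
\<close>

lemma pencil_first_kernel:
  assumes [measurable]: "K \<in> sets borel"
  shows "(\<integral>\<^sup>+m. ennreal (1 / (1 + (norm m)\<^sup>2)) * plane_area K m (x2 - m * x1) \<partial>lborel)
    = (\<integral>\<^sup>+p1. \<integral>\<^sup>+p2. line_area K x1 x2 p1 p2 * ennreal (1 / ((norm p1)\<^sup>2 + (norm p2)\<^sup>2)) \<partial>lborel \<partial>lborel)"
proof -
  let ?L = "\<lambda>m p1. ennreal (1 / (1 + (norm m)\<^sup>2)) * line_area K x1 x2 p1 (m * p1)"
  let ?k = "\<lambda>m p1. ennreal (1 / ((norm p1)\<^sup>2 + (norm (p1 * m))\<^sup>2))"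
  have "(\<integral>\<^sup>+m. ennreal (1 / (1 + (norm m)\<^sup>2)) * plane_area K m (x2 - m * x1) \<partial>lborel)
     = (\<integral>\<^sup>+m. \<integral>\<^sup>+p1. ?L m p1 \<partial>lborel \<partial>lborel)"
    unfolding plane_area_pencil[OF assms] by (intro nn_integral_cong nn_integral_cmult[symmetric]) measurable
  also have "\<dots> = (\<integral>\<^sup>+p1. \<integral>\<^sup>+m. ?L m p1 \<partial>lborel \<partial>lborel)"
    by (rule nn_integral_swap) measurable
  also have "\<dots> = (\<integral>\<^sup>+p1. \<integral>\<^sup>+p2. line_area K x1 x2 p1 p2 * ennreal (1 / ((norm p1)\<^sup>2 + (norm p2)\<^sup>2)) \<partial>lborel \<partial>lborel)"
  proof (rule nn_integral_cong_AE, use AE_lborel_singleton[of "0::complex"] in eventually_elim)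
    fix p1 :: complex assume p1: "p1 \<noteq> 0"
    have "(\<integral>\<^sup>+p2. line_area K x1 x2 p1 p2 * ennreal (1 / ((norm p1)\<^sup>2 + (norm p2)\<^sup>2)) \<partial>lborel)
      = ennreal ((norm p1)\<^sup>2) * (\<integral>\<^sup>+m. line_area K x1 x2 p1 (p1 * m) * ?k m p1 \<partial>lborel)"
      by (rule nn_integral_complex_mult[OF _ p1]) measurable
    also have "\<dots> = (\<integral>\<^sup>+m. ennreal ((norm p1)\<^sup>2) * (line_area K x1 x2 p1 (p1 * m) * ?k m p1) \<partial>lborel)"
      by (rule nn_integral_cmult[symmetric]) measurable
    also have "\<dots> = (\<integral>\<^sup>+m. ?L m p1 \<partial>lborel)"
    proof (intro nn_integral_cong)
      fix m
      have "(norm p1)\<^sup>2 * (1 / ((norm p1)\<^sup>2 + (norm (p1 * m))\<^sup>2)) = 1 / (1 + (norm m)\<^sup>2)"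
        using p1 by (simp add: norm_mult power_mult_distrib field_simps add_nonneg_eq_0_iff)
      then have eq: "ennreal ((norm p1)\<^sup>2) * ?k m p1 = ennreal (1 / (1 + (norm m)\<^sup>2))"
        by (simp flip: ennreal_mult)
      show "ennreal ((norm p1)\<^sup>2) * (line_area K x1 x2 p1 (p1 * m) * ?k m p1)
        = ?L m p1"
        unfolding eq[symmetric] by (simp only: mult_ac)
    qed
    finally show "(\<integral>\<^sup>+m. ?L m p1 \<partial>lborel)
      = (\<integral>\<^sup>+p2. line_area K x1 x2 p1 p2 * ennreal (1 / ((norm p1)\<^sup>2 + (norm p2)\<^sup>2)) \<partial>lborel)" ..
  qed
  finally show ?thesis .
qed

text \<open>
  The slab is measured by the displacement in the \<open>v\<close>-direction, not by Euclidean distance to the plane.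
\<close>

definition slab_volume :: "(complex \<times> complex \<times> complex) set \<Rightarrow> complex \<Rightarrow> complex \<Rightarrow> real \<Rightarrow> ennreal" where
  "slab_volume K m b \<tau> = (\<integral>\<^sup>+u. \<integral>\<^sup>+v. \<integral>\<^sup>+w. indicator K (u, v, w)
      * indicator {..<\<tau>} (norm (v - m * u - b * w)) \<partial>lborel \<partial>lborel \<partial>lborel)"

lemma measurable_slab_volume [measurable (raw)]:
  assumes [measurable]: "K \<in> sets borel" "f \<in> borel_measurable M" "g \<in> borel_measurable M" "h \<in> borel_measurable M"
  shows "(\<lambda>x. slab_volume K (f x) (g x) (h x)) \<in> borel_measurable M"
proof -
  have "slab_volume K m b \<tau> = (\<integral>\<^sup>+u. \<integral>\<^sup>+v. \<integral>\<^sup>+w. indicator K (u, v, w)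
      * indicator {0<..} (\<tau> - norm (v - m * u - b * w)) \<partial>lborel \<partial>lborel \<partial>lborel)" for m b \<tau>
    unfolding slab_volume_def by (intro nn_integral_cong) (simp add: indicator_def)
  then show ?thesis by simp
qed

text \<open>
  Points are written as a displacement \<open>(p1, p2, 0)\<close> plus a multiple of \<open>(x1, x2, 1)\<close>; the coordinate
  change is unimodular.
\<close>

lemma nn_integral_shear:
  fixes F :: "complex \<Rightarrow> complex \<Rightarrow> complex \<Rightarrow> ennreal"
  assumes F: "(\<lambda>(u, v, w). F u v w) \<in> borel_measurable (borel \<Otimes>\<^sub>M borel \<Otimes>\<^sub>M borel)"
  shows "(\<integral>\<^sup>+u. \<integral>\<^sup>+v. \<integral>\<^sup>+w. F u v w \<partial>lborel \<partial>lborel \<partial>lborel)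
    = (\<integral>\<^sup>+p1. \<integral>\<^sup>+p2. \<integral>\<^sup>+l. F (p1 + l * x1) (p2 + l * x2) l \<partial>lborel \<partial>lborel \<partial>lborel)"
proof -
  note [measurable (raw)] = measurable_ternary[OF F]
  have "(\<integral>\<^sup>+u. \<integral>\<^sup>+v. \<integral>\<^sup>+w. F u v w \<partial>lborel \<partial>lborel \<partial>lborel) = (\<integral>\<^sup>+w. \<integral>\<^sup>+v. \<integral>\<^sup>+u. F u v w \<partial>lborel \<partial>lborel \<partial>lborel)"
    by (rule nn_integral_reverse[OF F])
  also have "\<dots> = (\<integral>\<^sup>+w. \<integral>\<^sup>+v. \<integral>\<^sup>+u. F (w * x1 + u) (w * x2 + v) w \<partial>lborel \<partial>lborel \<partial>lborel)"
  proof (rule nn_integral_cong)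
    fix w
    have "(\<integral>\<^sup>+v. \<integral>\<^sup>+u. F u v w \<partial>lborel \<partial>lborel) = (\<integral>\<^sup>+v. \<integral>\<^sup>+u. F u (w * x2 + v) w \<partial>lborel \<partial>lborel)"
      by (rule nn_integral_lborel_translate[symmetric]) measurable
    also have "\<dots> = (\<integral>\<^sup>+v. \<integral>\<^sup>+u. F (w * x1 + u) (w * x2 + v) w \<partial>lborel \<partial>lborel)"
      by (intro nn_integral_cong nn_integral_lborel_translate[symmetric]) measurable
    finally show "(\<integral>\<^sup>+v. \<integral>\<^sup>+u. F u v w \<partial>lborel \<partial>lborel) = (\<integral>\<^sup>+v. \<integral>\<^sup>+u. F (w * x1 + u) (w * x2 + v) w \<partial>lborel \<partial>lborel)" .
  qed
  also have "\<dots> = (\<integral>\<^sup>+u. \<integral>\<^sup>+v. \<integral>\<^sup>+w. F (w * x1 + u) (w * x2 + v) w \<partial>lborel \<partial>lborel \<partial>lborel)"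
    by (rule nn_integral_reverse) measurable
  finally show ?thesis by (simp add: add.commute)
qed

lemma slab_volume_pencil:
  assumes [measurable]: "K \<in> sets borel"
  shows "slab_volume K m (x2 - m * x1) \<tau>
    = (\<integral>\<^sup>+p1. \<integral>\<^sup>+p2. line_area K x1 x2 p1 p2 * indicator {..<\<tau>} (norm (p2 - m * p1)) \<partial>lborel \<partial>lborel)"
proof -
  have "slab_volume K m (x2 - m * x1) \<tau> = (\<integral>\<^sup>+p1. \<integral>\<^sup>+p2. \<integral>\<^sup>+l. indicator K (p1 + l * x1, p2 + l * x2, l)
      * indicator {..<\<tau>} (norm (p2 + l * x2 - m * (p1 + l * x1) - (x2 - m * x1) * l)) \<partial>lborel \<partial>lborel \<partial>lborel)"
    unfolding slab_volume_def by (rule nn_integral_shear) measurable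
  also have "\<dots> = (\<integral>\<^sup>+p1. \<integral>\<^sup>+p2. \<integral>\<^sup>+l. indicator K (p1 + l * x1, p2 + l * x2, l)
      * indicator {..<\<tau>} (norm (p2 - m * p1)) \<partial>lborel \<partial>lborel \<partial>lborel)"
    by (simp add: algebra_simps)
  also have "\<dots> = (\<integral>\<^sup>+p1. \<integral>\<^sup>+p2. line_area K x1 x2 p1 p2 * indicator {..<\<tau>} (norm (p2 - m * p1)) \<partial>lborel \<partial>lborel)"
    unfolding line_area_def by (intro nn_integral_cong nn_integral_multc) measurable
  finally show ?thesis .
qed

text \<open>
  A slab is the union of the translates of a plane over a disc of area \<open>\<pi> \<tau>\<^sup>2\<close>, and the
  translate through the origin has the largest section.
\<close>

lemma slab_volume_le:
  assumes K: "K \<in> sets borel" "convex K" "bounded K" "\<forall>x\<in>K. - x \<in> K" and "\<tau> \<ge> 0"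
  shows "slab_volume K m b \<tau> \<le> ennreal (pi * \<tau>\<^sup>2) * plane_area K m b"
proof -
  note [measurable] = K(1)
  let ?A = "\<lambda>z. \<integral>\<^sup>+u. \<integral>\<^sup>+w. (indicator K (u, m * u + b * w + z, w) :: ennreal) \<partial>lborel \<partial>lborel"
  let ?f = "\<lambda>u v w. indicator K (u, v, w) * (indicator {..<\<tau>} (norm (v - m * u - b * w)) :: ennreal)"
  let ?g = "\<lambda>q::complex \<times> complex. (fst q, m * fst q + b * snd q, snd q)"
  have g: "linear ?g" "inj ?g"
    by (auto intro!: linearI simp: algebra_simps inj_def prod_eq_iff)
  have pair: "?A z
     = (\<integral>\<^sup>+q. indicator K ((0, z, 0) + ?g q) \<partial>lborel)" for z
    by (subst nn_integral_lborel_pair) (measurable, simp add: add.commute)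
  have "slab_volume K m b \<tau> = (\<integral>\<^sup>+u. \<integral>\<^sup>+w. \<integral>\<^sup>+v. ?f u v w \<partial>lborel \<partial>lborel \<partial>lborel)"
    unfolding slab_volume_def by (intro nn_integral_cong nn_integral_swap) measurable
  also have "\<dots> = (\<integral>\<^sup>+u. \<integral>\<^sup>+w. \<integral>\<^sup>+z. ?f u (m * u + b * w + z) w \<partial>lborel \<partial>lborel \<partial>lborel)"
    by (intro nn_integral_cong nn_integral_lborel_translate[symmetric]) measurable
  also have "\<dots> = (\<integral>\<^sup>+u. \<integral>\<^sup>+z. \<integral>\<^sup>+w. ?f u (m * u + b * w + z) w \<partial>lborel \<partial>lborel \<partial>lborel)"
    by (intro nn_integral_cong nn_integral_swap) measurable
  also have "\<dots> = (\<integral>\<^sup>+z. \<integral>\<^sup>+u. \<integral>\<^sup>+w. ?f u (m * u + b * w + z) w \<partial>lborel \<partial>lborel \<partial>lborel)"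
    by (rule nn_integral_swap) measurable
  also have "\<dots> = (\<integral>\<^sup>+z. \<integral>\<^sup>+u. \<integral>\<^sup>+w. indicator K (u, m * u + b * w + z, w) * indicator {..<\<tau>} (norm z) \<partial>lborel \<partial>lborel \<partial>lborel)"
    by (simp add: algebra_simps)
  also have "\<dots> = (\<integral>\<^sup>+z. ?A z * indicator {..<\<tau>} (norm z) \<partial>lborel)"
    by (simp add: nn_integral_multc)
  also have "\<dots> \<le> (\<integral>\<^sup>+z. plane_area K m b * indicator {..<\<tau>} (norm z) \<partial>complex_lborel)"
  proof (intro nn_integral_mono mult_right_mono)
    fix z
    show "?A z \<le> plane_area K m b"
      using section_central_max[OF g K, of "(0, z, 0)"] pair[of z] pair[of 0]
      by (simp add: plane_area_def zero_prod_def)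
  qed simp
  also have "\<dots> = plane_area K m b * (\<integral>\<^sup>+z. indicator (ball 0 \<tau>) z \<partial>complex_lborel)"
  proof -
    have "plane_area K m b * (\<integral>\<^sup>+z. indicator (ball 0 \<tau>) z \<partial>complex_lborel)
      = (\<integral>\<^sup>+z. plane_area K m b * indicator (ball 0 \<tau>) z \<partial>complex_lborel)"
      by (rule nn_integral_cmult[symmetric]) simp
    then show ?thesis by (simp add: indicator_def)
  qed
  also have "\<dots> = ennreal (pi * \<tau>\<^sup>2) * plane_area K m b"
    using assms(5) unit_ball_vol_even[of 1] by (simp add: emeasure_ball mult.commute)
  finally show ?thesis .
qed

section \<open>The kernel of a pencil of planes\<close>

lemma nn_integral_disc:
  "(\<integral>\<^sup>+z. indicator {..<\<beta>} ((norm z)\<^sup>2) \<partial>complex_lborel) = ennreal (pi * \<beta>)"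
proof (cases "\<beta> > 0")
  case True
  have "(\<integral>\<^sup>+z. indicator {..<\<beta>} ((norm z)\<^sup>2) \<partial>complex_lborel)
      = (\<integral>\<^sup>+z. indicator (ball 0 (sqrt \<beta>)) z \<partial>complex_lborel)"
  proof (intro nn_integral_cong)
    fix z :: complex
    have "(norm z)\<^sup>2 < \<beta> \<longleftrightarrow> norm z < sqrt \<beta>"
      using real_sqrt_less_iff[of "(norm z)\<^sup>2" \<beta>] by simp
    then show "indicator {..<\<beta>} ((norm z)\<^sup>2) = (indicator (ball 0 (sqrt \<beta>)) z :: ennreal)" by (simp add: indicator_def)
  qed
  also have "\<dots> = ennreal (pi * \<beta>)"
    using True by (simp add: emeasure_ball unit_ball_vol_2)
  finally show ?thesis .
next
  case False
  then have "\<not> (norm z)\<^sup>2 < \<beta>" for z :: complex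
    using zero_le_power2[of "norm z"] by linarith
  then have "indicator {..<\<beta>} ((norm z)\<^sup>2) = (0 :: ennreal)" for z :: complex
    by (simp add: indicator_def)
  then show ?thesis using False by (simp add: ennreal_neg mult_nonneg_nonpos)
qed

lemma nn_integral_annulus:
  assumes "\<alpha> \<ge> 0"
  shows "(\<integral>\<^sup>+z. indicator {\<alpha><..<\<beta>} ((norm z)\<^sup>2) \<partial>complex_lborel) = ennreal (pi * (\<beta> - \<alpha>))"
proof (cases "\<alpha> < \<beta>")
  case True
  have cd: "(\<integral>\<^sup>+z. indicator {..\<alpha>} ((norm z)\<^sup>2) \<partial>complex_lborel) = ennreal (pi * \<alpha>)"
  proof -
    have "(\<integral>\<^sup>+z. indicator {..\<alpha>} ((norm z)\<^sup>2) \<partial>complex_lborel)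
      = (\<integral>\<^sup>+z. indicator (cball 0 (sqrt \<alpha>)) z \<partial>complex_lborel)"
    proof (intro nn_integral_cong)
      fix z :: complex
      have "(norm z)\<^sup>2 \<le> \<alpha> \<longleftrightarrow> norm z \<le> sqrt \<alpha>" using assms real_le_rsqrt sqrt_ge_absD by fastforce
      then show "indicator {..\<alpha>} ((norm z)\<^sup>2) = (indicator (cball 0 (sqrt \<alpha>)) z :: ennreal)" by (simp add: indicator_def)
    qed
    then show ?thesis using assms by (simp add: emeasure_cball unit_ball_vol_2)
  qed
  have "ennreal (pi * \<alpha>) + (\<integral>\<^sup>+z. indicator {\<alpha><..<\<beta>} ((norm z)\<^sup>2) \<partial>complex_lborel)
     = (\<integral>\<^sup>+z. indicator {..\<alpha>} ((norm z)\<^sup>2) + indicator {\<alpha><..<\<beta>} ((norm z)\<^sup>2) \<partial>complex_lborel)"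
    unfolding cd[symmetric] by (rule nn_integral_add[symmetric]) measurable
  also have "\<dots> = (\<integral>\<^sup>+z. indicator {..<\<beta>} ((norm z)\<^sup>2) \<partial>complex_lborel)"
    using True by (intro nn_integral_cong) (auto simp: indicator_def)
  also have "\<dots> = ennreal (pi * \<alpha>) + ennreal (pi * (\<beta> - \<alpha>))"
    using True assms unfolding nn_integral_disc by (subst ennreal_plus[symmetric]) (auto simp: algebra_simps)
  finally show ?thesis by (subst (asm) ennreal_add_left_cancel) simp
next
  case False
  then have "indicator {\<alpha><..<\<beta>} ((norm z)\<^sup>2) = (0 :: ennreal)" for z :: complex
    by (simp add: indicator_def)
  then show ?thesis using False by (simp add: ennreal_neg mult_nonneg_nonpos)
qed

text \<open>
  Slicing the unit ball of \<open>C\<^sup>2\<close> by discs identifies the integral with its volume.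
\<close>

lemma nn_integral_paraboloid: "(\<integral>\<^sup>+z. ennreal (pi * (1 - (norm z)\<^sup>2)) \<partial>complex_lborel) = ennreal (pi\<^sup>2 / 2)"
proof -
  have "ennreal (pi\<^sup>2 / 2) = emeasure lborel (ball 0 1 :: (complex \<times> complex) set)"
    by (simp add: emeasure_ball eval_unit_ball_vol fact_numeral)
  also have "\<dots> = (\<integral>\<^sup>+p. indicator (ball 0 1) p \<partial>(lborel :: (complex \<times> complex) measure))" by simp
  also have "\<dots> = (\<integral>\<^sup>+z. \<integral>\<^sup>+y. indicator (ball 0 1) (z, y) \<partial>complex_lborel \<partial>complex_lborel)"
    by (rule nn_integral_lborel_pair) simp
  also have "\<dots> = (\<integral>\<^sup>+z. \<integral>\<^sup>+y. indicator {..<1 - (norm z)\<^sup>2} ((norm y)\<^sup>2) \<partial>complex_lborel \<partial>complex_lborel)"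
    by (intro nn_integral_cong) (auto simp: indicator_def norm_Pair)
  finally show ?thesis by (simp add: nn_integral_disc)
qed

lemma nn_integral_square_disc:
  "(\<integral>\<^sup>+z. ennreal ((norm z)\<^sup>2) * indicator {..<1} ((norm z)\<^sup>2) \<partial>complex_lborel) = ennreal (pi / 2)" (is "?I = _")
proof -
  have "ennreal pi * (\<integral>\<^sup>+z. ennreal (1 - (norm z)\<^sup>2) \<partial>complex_lborel) = ennreal pi * ennreal (pi / 2)"
    using nn_integral_paraboloid by (simp add: ennreal_mult' nn_integral_cmult flip: ennreal_mult) (simp add: power2_eq_square)
  then have 1: "(\<integral>\<^sup>+z. ennreal (1 - (norm z)\<^sup>2) \<partial>complex_lborel) = ennreal (pi / 2)"
    by (subst (asm) ennreal_mult_cancel_left) simp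
  have "ennreal (pi / 2) + ?I = (\<integral>\<^sup>+z. ennreal (1 - (norm z)\<^sup>2) + ennreal ((norm z)\<^sup>2) * indicator {..<1} ((norm z)\<^sup>2) \<partial>complex_lborel)"
    unfolding 1[symmetric] by (rule nn_integral_add[symmetric]) measurable
  also have "\<dots> = (\<integral>\<^sup>+z. indicator {..<1} ((norm z)\<^sup>2) \<partial>complex_lborel)"
    by (intro nn_integral_cong) (auto simp: indicator_def ennreal_neg simp flip: ennreal_plus)
  also have "\<dots> = ennreal (pi / 2) + ennreal (pi / 2)"
    unfolding nn_integral_disc by (simp flip: ennreal_plus)
  finally show ?thesis by (subst (asm) ennreal_add_left_cancel) simp
qed

text \<open>
  The sets are the points of the unit ball of \<open>C\<^sup>2\<close> whose direction lies in a spherical cap. For \<open>a = t / R < 1\<close> the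
  sections at fixed \<open>y\<close> are annuli of area \<open>\<pi> (1 - \<bar>y / a\<bar>\<^sup>2)\<close>, so scaling \<open>y\<close> by \<open>a\<close> shows that the volume is
  \<open>a\<^sup>2\<close> times that of the ball.
\<close>

lemma nn_integral_cap:
  assumes "R > 0" "t > 0"
  shows "(\<integral>\<^sup>+y. \<integral>\<^sup>+x. indicator {..<1} ((norm x)\<^sup>2 + (norm y)\<^sup>2)
      * indicator {0<..} (t\<^sup>2 * ((norm x)\<^sup>2 + (norm y)\<^sup>2) - R\<^sup>2 * (norm y)\<^sup>2) \<partial>complex_lborel \<partial>complex_lborel)
    = ennreal (pi\<^sup>2 / 2 * min 1 (t\<^sup>2 / R\<^sup>2))"
proof -
  let ?c = "\<lambda>x y :: complex. indicator {..<1} ((norm x)\<^sup>2 + (norm y)\<^sup>2)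
      * (indicator {0<..} (t\<^sup>2 * ((norm x)\<^sup>2 + (norm y)\<^sup>2) - R\<^sup>2 * (norm y)\<^sup>2) :: ennreal)"
  show ?thesis
proof (cases "t < R")
  case True
  define a where "a = t / R"
  have a: "0 < a" "a < 1" using assms True by (auto simp: a_def)
  have "(\<integral>\<^sup>+x. ?c x y \<partial>complex_lborel)
      = ennreal (pi * (1 - (norm y / a)\<^sup>2))" for y :: complex
  proof -
    have *: "0 < t\<^sup>2 * ((norm x)\<^sup>2 + (norm y)\<^sup>2) - R\<^sup>2 * (norm y)\<^sup>2 \<longleftrightarrow> (norm y)\<^sup>2 * (1 / a\<^sup>2 - 1) < (norm x)\<^sup>2" for x :: complex
    proof -
      have "(norm y)\<^sup>2 * (1 / a\<^sup>2 - 1) = (R\<^sup>2 * (norm y)\<^sup>2 - t\<^sup>2 * (norm y)\<^sup>2) / t\<^sup>2"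
        using assms by (simp add: a_def field_simps)
      then show ?thesis using assms by (simp add: pos_divide_less_eq algebra_simps)
    qed
    have "(\<integral>\<^sup>+x. ?c x y \<partial>complex_lborel)
      = (\<integral>\<^sup>+x. indicator {(norm y)\<^sup>2 * (1 / a\<^sup>2 - 1) <..< 1 - (norm y)\<^sup>2} ((norm x)\<^sup>2) \<partial>complex_lborel)"
      unfolding indicator_def greaterThan_iff greaterThanLessThan_iff lessThan_iff *
      by (intro nn_integral_cong) auto
    also have "\<dots> = ennreal (pi * (1 - (norm y)\<^sup>2 - (norm y)\<^sup>2 * (1 / a\<^sup>2 - 1)))"
      using a by (intro nn_integral_annulus mult_nonneg_nonneg) (auto simp: power_le_one)
    also have "1 - (norm y)\<^sup>2 - (norm y)\<^sup>2 * (1 / a\<^sup>2 - 1) = 1 - (norm y / a)\<^sup>2"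
      by (simp add: algebra_simps power_divide)
    finally show ?thesis .
  qed
  then have "(\<integral>\<^sup>+y. \<integral>\<^sup>+x. ?c x y \<partial>complex_lborel \<partial>complex_lborel)
      = (\<integral>\<^sup>+y. ennreal (pi * (1 - (norm y / a)\<^sup>2)) \<partial>complex_lborel)" by simp
  also have "\<dots> = ennreal (a ^ DIM(complex)) * (\<integral>\<^sup>+y. ennreal (pi * (1 - (norm (a *\<^sub>R y) / a)\<^sup>2)) \<partial>complex_lborel)"
    using a by (intro nn_integral_lborel_scaleR) auto
  also have "\<dots> = ennreal (a\<^sup>2) * ennreal (pi\<^sup>2 / 2)"
    using a by (simp add: nn_integral_paraboloid)
  also have "\<dots> = ennreal (pi\<^sup>2 / 2 * min 1 (t\<^sup>2 / R\<^sup>2))"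
  proof -
    have "a\<^sup>2 \<le> 1" using a by (simp add: power_le_one)
    then have "min 1 (t\<^sup>2 / R\<^sup>2) = a\<^sup>2" by (simp add: a_def power_divide min_absorb2)
    then show ?thesis by (simp add: mult.commute flip: ennreal_mult)
  qed
  finally show ?thesis .
next
  case False
  have "(\<integral>\<^sup>+x. ?c x y \<partial>complex_lborel)
      = ennreal (pi * (1 - (norm y)\<^sup>2))" for y :: complex
  proof -
    have "(\<integral>\<^sup>+x. ?c x y \<partial>complex_lborel)
      = (\<integral>\<^sup>+x. indicator {..<1 - (norm y)\<^sup>2} ((norm x)\<^sup>2) \<partial>complex_lborel)"
    proof (rule nn_integral_cong_AE, use AE_lborel_singleton[of "0::complex"] in eventually_elim)
      fix x :: complex assume "x \<noteq> 0"
      then have "0 < t\<^sup>2 * (norm x)\<^sup>2" using assms by simp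
      moreover have "R\<^sup>2 * (norm y)\<^sup>2 \<le> t\<^sup>2 * (norm y)\<^sup>2"
        using False assms by (intro mult_right_mono power_mono) auto
      ultimately have "0 < t\<^sup>2 * ((norm x)\<^sup>2 + (norm y)\<^sup>2) - R\<^sup>2 * (norm y)\<^sup>2" by (simp add: algebra_simps)
      then show "indicator {..<1} ((norm x)\<^sup>2 + (norm y)\<^sup>2)
         * indicator {0<..} (t\<^sup>2 * ((norm x)\<^sup>2 + (norm y)\<^sup>2) - R\<^sup>2 * (norm y)\<^sup>2)
         = (indicator {..<1 - (norm y)\<^sup>2} ((norm x)\<^sup>2) :: ennreal)"
        by (auto simp: indicator_def)
    qed
    then show ?thesis by (simp add: nn_integral_disc)
  qed
  moreover have "min 1 (t\<^sup>2 / R\<^sup>2) = 1" using False assms by (simp add: min_absorb1 power_mono)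
  ultimately show ?thesis by (simp add: nn_integral_paraboloid)
qed
qed

text \<open>
  The left-hand side is the measure of a cap in the projective line, with affine coordinate \<open>m\<close> and the unitarily
  invariant density \<open>1/(1 + \<bar>m\<bar>\<^sup>2)\<^sup>2\<close>. It is computed on \<open>C\<^sup>2\<close>: the substitution \<open>y = m x\<close> reduces the volume
  of the corresponding cone in the unit ball to this measure, while a unitary map that takes \<open>(p1, p2)\<close> to a coordinate axis reduces
  it to \<open>nn_integral_cap\<close>.
\<close>

lemma pencil_cap:
  fixes p1 p2 :: complex
  assumes p: "p1 \<noteq> 0 \<or> p2 \<noteq> 0" and t: "t > 0"
  shows "(\<integral>\<^sup>+m. ennreal ((1 / (1 + (norm m)\<^sup>2))\<^sup>2) * indicator {..<t * sqrt (1 + (norm m)\<^sup>2)} (norm (p2 - m * p1)) \<partial>lborel)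
    = ennreal (pi * min 1 (t\<^sup>2 / ((norm p1)\<^sup>2 + (norm p2)\<^sup>2)))" (is "?L = _")
proof -
  define R where "R = sqrt ((norm p1)\<^sup>2 + (norm p2)\<^sup>2)"
  have R2: "R\<^sup>2 = (norm p1)\<^sup>2 + (norm p2)\<^sup>2" by (simp add: R_def)
  have R: "R > 0" using p by (auto simp: R_def sum_power2_gt_zero_iff)
  define F where "F = (\<lambda>x y :: complex. indicator {..<1} ((norm x)\<^sup>2 + (norm y)\<^sup>2)
      * (indicator {0<..} (t\<^sup>2 * ((norm x)\<^sup>2 + (norm y)\<^sup>2) - (norm (p2 * x - p1 * y))\<^sup>2) :: ennreal))"
  \<comment> \<open>A unitary map whose second component is proportional to \<open>p2 x - p1 y\<close>.\<close>
  define U where "U = (\<lambda>q :: complex \<times> complex. ((cnj p1 * fst q + cnj p2 * snd q) / of_real R, (p2 * fst q - p1 * snd q) / of_real R))"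
  let ?g = "\<lambda>q :: complex \<times> complex. indicator {..<1} ((norm (fst q))\<^sup>2 + (norm (snd q))\<^sup>2)
      * (indicator {0<..} (t\<^sup>2 * ((norm (fst q))\<^sup>2 + (norm (snd q))\<^sup>2) - R\<^sup>2 * (norm (snd q))\<^sup>2) :: ennreal)"
  have normU: "(norm (fst (U q)))\<^sup>2 + (norm (snd (U q)))\<^sup>2 = (norm (fst q))\<^sup>2 + (norm (snd q))\<^sup>2" for q
  proof -
    have "(norm (cnj p1 * fst q + cnj p2 * snd q))\<^sup>2 + (norm (p2 * fst q - p1 * snd q))\<^sup>2 = R\<^sup>2 * ((norm (fst q))\<^sup>2 + (norm (snd q))\<^sup>2)"
      unfolding R2 cmod_power2 by (simp add: power2_eq_square algebra_simps)
    then show ?thesis using R by (simp add: U_def norm_divide power_divide field_simps)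
  qed
  have mF: "(\<lambda>q. F (fst q) (snd q)) \<in> borel_measurable borel"
    unfolding F_def borel_prod[symmetric] by measurable
  have "(\<integral>\<^sup>+x. \<integral>\<^sup>+y. F x y \<partial>lborel \<partial>lborel) = (\<integral>\<^sup>+q. F (fst q) (snd q) \<partial>lborel)"
    by (subst nn_integral_lborel_pair[OF mF]) simp
  also have "\<dots> = (\<integral>\<^sup>+q. ?g (U q) \<partial>lborel)"
  proof (intro nn_integral_cong)
    fix q :: "complex \<times> complex"
    have "R\<^sup>2 * (norm (snd (U q)))\<^sup>2 = (norm (p2 * fst q - p1 * snd q))\<^sup>2"
      using R by (simp add: U_def norm_divide power_divide)
    then show "F (fst q) (snd q) = ?g (U q)" by (simp add: F_def normU)
  qed
  also have "\<dots> = (\<integral>\<^sup>+q. ?g q \<partial>lborel)"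
  proof (rule nn_integral_lborel_isometry)
    show "linear U" by (rule linearI) (auto simp: U_def algebra_simps add_divide_distrib diff_divide_distrib scaleR_conv_of_real)
    show "norm (U q) = norm q" for q
      using normU[of q] by (simp add: norm_prod_def)
  qed simp_all
  also have "\<dots> = (\<integral>\<^sup>+x. \<integral>\<^sup>+y. ?g (x, y) \<partial>lborel \<partial>lborel)"
    by (rule nn_integral_lborel_pair) measurable
  also have "\<dots> = (\<integral>\<^sup>+y. \<integral>\<^sup>+x. ?g (x, y) \<partial>lborel \<partial>lborel)"
    by (rule nn_integral_swap) measurable
  also have "\<dots> = ennreal (pi\<^sup>2 / 2 * min 1 (t\<^sup>2 / R\<^sup>2))"
    using nn_integral_cap[OF R t] by simp
  finally have F1: "(\<integral>\<^sup>+x. \<integral>\<^sup>+y. F x y \<partial>lborel \<partial>lborel) = ennreal (pi\<^sup>2 / 2 * min 1 (t\<^sup>2 / R\<^sup>2))" .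
  define i where "i = (\<lambda>m. indicator {0<..} (t * sqrt (1 + (norm m)\<^sup>2) - norm (p2 - m * p1)) :: ennreal)"
  have [measurable]: "i \<in> borel_measurable borel" unfolding i_def by measurable
  let ?G = "\<lambda>x m. ennreal ((norm (x :: complex))\<^sup>2) * (indicator {..<1} ((norm x)\<^sup>2 * (1 + (norm m)\<^sup>2)) * i m)"
  have "(\<integral>\<^sup>+x. \<integral>\<^sup>+y. F x y \<partial>lborel \<partial>lborel)
     = (\<integral>\<^sup>+x. \<integral>\<^sup>+m. ?G x m \<partial>lborel \<partial>complex_lborel)"
  proof (rule nn_integral_cong_AE, use AE_lborel_singleton[of "0::complex"] in eventually_elim)
    fix x :: complex assume x: "x \<noteq> 0"
    have "(\<integral>\<^sup>+y. F x y \<partial>lborel) = ennreal ((norm x)\<^sup>2) * (\<integral>\<^sup>+m. F x (x * m) \<partial>lborel)"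
      unfolding F_def by (rule nn_integral_complex_mult[OF _ x]) measurable
    also have "\<dots> = (\<integral>\<^sup>+m. ennreal ((norm x)\<^sup>2) * F x (x * m) \<partial>lborel)"
      unfolding F_def by (rule nn_integral_cmult[symmetric]) measurable
    also have "\<dots> = (\<integral>\<^sup>+m. ?G x m \<partial>lborel)"
    proof (intro nn_integral_cong)
      fix m
      have e1: "(norm x)\<^sup>2 + (norm (x * m))\<^sup>2 = (norm x)\<^sup>2 * (1 + (norm m)\<^sup>2)"
        by (simp add: norm_mult power_mult_distrib algebra_simps)
      have "p2 * x - p1 * (x * m) = x * (p2 - m * p1)" by (simp add: algebra_simps)
      then have "(norm (p2 * x - p1 * (x * m)))\<^sup>2 = (norm x)\<^sup>2 * (norm (p2 - m * p1))\<^sup>2"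
        by (simp add: norm_mult power_mult_distrib)
      then have "t\<^sup>2 * ((norm x)\<^sup>2 + (norm (x * m))\<^sup>2) - (norm (p2 * x - p1 * (x * m)))\<^sup>2
          = (norm x)\<^sup>2 * ((t * sqrt (1 + (norm m)\<^sup>2))\<^sup>2 - (norm (p2 - m * p1))\<^sup>2)"
        unfolding e1 by (simp add: power_mult_distrib algebra_simps)
      moreover have "(0 < (norm x)\<^sup>2 * ((t * sqrt (1 + (norm m)\<^sup>2))\<^sup>2 - (norm (p2 - m * p1))\<^sup>2))
          \<longleftrightarrow> norm (p2 - m * p1) < t * sqrt (1 + (norm m)\<^sup>2)"
        using x t by (simp add: zero_less_mult_iff) (metis abs_norm_cancel abs_of_nonneg abs_square_less_1 power2_less_imp_less power_strict_mono norm_ge_zero mult_nonneg_nonneg less_imp_le real_sqrt_ge_zero add_nonneg_nonneg zero_le_one zero_le_power2 zero_less_numeral pos2)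
      ultimately show "ennreal ((norm x)\<^sup>2) * F x (x * m)
        = ?G x m"
        unfolding F_def e1 i_def by (simp add: indicator_def)
    qed
    finally show "(\<integral>\<^sup>+y. F x y \<partial>lborel)
       = (\<integral>\<^sup>+m. ?G x m \<partial>lborel)" .
  qed
  also have "\<dots> = (\<integral>\<^sup>+m. \<integral>\<^sup>+x. ?G x m \<partial>complex_lborel \<partial>lborel)"
    by (rule nn_integral_swap) measurable
  also have "\<dots> = (\<integral>\<^sup>+m. ennreal (pi / 2) * (ennreal ((1 / (1 + (norm m)\<^sup>2))\<^sup>2) * i m) \<partial>lborel)"
  proof (intro nn_integral_cong)
    fix m :: complex
    define s where "s = 1 / sqrt (1 + (norm m)\<^sup>2)"
    have pos: "1 + (norm m)\<^sup>2 > 0" by (simp add: add_pos_nonneg)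
    have s: "s > 0" "s\<^sup>2 = 1 / (1 + (norm m)\<^sup>2)" using pos by (simp_all add: s_def power_divide)
    have "(\<integral>\<^sup>+x. ennreal ((norm x)\<^sup>2) * (indicator {..<1} ((norm x)\<^sup>2 * (1 + (norm m)\<^sup>2))) \<partial>complex_lborel)
       = ennreal (s ^ DIM(complex)) * (\<integral>\<^sup>+x. ennreal ((norm (s *\<^sub>R x))\<^sup>2) * (indicator {..<1} ((norm (s *\<^sub>R x))\<^sup>2 * (1 + (norm m)\<^sup>2))) \<partial>complex_lborel)"
      by (rule nn_integral_lborel_scaleR[OF _ s(1)]) measurable
    also have "\<dots> = ennreal (s\<^sup>2) * (\<integral>\<^sup>+x. ennreal (s\<^sup>2) * (ennreal ((norm x)\<^sup>2) * indicator {..<1} ((norm x)\<^sup>2)) \<partial>complex_lborel)"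
    proof -
      have n: "(norm (s *\<^sub>R x))\<^sup>2 = s\<^sup>2 * (norm x)\<^sup>2" for x :: complex by (simp add: power_mult_distrib)
      have "s\<^sup>2 * (norm x)\<^sup>2 * (1 + (norm m)\<^sup>2) = (norm x)\<^sup>2" for x :: complex
        using pos unfolding s(2) by simp
      then show ?thesis unfolding n by (simp only: ennreal_mult[OF zero_le_power2 zero_le_power2] mult.assoc) (simp add: numeral_2_eq_2)
    qed
    also have "\<dots> = ennreal (s\<^sup>2) * (ennreal (s\<^sup>2) * ennreal (pi / 2))"
      by (subst nn_integral_cmult) (measurable, simp add: nn_integral_square_disc)
    also have "\<dots> = ennreal (pi / 2) * ennreal ((1 / (1 + (norm m)\<^sup>2))\<^sup>2)"
      unfolding s(2)[symmetric] by (simp only: power2_eq_square[of "s\<^sup>2"] ennreal_mult[OF zero_le_power2 zero_le_power2] mult_ac)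
    finally have eq: "(\<integral>\<^sup>+x. ennreal ((norm x)\<^sup>2) * (indicator {..<1} ((norm x)\<^sup>2 * (1 + (norm m)\<^sup>2))) \<partial>complex_lborel)
       = ennreal (pi / 2) * ennreal ((1 / (1 + (norm m)\<^sup>2))\<^sup>2)" .
    have "(\<integral>\<^sup>+x. ?G x m \<partial>complex_lborel)
      = (\<integral>\<^sup>+x. ennreal ((norm x)\<^sup>2) * (indicator {..<1} ((norm x)\<^sup>2 * (1 + (norm m)\<^sup>2))) \<partial>complex_lborel) * i m"
      by (subst nn_integral_multc[symmetric]) (measurable, simp add: mult.assoc)
    then show "(\<integral>\<^sup>+x. ?G x m \<partial>complex_lborel)
      = ennreal (pi / 2) * (ennreal ((1 / (1 + (norm m)\<^sup>2))\<^sup>2) * i m)"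
      unfolding eq by (simp add: mult.assoc)
  qed
  also have "\<dots> = ennreal (pi / 2) * ?L"
  proof -
    have "?L = (\<integral>\<^sup>+m. ennreal ((1 / (1 + (norm m)\<^sup>2))\<^sup>2) * i m \<partial>lborel)"
      by (intro nn_integral_cong) (simp add: i_def indicator_def)
    then show ?thesis by (simp add: nn_integral_cmult)
  qed
  finally have eq: "(\<integral>\<^sup>+x. \<integral>\<^sup>+y. F x y \<partial>lborel \<partial>lborel) = ennreal (pi / 2) * ?L" .
  have "ennreal (pi / 2) * ?L = ennreal (pi / 2) * ennreal (pi * min 1 (t\<^sup>2 / R\<^sup>2))"
  proof -
    have "pi\<^sup>2 / 2 * min 1 (t\<^sup>2 / R\<^sup>2) = pi / 2 * (pi * min 1 (t\<^sup>2 / R\<^sup>2))" by (simp add: power2_eq_square)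
    then have "ennreal (pi\<^sup>2 / 2 * min 1 (t\<^sup>2 / R\<^sup>2)) = ennreal (pi / 2) * ennreal (pi * min 1 (t\<^sup>2 / R\<^sup>2))"
      by (simp only:) (rule ennreal_mult, auto)
    then show ?thesis using eq F1 by simp
  qed
  then show ?thesis unfolding R2 by (subst (asm) ennreal_mult_cancel_left) simp
qed

text \<open>
  The averaged parallel sections have the same kernel as the central ones, truncated: by \<open>pencil_cap\<close> it is
  constant for \<open>\<bar>p\<bar> \<le> t\<close> and proportional to \<open>1/\<bar>p\<bar>\<^sup>2\<close> beyond. The width \<open>t sqrt (1 + \<bar>m\<bar>\<^sup>2)\<close> is chosen for
  this effect.
\<close>

lemma pencil_second_kernel:
  assumes [measurable]: "K \<in> sets borel" and t: "t > 0"
  shows "(\<integral>\<^sup>+m. ennreal ((1 / (1 + (norm m)\<^sup>2))\<^sup>2) * slab_volume K m (x2 - m * x1) (t * sqrt (1 + (norm m)\<^sup>2)) \<partial>lborel)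
    = (\<integral>\<^sup>+p1. \<integral>\<^sup>+p2. line_area K x1 x2 p1 p2 * ennreal (pi * min 1 (t\<^sup>2 / ((norm p1)\<^sup>2 + (norm p2)\<^sup>2))) \<partial>lborel \<partial>lborel)"
proof -
  let ?W = "\<lambda>m::complex. ennreal ((1 / (1 + (norm m)\<^sup>2))\<^sup>2)"
  let ?i = "\<lambda>m p1 p2. indicator {0<..} (t * sqrt (1 + (norm m)\<^sup>2) - norm (p2 - m * p1)) :: ennreal"
  have i: "indicator {..<t * sqrt (1 + (norm m)\<^sup>2)} (norm (p2 - m * p1)) = ?i m p1 p2" for m p1 p2
    by (simp add: indicator_def)
  have "(\<integral>\<^sup>+m. ?W m * slab_volume K m (x2 - m * x1) (t * sqrt (1 + (norm m)\<^sup>2)) \<partial>lborel)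
     = (\<integral>\<^sup>+m. \<integral>\<^sup>+p1. \<integral>\<^sup>+p2. ?W m * (line_area K x1 x2 p1 p2 * ?i m p1 p2) \<partial>lborel \<partial>lborel \<partial>lborel)"
    unfolding slab_volume_pencil[OF assms(1)] i by (simp add: nn_integral_cmult)
  also have "\<dots> = (\<integral>\<^sup>+p1. \<integral>\<^sup>+p2. \<integral>\<^sup>+m. ?W m * (line_area K x1 x2 p1 p2 * ?i m p1 p2) \<partial>lborel \<partial>lborel \<partial>lborel)"
    by (rule nn_integral_rotate) measurable
  also have "\<dots> = (\<integral>\<^sup>+p1. \<integral>\<^sup>+p2. \<integral>\<^sup>+m. line_area K x1 x2 p1 p2 * (?W m * ?i m p1 p2) \<partial>lborel \<partial>lborel \<partial>lborel)"
    by (simp only: mult_ac)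
  also have "\<dots> = (\<integral>\<^sup>+p1. \<integral>\<^sup>+p2. line_area K x1 x2 p1 p2 * (\<integral>\<^sup>+m. ?W m * ?i m p1 p2 \<partial>lborel) \<partial>lborel \<partial>lborel)"
    by (intro nn_integral_cong nn_integral_cmult) measurable
  also have "\<dots> = (\<integral>\<^sup>+p1. \<integral>\<^sup>+p2. line_area K x1 x2 p1 p2 * ennreal (pi * min 1 (t\<^sup>2 / ((norm p1)\<^sup>2 + (norm p2)\<^sup>2))) \<partial>lborel \<partial>lborel)"
  proof (rule nn_integral_cong_AE, use AE_lborel_singleton[of "0::complex"] in eventually_elim)
    fix p1 :: complex assume "p1 \<noteq> 0"
    then show "(\<integral>\<^sup>+p2. line_area K x1 x2 p1 p2 * (\<integral>\<^sup>+m. ?W m * ?i m p1 p2 \<partial>lborel) \<partial>lborel)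
      = (\<integral>\<^sup>+p2. line_area K x1 x2 p1 p2 * ennreal (pi * min 1 (t\<^sup>2 / ((norm p1)\<^sup>2 + (norm p2)\<^sup>2))) \<partial>lborel)"
      using pencil_cap[of p1 _ t] t by (simp add: i)
  qed
  finally show ?thesis .
qed

text \<open>
  Central section minus the average of the parallel sections in a slab of \<open>v\<close>-width \<open>t sqrt (1 + \<bar>m\<bar>\<^sup>2)\<close>, that is, of
  width \<open>t\<close> measured in the \<open>(u, v)\<close>-plane.
\<close>

definition section_deficit :: "real \<Rightarrow> (complex \<times> complex \<times> complex) set \<Rightarrow> complex \<Rightarrow> complex \<Rightarrow> ennreal" where
  "section_deficit t K m b = plane_area K m b
     - ennreal (1 / (1 + (norm m)\<^sup>2) / (pi * t\<^sup>2)) * slab_volume K m b (t * sqrt (1 + (norm m)\<^sup>2))"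

lemma measurable_section_deficit [measurable (raw)]:
  assumes [measurable]: "K \<in> sets borel" "f \<in> borel_measurable M" "g \<in> borel_measurable M"
  shows "(\<lambda>x. section_deficit t K (f x) (g x)) \<in> borel_measurable M"
  unfolding section_deficit_def by measurable

text \<open>
  Since \<open>ennreal\<close> truncates negative numbers, this is \<open>max 0 (1/\<bar>p\<bar>\<^sup>2 - 1/t\<^sup>2)\<close>.
\<close>

definition cap_kernel :: "real \<Rightarrow> complex \<Rightarrow> complex \<Rightarrow> ennreal" where
  "cap_kernel t p1 p2 = ennreal (1 / ((norm p1)\<^sup>2 + (norm p2)\<^sup>2) - 1 / t\<^sup>2)"

lemma measurable_cap_kernel [measurable (raw)]:
  assumes [measurable]: "f \<in> borel_measurable M" "g \<in> borel_measurable M"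
  shows "(\<lambda>x. cap_kernel t (f x) (g x)) \<in> borel_measurable M"
  unfolding cap_kernel_def by measurable

text \<open>
  The truncated subtraction in the deficit is exact, because the central section dominates the average.
\<close>

lemma section_deficit_add:
  assumes K: "K \<in> sets borel" "convex K" "bounded K" "\<forall>x\<in>K. - x \<in> K" and t: "t > 0"
  shows "section_deficit t K m b + ennreal (1 / (1 + (norm m)\<^sup>2) / (pi * t\<^sup>2)) * slab_volume K m b (t * sqrt (1 + (norm m)\<^sup>2))
     = plane_area K m b"
  unfolding section_deficit_def
proof (rule diff_add_cancel_ennreal)
  let ?w = "1 + (norm m)\<^sup>2"
  have w: "?w > 0" by (simp add: add_pos_nonneg)
  have "ennreal (1 / ?w / (pi * t\<^sup>2)) * slab_volume K m b (t * sqrt ?w)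
     \<le> ennreal (1 / ?w / (pi * t\<^sup>2)) * (ennreal (pi * (t * sqrt ?w)\<^sup>2) * plane_area K m b)"
    using slab_volume_le[OF K, of "t * sqrt ?w" m b] t w by (intro mult_left_mono) auto
  also have "\<dots> = ennreal (1 / ?w / (pi * t\<^sup>2) * (pi * (t * sqrt ?w)\<^sup>2)) * plane_area K m b"
  proof -
    have "0 \<le> 1 / ?w / (pi * t\<^sup>2)" "0 \<le> pi * (t * sqrt ?w)\<^sup>2" using w by auto
    then show ?thesis by (simp only: ennreal_mult mult.assoc)
  qed
  also have "1 / ?w / (pi * t\<^sup>2) * (pi * (t * sqrt ?w)\<^sup>2) = 1"
    using t w by (simp add: power_mult_distrib)
  finally show "ennreal (1 / ?w / (pi * t\<^sup>2)) * slab_volume K m b (t * sqrt ?w) \<le> plane_area K m b" by simp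
qed

lemma line_area_total:
  assumes [measurable]: "K \<in> sets borel"
  shows "(\<integral>\<^sup>+p1. \<integral>\<^sup>+p2. line_area K x1 x2 p1 p2 \<partial>lborel \<partial>lborel) = emeasure lborel K"
proof -
  have "emeasure lborel K = (\<integral>\<^sup>+x. indicator K x \<partial>lborel)" by simp
  also have "\<dots> = (\<integral>\<^sup>+u. \<integral>\<^sup>+q. indicator K (u, q) \<partial>lborel \<partial>lborel)"
    by (rule nn_integral_lborel_pair) measurable
  also have "\<dots> = (\<integral>\<^sup>+u. \<integral>\<^sup>+v. \<integral>\<^sup>+w. indicator K (u, v, w) \<partial>lborel \<partial>lborel \<partial>lborel)"
    by (intro nn_integral_cong nn_integral_lborel_pair) measurable
  also have "\<dots> = (\<integral>\<^sup>+p1. \<integral>\<^sup>+p2. line_area K x1 x2 p1 p2 \<partial>lborel \<partial>lborel)"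
    unfolding line_area_def by (rule nn_integral_shear) measurable
  finally show ?thesis ..
qed

text \<open>
  The two kernels cancel for \<open>\<bar>p\<bar> \<ge> t\<close>. This localization is what makes the deficits of the planes through
  a point recover the slice through that point.
\<close>

lemma pencil_deficit:
  assumes K: "K \<in> sets borel" "convex K" "bounded K" "\<forall>x\<in>K. - x \<in> K" and t: "t > 0"
  shows "(\<integral>\<^sup>+m. ennreal (1 / (1 + (norm m)\<^sup>2)) * section_deficit t K m (x2 - m * x1) \<partial>lborel)
    = (\<integral>\<^sup>+p1. \<integral>\<^sup>+p2. line_area K x1 x2 p1 p2 * cap_kernel t p1 p2 \<partial>lborel \<partial>lborel)" (is "?Q = ?C")
proof -
  note [measurable] = K(1)
  let ?W = "\<lambda>m::complex. 1 / (1 + (norm m)\<^sup>2)"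
  let ?S = "\<lambda>m. slab_volume K m (x2 - m * x1) (t * sqrt (1 + (norm m)\<^sup>2))"
  let ?k = "\<lambda>p1 p2 :: complex. ennreal (1 / (pi * t\<^sup>2)) * ennreal (pi * min 1 (t\<^sup>2 / ((norm p1)\<^sup>2 + (norm p2)\<^sup>2)))"
  let ?l = "line_area K x1 x2"
  let ?q = "\<lambda>m. section_deficit t K m (x2 - m * x1)"
  let ?s = "\<lambda>m. ennreal (1 / (pi * t\<^sup>2)) * (ennreal ((?W m)\<^sup>2) * ?S m)"
  \<comment> \<open>The contribution of the slabs, which is finite and is cancelled at the end.\<close>
  define T where "T = (\<integral>\<^sup>+p1. \<integral>\<^sup>+p2. ?l p1 p2 * ?k p1 p2 \<partial>lborel \<partial>lborel)"
  have T: "(\<integral>\<^sup>+m. ?s m \<partial>lborel) = T"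
  proof -
    have "(\<integral>\<^sup>+m. ?s m \<partial>lborel)
      = ennreal (1 / (pi * t\<^sup>2)) * (\<integral>\<^sup>+m. ennreal ((?W m)\<^sup>2) * ?S m \<partial>lborel)"
      by (rule nn_integral_cmult) measurable
    also have "\<dots> = (\<integral>\<^sup>+p1. \<integral>\<^sup>+p2. ennreal (1 / (pi * t\<^sup>2)) * (?l p1 p2 * ennreal (pi * min 1 (t\<^sup>2 / ((norm p1)\<^sup>2 + (norm p2)\<^sup>2)))) \<partial>lborel \<partial>lborel)"
      unfolding pencil_second_kernel[OF K(1) t] by (simp add: nn_integral_cmult)
    finally show ?thesis unfolding T_def by (simp only: mult_ac)
  qed
  have "?Q + T = (\<integral>\<^sup>+m. ennreal (?W m) * ?q m
      + ?s m \<partial>lborel)"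
    unfolding T[symmetric] by (rule nn_integral_add[symmetric]) measurable
  also have "\<dots> = (\<integral>\<^sup>+m. ennreal (?W m) * plane_area K m (x2 - m * x1) \<partial>lborel)"
  proof (intro nn_integral_cong)
    fix m :: complex
    have W: "?W m \<ge> 0" by (simp add: add_nonneg_nonneg)
    have "ennreal (1 / (pi * t\<^sup>2)) * ennreal ((?W m)\<^sup>2) = ennreal (?W m) * ennreal (?W m / (pi * t\<^sup>2))"
      using W by (simp add: power2_eq_square flip: ennreal_mult)
    then have "?s m = ennreal (?W m) * (ennreal (?W m / (pi * t\<^sup>2)) * ?S m)"
      by (simp only: mult.assoc[symmetric])
    from arg_cong[OF this, of "(+) (ennreal (?W m) * ?q m)"]
    have "ennreal (?W m) * ?q m + ?s m
       = ennreal (?W m) * (?q m + ennreal (?W m / (pi * t\<^sup>2)) * ?S m)"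
      by (simp only: distrib_left)
    also have "?q m + ennreal (?W m / (pi * t\<^sup>2)) * ?S m = plane_area K m (x2 - m * x1)"
      by (rule section_deficit_add[OF K t])
    finally show "ennreal (?W m) * ?q m + ?s m
       = ennreal (?W m) * plane_area K m (x2 - m * x1)" .
  qed
  also have "\<dots> = (\<integral>\<^sup>+p1. \<integral>\<^sup>+p2. ?l p1 p2 * ennreal (1 / ((norm p1)\<^sup>2 + (norm p2)\<^sup>2)) \<partial>lborel \<partial>lborel)"
    by (rule pencil_first_kernel[OF K(1)])
  also have "\<dots> = (\<integral>\<^sup>+p1. \<integral>\<^sup>+p2. ?l p1 p2 * cap_kernel t p1 p2 + ?l p1 p2 * ?k p1 p2 \<partial>lborel \<partial>lborel)"
  proof (rule nn_integral_cong_AE, use AE_lborel_singleton[of "0::complex"] in eventually_elim)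
    fix p1 :: complex assume p1: "p1 \<noteq> 0"
    have "ennreal (1 / ((norm p1)\<^sup>2 + (norm p2)\<^sup>2)) = cap_kernel t p1 p2 + ?k p1 p2" for p2 :: complex
    proof -
      define q where "q = (norm p1)\<^sup>2 + (norm p2)\<^sup>2"
      have q: "q > 0" using p1 by (simp add: q_def add_pos_nonneg)
      have k: "?k p1 p2 = ennreal (min (1 / t\<^sup>2) (1 / q))"
      proof -
        have "1 / (pi * t\<^sup>2) * (pi * min 1 (t\<^sup>2 / q)) = min (1 / t\<^sup>2) (1 / q)"
          using t q by (auto simp: min_def field_simps)
        then have "ennreal (1 / (pi * t\<^sup>2)) * ennreal (pi * min 1 (t\<^sup>2 / q)) = ennreal (min (1 / t\<^sup>2) (1 / q))"
          using q by (simp flip: ennreal_mult)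
        then show ?thesis by (simp only: q_def)
      qed
      show ?thesis
      proof (cases "1 / t\<^sup>2 \<le> 1 / q")
        case True
        then have "ennreal (1 / q) = ennreal (1 / q - 1 / t\<^sup>2) + ennreal (min (1 / t\<^sup>2) (1 / q))"
          by (simp add: min_absorb1 flip: ennreal_plus)
        then show ?thesis unfolding k cap_kernel_def by (simp only: q_def)
      next
        case False
        then have "ennreal (1 / q) = ennreal (1 / q - 1 / t\<^sup>2) + ennreal (min (1 / t\<^sup>2) (1 / q))"
          by (simp add: min_absorb2 ennreal_neg)
        then show ?thesis unfolding k cap_kernel_def by (simp only: q_def)
      qed
    qed
    then show "(\<integral>\<^sup>+p2. ?l p1 p2 * ennreal (1 / ((norm p1)\<^sup>2 + (norm p2)\<^sup>2)) \<partial>lborel)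
      = (\<integral>\<^sup>+p2. ?l p1 p2 * cap_kernel t p1 p2 + ?l p1 p2 * ?k p1 p2 \<partial>lborel)"
      by (simp only: distrib_left)
  qed
  also have "\<dots> = ?C + T"
  proof -
    have "(\<integral>\<^sup>+p2. ?l p1 p2 * cap_kernel t p1 p2 + ?l p1 p2 * ?k p1 p2 \<partial>lborel)
      = (\<integral>\<^sup>+p2. ?l p1 p2 * cap_kernel t p1 p2 \<partial>lborel) + (\<integral>\<^sup>+p2. ?l p1 p2 * ?k p1 p2 \<partial>lborel)" for p1
      by (rule nn_integral_add) measurable
    then show ?thesis unfolding T_def by (simp only:) (rule nn_integral_add, measurable)
  qed
  finally have eq: "T + ?Q = T + ?C" by (simp only: add.commute)
  have "T \<le> (\<integral>\<^sup>+p1. \<integral>\<^sup>+p2. ?l p1 p2 * ennreal (1 / t\<^sup>2) \<partial>lborel \<partial>lborel)"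
    unfolding T_def
  proof (intro nn_integral_mono mult_left_mono)
    fix p1 p2 :: complex
    have "?k p1 p2 \<le> ennreal (1 / (pi * t\<^sup>2)) * ennreal pi"
      by (intro mult_left_mono ennreal_leI) auto
    then show "?k p1 p2 \<le> ennreal (1 / t\<^sup>2)" by (simp flip: ennreal_mult)
  qed simp
  also have "\<dots> = emeasure lborel K * ennreal (1 / t\<^sup>2)"
    unfolding line_area_total[OF K(1), of x1 x2, symmetric] by (simp add: nn_integral_multc)
  also have "\<dots> < \<infinity>" using emeasure_bounded_finite[OF K(3)] by (simp add: ennreal_mult_less_top)
  finally show ?thesis using eq by (auto simp: ennreal_add_left_cancel)
qed

lemma cap_kernel_outside: "t > 0 \<Longrightarrow> t \<le> norm (p1, p2) \<Longrightarrow> cap_kernel t p1 p2 = 0"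
proof -
  assume "t > 0" "t \<le> norm (p1, p2)"
  then have "t\<^sup>2 \<le> (norm p1)\<^sup>2 + (norm p2)\<^sup>2" by (simp add: norm_Pair real_le_rsqrt sqrt_ge_absD)
  moreover have "0 < t\<^sup>2" using \<open>t > 0\<close> by simp
  ultimately have "1 / ((norm p1)\<^sup>2 + (norm p2)\<^sup>2) \<le> 1 / t\<^sup>2" by (intro divide_left_mono mult_pos_pos) linarith+
  then show ?thesis by (simp add: cap_kernel_def ennreal_neg)
qed

text \<open>
  On \<open>C\<^sup>2\<close>, which has real dimension 4, the singularity \<open>1/\<bar>p\<bar>\<^sup>2\<close> is integrable. For finiteness, \<open>\<pi>/\<bar>p\<bar>\<^sup>2\<close> is
  written as the area of \<open>{l. \<bar>p\<bar> \<bar>l\<bar> < 1}\<close> and the order of integration is exchanged.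
\<close>

lemma cap_kernel_integral:
  assumes t: "t > 0"
  shows "(\<integral>\<^sup>+p1. \<integral>\<^sup>+p2. cap_kernel t p1 p2 \<partial>lborel \<partial>lborel) < \<infinity>" (is "?I < _")
    and "0 < (\<integral>\<^sup>+p1. \<integral>\<^sup>+p2. cap_kernel t p1 p2 \<partial>lborel \<partial>lborel)"
proof -
  have [measurable]: "(\<lambda>p. cap_kernel t (fst p) (snd p)) \<in> borel_measurable borel"
    unfolding borel_prod[symmetric] by measurable
  have I: "?I = (\<integral>\<^sup>+p. cap_kernel t (fst p) (snd p) \<partial>lborel)"
    by (subst nn_integral_lborel_pair) simp_all
  have n2: "(norm (fst p))\<^sup>2 + (norm (snd p))\<^sup>2 = (norm p)\<^sup>2" for p :: "complex \<times> complex"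
    by (simp add: norm_prod_def)
  let ?h = "\<lambda>(p :: complex \<times> complex) (l :: complex). indicator {..<t} (norm p) * indicator {..<1} ((norm (norm p *\<^sub>R l))\<^sup>2) :: ennreal"
  have "ennreal pi * ?I = (\<integral>\<^sup>+p. ennreal pi * cap_kernel t (fst p) (snd p) \<partial>lborel)"
    unfolding I by (rule nn_integral_cmult[symmetric]) measurable
  also have "\<dots> \<le> (\<integral>\<^sup>+p. \<integral>\<^sup>+l. ?h p l \<partial>lborel \<partial>lborel)"
  proof (rule nn_integral_mono_AE, use AE_lborel_singleton[of "0::complex \<times> complex"] in eventually_elim)
    fix p :: "complex \<times> complex" assume p: "p \<noteq> 0"
    show "ennreal pi * cap_kernel t (fst p) (snd p) \<le> (\<integral>\<^sup>+l. ?h p l \<partial>lborel)"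
    proof (cases "norm p < t")
      case False
      then show ?thesis using cap_kernel_outside[OF t, of "fst p" "snd p"] by simp
    next
      case True
      have "ennreal pi = (\<integral>\<^sup>+l. indicator {..<1} ((norm (l :: complex))\<^sup>2) \<partial>lborel)"
        by (simp add: nn_integral_disc)
      also have "\<dots> = ennreal ((norm p) ^ DIM(complex)) * (\<integral>\<^sup>+l. indicator {..<1} ((norm (norm p *\<^sub>R l :: complex))\<^sup>2) \<partial>lborel)"
        using p by (intro nn_integral_lborel_scaleR) auto
      finally have "ennreal (1 / (norm p)\<^sup>2) * ennreal pi = ennreal (1 / (norm p)\<^sup>2) * (ennreal ((norm p)\<^sup>2) * (\<integral>\<^sup>+l. ?h p l \<partial>lborel))"
        using True by simp
      also have "\<dots> = (\<integral>\<^sup>+l. ?h p l \<partial>lborel)"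
        using p by (simp add: mult.assoc[symmetric] flip: ennreal_mult)
      finally have 1: "(\<integral>\<^sup>+l. ?h p l \<partial>lborel) = ennreal (1 / (norm p)\<^sup>2) * ennreal pi" by simp
      show ?thesis unfolding 1 cap_kernel_def n2 by (subst mult.commute) (intro mult_right_mono ennreal_leI, auto)
    qed
  qed
  also have "\<dots> = (\<integral>\<^sup>+l. \<integral>\<^sup>+p. ?h p l \<partial>lborel \<partial>lborel)"
    by (rule nn_integral_swap) measurable
  also have "\<dots> \<le> (\<integral>\<^sup>+l. ennreal (unit_ball_vol 4 * max 1 (t ^ 4)) * ennreal (1 / max 1 (norm l ^ 4)) \<partial>complex_lborel)"
  proof (intro nn_integral_mono)
    fix l :: complex
    have "(\<integral>\<^sup>+p. ?h p l \<partial>lborel) \<le> ennreal (unit_ball_vol 4 * r ^ 4)" if r: "r > 0" "r = t \<or> (l \<noteq> 0 \<and> r = 1 / norm l)" for r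
    proof -
      have "(\<integral>\<^sup>+p. ?h p l \<partial>lborel) \<le> (\<integral>\<^sup>+p. indicator (ball 0 r) p \<partial>(lborel :: (complex \<times> complex) measure))"
        using r by (intro nn_integral_mono) (auto simp: indicator_def power_mult_distrib abs_square_less_1 field_simps simp flip: power_mult_distrib)
      then show ?thesis using r by (simp add: emeasure_ball)
    qed
    note b = this
    show "(\<integral>\<^sup>+p. ?h p l \<partial>lborel) \<le> ennreal (unit_ball_vol 4 * max 1 (t ^ 4)) * ennreal (1 / max 1 (norm l ^ 4))"
    proof (cases "norm l \<le> 1")
      case True
      then have "max 1 (norm l ^ 4) = 1" by (intro max_absorb1) (simp add: power_le_one)
      moreover have "ennreal (unit_ball_vol 4 * t ^ 4) \<le> ennreal (unit_ball_vol 4 * max 1 (t ^ 4))"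
        by (intro ennreal_leI mult_left_mono) auto
      ultimately show ?thesis using b[of t] t by (simp add: order_trans)
    next
      case False
      then have "(\<integral>\<^sup>+p. ?h p l \<partial>lborel) \<le> ennreal (unit_ball_vol 4 * (1 / norm l) ^ 4)" by (intro b) auto
      also have "\<dots> \<le> ennreal (unit_ball_vol 4 * max 1 (t ^ 4) * (1 / max 1 (norm l ^ 4)))"
      proof (intro ennreal_leI)
        have "max 1 (norm l ^ 4) = norm l ^ 4" using False by (intro max_absorb2) (simp add: one_le_power)
        moreover have "1 * (1 / norm l ^ 4) \<le> max 1 (t ^ 4) * (1 / norm l ^ 4)" by (intro mult_right_mono) auto
        ultimately show "unit_ball_vol 4 * (1 / norm l) ^ 4 \<le> unit_ball_vol 4 * max 1 (t ^ 4) * (1 / max 1 (norm l ^ 4))"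
          unfolding mult.assoc by (intro mult_left_mono) (auto simp: power_divide)
      qed
      also have "\<dots> = ennreal (unit_ball_vol 4 * max 1 (t ^ 4)) * ennreal (1 / max 1 (norm l ^ 4))"
        by (intro ennreal_mult) auto
      finally show ?thesis .
    qed
  qed
  also have "\<dots> < \<infinity>"
    using nn_integral_inverse_fourth_power_finite by (simp add: nn_integral_cmult ennreal_mult_less_top)
  finally show "?I < \<infinity>" by (auto simp: ennreal_mult_less_top)
  have "0 < ennreal (3 / t\<^sup>2) * emeasure lborel (ball 0 (t / 2) :: (complex \<times> complex) set)"
    using t unit_ball_vol_pos[of 4] by (simp add: emeasure_ball ennreal_zero_less_mult_iff del: unit_ball_vol_pos)
  also have "\<dots> = (\<integral>\<^sup>+p. ennreal (3 / t\<^sup>2) * indicator (ball 0 (t / 2)) p \<partial>(lborel :: (complex \<times> complex) measure))"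
    by (simp add: nn_integral_cmult)
  also have "\<dots> \<le> (\<integral>\<^sup>+p. cap_kernel t (fst p) (snd p) \<partial>lborel)"
  proof (rule nn_integral_mono_AE, use AE_lborel_singleton[of "0::complex \<times> complex"] in eventually_elim)
    fix p :: "complex \<times> complex" assume p: "p \<noteq> 0"
    show "ennreal (3 / t\<^sup>2) * indicator (ball 0 (t / 2)) p \<le> cap_kernel t (fst p) (snd p)"
    proof (cases "norm p < t / 2")
      case True
      then have "(norm p)\<^sup>2 \<le> (t / 2)\<^sup>2" by (intro power_mono) auto
      then have "1 / (t / 2)\<^sup>2 \<le> 1 / (norm p)\<^sup>2" using p t by (intro divide_left_mono) auto
      then have "3 / t\<^sup>2 \<le> 1 / (norm p)\<^sup>2 - 1 / t\<^sup>2" by (simp add: power_divide)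
      then show ?thesis using True by (auto simp: cap_kernel_def n2 indicator_def intro!: ennreal_leI)
    qed (simp add: indicator_def)
  qed
  finally show "0 < ?I" unfolding I .
qed

section \<open>Comparison of bodies through their plane sections\<close>

lemma line_area_le:
  assumes K: "K \<in> sets borel" "convex K" "bounded K" "\<forall>x\<in>K. - x \<in> K"
  shows "line_area K x1 x2 p1 p2 \<le> line_area K x1 x2 0 0"
proof -
  let ?g = "\<lambda>l::complex. (l * x1, l * x2, l)"
  have "linear ?g" "inj ?g" by (auto intro!: linearI simp: algebra_simps inj_def)
  from section_central_max[OF this K, of "(p1, p2, 0)"] show ?thesis by (simp add: line_area_def)
qed

text \<open>
  Lower semicontinuity of the slices, with an explicit rate: \<open>(1 - d) K + d (cball 0 r)\<close> is contained in \<open>K\<close>, so a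
  slice displaced by at most \<open>d r\<close> contains the central one shrunk by \<open>1 - d\<close>.
\<close>

lemma line_area_ge:
  assumes K: "K \<in> sets borel" "convex K" and r: "cball 0 r \<subseteq> K" and d: "0 < d" "d < 1"
    and p: "norm (p1, p2) \<le> d * r"
  shows "ennreal ((1 - d)\<^sup>2) * line_area K x1 x2 0 0 \<le> line_area K x1 x2 p1 p2"
proof -
  note [measurable] = K(1)
  let ?q = "\<lambda>l. (p1 + ((1 - d) *\<^sub>R l) * x1, p2 + ((1 - d) *\<^sub>R l) * x2, (1 - d) *\<^sub>R l)"
  have "line_area K x1 x2 p1 p2 = ennreal ((1 - d) ^ DIM(complex))
      * (\<integral>\<^sup>+l. indicator K (?q l) \<partial>lborel)"
    unfolding line_area_def using d by (intro nn_integral_lborel_scaleR) auto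
  moreover have "line_area K x1 x2 0 0 \<le> (\<integral>\<^sup>+l. indicator K (?q l) \<partial>lborel)"
    unfolding line_area_def
  proof (intro nn_integral_mono)
    fix l :: complex
    have "?q l \<in> K" if l: "(l * x1, l * x2, l) \<in> K"
    proof -
      have "norm (p1, p2, 0 :: complex) = norm (p1, p2)" by (simp add: norm_Pair)
      then have "norm ((1 / d) *\<^sub>R (p1, p2, 0 :: complex)) \<le> r"
        using p d by (simp only: norm_scaleR) (simp add: field_simps)
      then have "(1 / d) *\<^sub>R (p1, p2, 0 :: complex) \<in> cball 0 r" by (simp only: mem_cball dist_0_norm)
      then have "(1 / d) *\<^sub>R (p1, p2, 0) \<in> K" using r by blast
      then have "(1 - d) *\<^sub>R (l * x1, l * x2, l) + d *\<^sub>R ((1 / d) *\<^sub>R (p1, p2, 0)) \<in> K"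
        using l K(2) d by (intro convexD) auto
      then show ?thesis using d by (simp add: add.commute)
    qed
    then show "indicator K (0 + l * x1, 0 + l * x2, l)
       \<le> (indicator K (?q l) :: ennreal)"
      by (auto simp: indicator_def)
  qed
  ultimately show ?thesis by (simp add: mult_left_mono)
qed

text \<open>
  The area \<open>s\<^sub>K\<close> of the slice through the origin and \<open>(u, v, w)\<close>, parametrized by multiples of this vector.
\<close>

definition disc_area :: "(complex \<times> complex \<times> complex) set \<Rightarrow> complex \<Rightarrow> complex \<Rightarrow> complex \<Rightarrow> ennreal" where
  "disc_area K u v w = (\<integral>\<^sup>+l. indicator K (l * u, l * v, l * w) \<partial>lborel)"

lemma measurable_disc_area [measurable (raw)]:
  assumes [measurable]: "K \<in> sets borel" "f \<in> borel_measurable M" "g \<in> borel_measurable M" "h \<in> borel_measurable M"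
  shows "(\<lambda>x. disc_area K (f x) (g x) (h x)) \<in> borel_measurable M"
  unfolding disc_area_def by measurable

lemma line_area_center:
  assumes [measurable]: "K \<in> sets borel" and w: "w \<noteq> 0"
  shows "ennreal (1 / (norm w)\<^sup>2) * line_area K (u / w) (v / w) 0 0 = disc_area K u v w"
proof -
  have "line_area K (u / w) (v / w) 0 0 = ennreal ((norm w)\<^sup>2) * (\<integral>\<^sup>+l. indicator K (0 + (w * l) * (u / w), 0 + (w * l) * (v / w), w * l) \<partial>lborel)"
    unfolding line_area_def by (rule nn_integral_complex_mult[OF _ w]) measurable
  also have "\<dots> = ennreal ((norm w)\<^sup>2) * disc_area K u v w"
    using w by (simp add: disc_area_def mult_ac)
  finally show ?thesis using w by (simp add: mult.assoc[symmetric] flip: ennreal_mult)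
qed

text \<open>
  The section functionals of \<open>D\<close> superposed with the deficits of \<open>K\<close> as weights; monotone in the sections of \<open>D\<close>.
\<close>

definition paired_energy :: "real \<Rightarrow> (complex \<times> complex \<times> complex) set \<Rightarrow> (complex \<times> complex \<times> complex) set \<Rightarrow> ennreal" where
  "paired_energy t K D = (\<integral>\<^sup>+m. \<integral>\<^sup>+b. plane_area D m b * (ennreal (1 / (1 + (norm m)\<^sup>2)) * section_deficit t K m b) \<partial>lborel \<partial>lborel)"

definition cap_mass :: "real \<Rightarrow> ennreal" where
  "cap_mass t = (\<integral>\<^sup>+p1. \<integral>\<^sup>+p2. cap_kernel t p1 p2 \<partial>lborel \<partial>lborel)"

definition disc_integral :: "(complex \<times> complex \<times> complex) set \<Rightarrow> (complex \<times> complex \<times> complex) set \<Rightarrow> ennreal" where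
  "disc_integral K D = (\<integral>\<^sup>+u. \<integral>\<^sup>+v. \<integral>\<^sup>+w. indicator D (u, v, w) * disc_area K u v w \<partial>lborel \<partial>lborel \<partial>lborel)"

lemma paired_energy_eq:
  assumes K: "K \<in> sets borel" "convex K" "bounded K" "\<forall>x\<in>K. - x \<in> K" and t: "t > 0"
    and D[measurable]: "D \<in> sets borel"
  shows "paired_energy t K D = (\<integral>\<^sup>+u. \<integral>\<^sup>+v. \<integral>\<^sup>+w. indicator D (u, v, w) * ennreal (1 / (norm w)\<^sup>2)
     * (\<integral>\<^sup>+p1. \<integral>\<^sup>+p2. line_area K (u / w) (v / w) p1 p2 * cap_kernel t p1 p2 \<partial>lborel \<partial>lborel) \<partial>lborel \<partial>lborel \<partial>lborel)"
proof -
  note [measurable] = K(1)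
  let ?I = "\<lambda>u v w. \<integral>\<^sup>+p1. \<integral>\<^sup>+p2. line_area K (u / w) (v / w) p1 p2 * cap_kernel t p1 p2 \<partial>lborel \<partial>lborel"
  have "paired_energy t K D = (\<integral>\<^sup>+u. \<integral>\<^sup>+v. \<integral>\<^sup>+w. indicator D (u, v, w) * ennreal (1 / (norm w)\<^sup>2)
     * (\<integral>\<^sup>+m. ennreal (1 / (1 + (norm m)\<^sup>2)) * section_deficit t K m ((v - m * u) / w) \<partial>lborel) \<partial>lborel \<partial>lborel \<partial>lborel)"
    unfolding paired_energy_def by (rule point_plane_duality) measurable
  also have "\<dots> = (\<integral>\<^sup>+u. \<integral>\<^sup>+v. \<integral>\<^sup>+w. indicator D (u, v, w) * ennreal (1 / (norm w)\<^sup>2)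
     * ?I u v w \<partial>lborel \<partial>lborel \<partial>lborel)"
  proof (rule nn_integral_cong, rule nn_integral_cong, rule nn_integral_cong)
    fix u v w :: complex
    have "(v - m * u) / w = v / w - m * (u / w)" for m by (simp add: diff_divide_distrib)
    then show "indicator D (u, v, w) * ennreal (1 / (norm w)\<^sup>2)
      * (\<integral>\<^sup>+m. ennreal (1 / (1 + (norm m)\<^sup>2)) * section_deficit t K m ((v - m * u) / w) \<partial>lborel)
      = indicator D (u, v, w) * ennreal (1 / (norm w)\<^sup>2)
      * ?I u v w"
      by (simp only: pencil_deficit[OF K t])
  qed
  finally show ?thesis .
qed

lemma cap_mass_line_area:
  assumes K: "K \<in> sets borel" and w: "w \<noteq> 0"
  shows "indicator D (u, v, w) * ennreal (1 / (norm w)\<^sup>2) * (\<integral>\<^sup>+p1. \<integral>\<^sup>+p2. c * line_area K (u / w) (v / w) 0 0 * cap_kernel t p1 p2 \<partial>lborel \<partial>lborel)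
     = c * cap_mass t * (indicator D (u, v, w) * disc_area K u v w)"
proof -
  have "(\<integral>\<^sup>+p1. \<integral>\<^sup>+p2. c * line_area K (u / w) (v / w) 0 0 * cap_kernel t p1 p2 \<partial>lborel \<partial>lborel)
      = c * line_area K (u / w) (v / w) 0 0 * cap_mass t"
    unfolding cap_mass_def by (simp add: nn_integral_cmult)
  then show ?thesis
    unfolding line_area_center[OF assms, symmetric] by (simp only: mult_ac)
qed

lemma paired_energy_le:
  assumes K: "K \<in> sets borel" "convex K" "bounded K" "\<forall>x\<in>K. - x \<in> K" and t: "t > 0"
    and D[measurable]: "D \<in> sets borel"
  shows "paired_energy t K D \<le> cap_mass t * disc_integral K D"
proof -
  note [measurable] = K(1)
  let ?I = "\<lambda>u v w. \<integral>\<^sup>+p1. \<integral>\<^sup>+p2. line_area K (u / w) (v / w) p1 p2 * cap_kernel t p1 p2 \<partial>lborel \<partial>lborel"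
  have "paired_energy t K D \<le> (\<integral>\<^sup>+u. \<integral>\<^sup>+v. \<integral>\<^sup>+w. cap_mass t * (indicator D (u, v, w) * disc_area K u v w) \<partial>lborel \<partial>lborel \<partial>lborel)"
    unfolding paired_energy_eq[OF K t D]
  proof (rule nn_integral_mono, rule nn_integral_mono)
    fix u v :: complex
    show "(\<integral>\<^sup>+w. indicator D (u, v, w) * ennreal (1 / (norm w)\<^sup>2)
       * ?I u v w \<partial>lborel)
      \<le> (\<integral>\<^sup>+w. cap_mass t * (indicator D (u, v, w) * disc_area K u v w) \<partial>lborel)"
    proof (rule nn_integral_mono_AE, use AE_lborel_singleton[of "0::complex"] in eventually_elim)
      fix w :: complex assume w: "w \<noteq> 0"
      have "indicator D (u, v, w) * ennreal (1 / (norm w)\<^sup>2)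
         * ?I u v w
        \<le> indicator D (u, v, w) * ennreal (1 / (norm w)\<^sup>2)
         * (\<integral>\<^sup>+p1. \<integral>\<^sup>+p2. 1 * line_area K (u / w) (v / w) 0 0 * cap_kernel t p1 p2 \<partial>lborel \<partial>lborel)"
        using line_area_le[OF K] by (intro mult_left_mono nn_integral_mono mult_right_mono) simp_all
      then show "indicator D (u, v, w) * ennreal (1 / (norm w)\<^sup>2)
         * ?I u v w
        \<le> cap_mass t * (indicator D (u, v, w) * disc_area K u v w)"
        unfolding cap_mass_line_area[OF K(1) w] by simp
    qed
  qed
  also have "\<dots> = cap_mass t * disc_integral K D"
    unfolding disc_integral_def by (simp add: nn_integral_cmult)
  finally show ?thesis .
qed

lemma paired_energy_ge:
  assumes K: "K \<in> sets borel" "convex K" "bounded K" "\<forall>x\<in>K. - x \<in> K"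
    and r: "r > 0" "cball 0 r \<subseteq> K" and d: "0 < d" "d < 1"
    and D[measurable]: "D \<in> sets borel"
  shows "ennreal ((1 - d)\<^sup>2) * (cap_mass (d * r) * disc_integral K D) \<le> paired_energy (d * r) K D"
proof -
  note [measurable] = K(1)
  let ?I = "\<lambda>u v w. \<integral>\<^sup>+p1. \<integral>\<^sup>+p2. line_area K (u / w) (v / w) p1 p2 * cap_kernel (d * r) p1 p2 \<partial>lborel \<partial>lborel"
  have t: "d * r > 0" using r d by simp
  have "ennreal ((1 - d)\<^sup>2) * (cap_mass (d * r) * disc_integral K D)
     = (\<integral>\<^sup>+u. \<integral>\<^sup>+v. \<integral>\<^sup>+w. ennreal ((1 - d)\<^sup>2) * cap_mass (d * r) * (indicator D (u, v, w) * disc_area K u v w) \<partial>lborel \<partial>lborel \<partial>lborel)"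
    unfolding disc_integral_def by (simp add: nn_integral_cmult mult.assoc)
  also have "\<dots> \<le> paired_energy (d * r) K D"
    unfolding paired_energy_eq[OF K t D]
  proof (rule nn_integral_mono, rule nn_integral_mono)
    fix u v :: complex
    show "(\<integral>\<^sup>+w. ennreal ((1 - d)\<^sup>2) * cap_mass (d * r) * (indicator D (u, v, w) * disc_area K u v w) \<partial>lborel)
      \<le> (\<integral>\<^sup>+w. indicator D (u, v, w) * ennreal (1 / (norm w)\<^sup>2)
       * ?I u v w \<partial>lborel)"
    proof (rule nn_integral_mono_AE, use AE_lborel_singleton[of "0::complex"] in eventually_elim)
      fix w :: complex assume w: "w \<noteq> 0"
      show "ennreal ((1 - d)\<^sup>2) * cap_mass (d * r) * (indicator D (u, v, w) * disc_area K u v w)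
        \<le> indicator D (u, v, w) * ennreal (1 / (norm w)\<^sup>2)
         * ?I u v w"
        unfolding cap_mass_line_area[OF K(1) w, symmetric]
      proof (intro mult_left_mono nn_integral_mono)
        fix p1 p2 :: complex
        show "ennreal ((1 - d)\<^sup>2) * line_area K (u / w) (v / w) 0 0 * cap_kernel (d * r) p1 p2
           \<le> line_area K (u / w) (v / w) p1 p2 * cap_kernel (d * r) p1 p2"
        proof (cases "norm (p1, p2) \<le> d * r")
          case True
          then show ?thesis using line_area_ge[OF K(1,2) r(2) d] by (intro mult_right_mono) auto
        next
          case False
          then show ?thesis using cap_kernel_outside[OF t, of p1 p2] by simp
        qed
      qed simp
    qed
  qed
  finally show ?thesis .
qed

text \<open>
  The paired energies inherit the inequality between the sections. With \<open>t = d r\<close>, that of \<open>K\<close> is at least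
  \<open>(1 - d)\<^sup>2 * cap_mass t\<close> times its integral, and those of \<open>D\<close> and \<open>E\<close> are at most \<open>cap_mass t\<close> times theirs; the
  common factor cancels and \<open>d\<close> tends to 0.
\<close>

lemma disc_integral_comparison:
  assumes K: "K \<in> sets borel" "convex K" "bounded K" "\<forall>x\<in>K. - x \<in> K"
    and r: "r > 0" "cball 0 r \<subseteq> K"
    and D: "D \<in> sets borel" and E: "E \<in> sets borel"
    and le: "\<And>m b. plane_area K m b \<le> plane_area D m b + plane_area E m b"
  shows "disc_integral K K \<le> disc_integral K D + disc_integral K E"
proof -
  note [measurable] = K(1) D E
  let ?Y = "disc_integral K D + disc_integral K E"
  have main: "ennreal ((1 - d)\<^sup>2) * disc_integral K K \<le> ?Y" if d: "0 < d" "d < 1" for d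
  proof -
    define t where "t = d * r"
    have t: "t > 0" using r d by (simp add: t_def)
    have m: "cap_mass t \<noteq> 0" "cap_mass t \<noteq> top"
      using cap_kernel_integral[OF t] by (auto simp: cap_mass_def)
    have "ennreal ((1 - d)\<^sup>2) * (cap_mass t * disc_integral K K) \<le> paired_energy t K K"
      unfolding t_def by (rule paired_energy_ge[OF K r d K(1)])
    also have "\<dots> \<le> (\<integral>\<^sup>+m. \<integral>\<^sup>+b. (plane_area D m b + plane_area E m b) * (ennreal (1 / (1 + (norm m)\<^sup>2)) * section_deficit t K m b) \<partial>lborel \<partial>lborel)"
      unfolding paired_energy_def by (intro nn_integral_mono mult_right_mono le) simp
    also have "\<dots> = paired_energy t K D + paired_energy t K E"
      unfolding paired_energy_def by (simp add: distrib_right nn_integral_add)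
    also have "\<dots> \<le> cap_mass t * disc_integral K D + cap_mass t * disc_integral K E"
      by (intro add_mono paired_energy_le[OF K t] D E)
    also have "\<dots> = cap_mass t * ?Y" by (simp add: distrib_left)
    finally have "cap_mass t * (ennreal ((1 - d)\<^sup>2) * disc_integral K K) \<le> cap_mass t * ?Y" by (simp add: mult_ac)
    then show ?thesis using m by (simp add: ennreal_mult_le_mult_iff)
  qed
  show ?thesis
  proof (rule tendsto_upperbound)
    have "((\<lambda>d. ennreal ((1 - d)\<^sup>2) * disc_integral K K) \<longlongrightarrow> ennreal ((1 - 0)\<^sup>2) * disc_integral K K) (at_right 0)"
      by (intro tendsto_mult_ennreal tendsto_ennrealI tendsto_intros) auto
    then show "((\<lambda>d. ennreal ((1 - d)\<^sup>2) * disc_integral K K) \<longlongrightarrow> disc_integral K K) (at_right 0)" by simp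
    show "\<forall>\<^sub>F d in at_right 0. ennreal ((1 - d)\<^sup>2) * disc_integral K K \<le> ?Y"
      using main by (auto simp: eventually_at_right_field intro!: exI[of _ 1])
  qed simp
qed

section \<open>Volume and slices by complex lines\<close>

lemma linear_complex_scale: "linear (\<lambda>x :: complex ^ 'n. l *s x)"
  by (rule linearI) (simp_all add: vec_eq_iff algebra_simps)

lemma linear_complex_scale_left: "linear (\<lambda>l. l *s (x :: complex ^ 'n))"
  by (rule linearI) (simp_all add: vec_eq_iff algebra_simps)

lemma norm_complex_scale: "norm (l *s (x :: complex ^ 'n)) = norm l * norm x"
  by (simp add: norm_vec_def norm_mult L2_set_right_distrib)

lemma measurable_complex_scale [measurable (raw)]:
  fixes g :: "'c \<Rightarrow> complex ^ 'n"
  assumes "f \<in> borel_measurable M" "g \<in> borel_measurable M"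
  shows "(\<lambda>x. f x *s g x) \<in> borel_measurable M"
proof -
  have "bounded_bilinear (\<lambda>l (x :: complex ^ 'n). l *s x)"
  proof
    show "\<exists>K. \<forall>a b. norm (a *s (b :: complex ^ 'n)) \<le> norm a * norm b * K"
      by (intro exI[of _ 1]) (simp add: norm_complex_scale)
  qed (simp_all add: vec_eq_iff algebra_simps)
  then have "continuous_on UNIV (\<lambda>p :: complex \<times> (complex ^ 'n). fst p *s snd p)"
    by (rule bounded_bilinear.continuous_on[OF _ continuous_on_fst[OF continuous_on_id] continuous_on_snd[OF continuous_on_id]])
  from borel_measurable_continuous_on[OF this borel_measurable_Pair[OF assms]] show ?thesis by simp
qed

lemma nn_integral_complex_scale:
  fixes g :: "complex ^ 'n \<Rightarrow> ennreal"
  assumes [measurable]: "g \<in> borel_measurable borel" and "l \<noteq> 0"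
  shows "(\<integral>\<^sup>+x. g x \<partial>lborel) = ennreal (norm l ^ (2 * CARD('n))) * (\<integral>\<^sup>+x. g (l *s x) \<partial>lborel)"
proof -
  define e where "e = l / of_real (norm l)"
  have e: "norm e = 1" "l = of_real (norm l) * e" using assms by (auto simp: e_def norm_divide)
  have "(\<integral>\<^sup>+x. g x \<partial>lborel) = (\<integral>\<^sup>+x. g (e *s x) \<partial>lborel)"
    by (rule nn_integral_lborel_isometry[symmetric]) (simp_all add: linear_complex_scale norm_complex_scale e(1))
  also have "\<dots> = ennreal (norm l ^ DIM(complex ^ 'n)) * (\<integral>\<^sup>+x. g (e *s (norm l *\<^sub>R x)) \<partial>lborel)"
    using assms by (intro nn_integral_lborel_scaleR) auto
  also have "(\<lambda>x :: complex ^ 'n. e *s (norm l *\<^sub>R x)) = (\<lambda>x. l *s x)"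
  proof
    fix x :: "complex ^ 'n"
    have "e *s (norm l *\<^sub>R x) = (of_real (norm l) * e) *s x"
      by (simp add: vec_eq_iff) (simp add: scaleR_conv_of_real)
    then show "e *s (norm l *\<^sub>R x) = l *s x" by (simp only: e(2)[symmetric])
  qed
  finally show ?thesis by (simp add: mult.commute fun_eq_iff)
qed

text \<open>
  When \<open>K\<close> is stable under multiplication by the unit disc, this is \<open>\<pi>\<close> times the square of its radial function.
\<close>

definition slice_area :: "(complex ^ 'n) set \<Rightarrow> complex ^ 'n \<Rightarrow> ennreal" where
  "slice_area K x = (\<integral>\<^sup>+l. indicator K (l *s x) \<partial>lborel)"

lemma measurable_slice_area [measurable]:
  assumes [measurable]: "K \<in> sets borel"
  shows "slice_area K \<in> borel_measurable borel"
  unfolding slice_area_def[abs_def] by measurable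

definition slice_integral :: "(complex ^ 'n) set \<Rightarrow> (complex ^ 'n) set \<Rightarrow> ennreal" where
  "slice_integral K D = (\<integral>\<^sup>+x. indicator D x * slice_area K x \<partial>lborel)"

text \<open>
  The value of \<open>slice_integral K K\<close> for a body of volume 1 in \<open>C\<^sup>n\<close> that is stable under multiplication by the unit
  disc. It is a common factor of all volume estimates.
\<close>

definition slice_constant :: "nat \<Rightarrow> ennreal" where
  "slice_constant n = (\<integral>\<^sup>+l. ennreal (1 / max 1 (norm l ^ (2 * n))) \<partial>complex_lborel)"

lemma slice_constant_bounds:
  assumes "n \<ge> 2"
  shows "slice_constant n < \<infinity>" "slice_constant n > 0"
proof -
  have "slice_constant n \<le> (\<integral>\<^sup>+l. ennreal (1 / max 1 (norm l ^ 4)) \<partial>complex_lborel)"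
    unfolding slice_constant_def
  proof (intro nn_integral_mono ennreal_leI)
    fix l :: complex
    have "max 1 (norm l ^ 4) \<le> max 1 (norm l ^ (2 * n))"
    proof (cases "norm l \<le> 1")
      case True
      then have "max 1 (norm l ^ 4) = 1" by (simp add: power_le_one max_absorb1)
      then show ?thesis by simp
    next
      case False
      then have "norm l ^ 4 \<le> norm l ^ (2 * n)" using assms by (intro power_increasing) auto
      then show ?thesis by auto
    qed
    then show "1 / max 1 (norm l ^ (2 * n)) \<le> 1 / max 1 (norm l ^ 4)"
      by (intro divide_left_mono mult_pos_pos) (auto simp: less_max_iff_disj)
  qed
  then show "slice_constant n < \<infinity>" using nn_integral_inverse_fourth_power_finite by (rule le_less_trans)
  have "0 < emeasure lborel (cball 0 1 :: complex set)" by (simp add: emeasure_cball unit_ball_vol_2)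
  also have "\<dots> = (\<integral>\<^sup>+l. indicator (cball 0 1) l \<partial>complex_lborel)" by simp
  also have "\<dots> \<le> slice_constant n"
    unfolding slice_constant_def
    by (intro nn_integral_mono) (auto simp: indicator_def power_le_one max_absorb1)
  finally show "slice_constant n > 0" .
qed

lemma slice_integral_eq:
  assumes [measurable]: "K \<in> sets borel" "D \<in> sets borel"
  shows "slice_integral K D = (\<integral>\<^sup>+l. emeasure lborel (D \<inter> {x. l *s x \<in> K}) \<partial>lborel)"
proof -
  have "slice_integral K D = (\<integral>\<^sup>+x. \<integral>\<^sup>+l. indicator D x * indicator K (l *s x) \<partial>lborel \<partial>lborel)"
    unfolding slice_integral_def slice_area_def by (simp add: nn_integral_cmult)
  also have "\<dots> = (\<integral>\<^sup>+l. \<integral>\<^sup>+x. indicator D x * indicator K (l *s x) \<partial>lborel \<partial>lborel)"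
    by (rule nn_integral_swap) measurable
  also have "\<dots> = (\<integral>\<^sup>+l. emeasure lborel (D \<inter> {x. l *s x \<in> K}) \<partial>lborel)"
  proof (intro nn_integral_cong)
    fix l :: complex
    have "D \<inter> {x. l *s x \<in> K} \<in> sets lborel" by measurable
    then have "emeasure lborel (D \<inter> {x. l *s x \<in> K}) = (\<integral>\<^sup>+x. indicator (D \<inter> {x. l *s x \<in> K}) x \<partial>lborel)" by simp
    also have "\<dots> = (\<integral>\<^sup>+x. indicator D x * indicator K (l *s x) \<partial>lborel)"
      by (intro nn_integral_cong) (auto simp: indicator_def)
    finally show "(\<integral>\<^sup>+x. indicator D x * indicator K (l *s x) \<partial>lborel) = emeasure lborel (D \<inter> {x. l *s x \<in> K})" ..
  qed
  finally show ?thesis .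
qed

lemma emeasure_complex_scale_vimage:
  fixes K :: "(complex ^ 'n) set"
  assumes [measurable]: "K \<in> sets borel" and l: "l \<noteq> 0"
  shows "emeasure lborel {x. l *s x \<in> K} = ennreal (1 / norm l ^ (2 * CARD('n))) * emeasure lborel K"
proof -
  have "emeasure lborel K = (\<integral>\<^sup>+x. indicator K x \<partial>lborel)" by simp
  also have "\<dots> = ennreal (norm l ^ (2 * CARD('n))) * (\<integral>\<^sup>+x. indicator K (l *s x) \<partial>lborel)"
    by (rule nn_integral_complex_scale[OF _ l]) measurable
  also have "(\<integral>\<^sup>+x. indicator K (l *s x) \<partial>lborel) = emeasure lborel {x. l *s x \<in> K}"
  proof -
    have "{x. l *s x \<in> K} \<in> sets lborel" by measurable
    then have "emeasure lborel {x. l *s x \<in> K} = (\<integral>\<^sup>+x. indicator {x. l *s x \<in> K} x \<partial>lborel)" by simp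
    then show ?thesis by (simp add: indicator_def)
  qed
  finally have "emeasure lborel K = ennreal (norm l ^ (2 * CARD('n))) * emeasure lborel {x. l *s x \<in> K}" .
  then show ?thesis using l by (simp add: mult.assoc[symmetric] flip: ennreal_mult)
qed

text \<open>
  The dilation factor \<open>s\<close> below is the one for which \<open>s\<^sup>-\<^sup>1 K\<close> and \<open>D\<close> have equal volume.
\<close>

lemma slice_integral_le:
  fixes K D :: "(complex ^ 'n) set"
  assumes [measurable]: "K \<in> sets borel" "D \<in> sets borel"
    and k: "emeasure lborel K = ennreal k" "k > 0" and d: "emeasure lborel D = ennreal d" "d > 0"
  shows "slice_integral K D \<le> ennreal (d powr ((real CARD('n) - 1) / real CARD('n)) * k powr (1 / real CARD('n)))
     * slice_constant CARD('n)"
proof -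
  let ?n = "CARD('n)"
  define s where "s = (k / d) powr (1 / (2 * real ?n))"
  have s: "s > 0" using k d by (simp add: s_def)
  have sn: "s ^ (2 * ?n) = k / d"
  proof -
    have "s ^ (2 * ?n) = s powr real (2 * ?n)" by (rule powr_realpow[OF s, symmetric])
    also have "\<dots> = (k / d) powr 1" unfolding s_def powr_powr by simp
    also have "\<dots> = k / d" using k d by simp
    finally show ?thesis .
  qed
  have s2: "s\<^sup>2 * d = d powr ((real ?n - 1) / real ?n) * k powr (1 / real ?n)"
  proof -
    have "s\<^sup>2 = s powr 2" using powr_realpow[OF s, of 2] by simp
    also have "\<dots> = (k / d) powr (1 / real ?n)" unfolding s_def powr_powr by simp
    also have "\<dots> = k powr (1 / real ?n) / d powr (1 / real ?n)" using k d by (simp add: powr_divide)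
    finally have "s\<^sup>2 * d = k powr (1 / real ?n) * (d powr 1 / d powr (1 / real ?n))" using d by simp
    also have "d powr 1 / d powr (1 / real ?n) = d powr (1 - 1 / real ?n)" by (rule powr_diff[symmetric])
    also have "1 - 1 / real ?n = (real ?n - 1) / real ?n" by (simp add: field_simps)
    finally show ?thesis by (simp add: mult.commute)
  qed
  have "slice_integral K D = (\<integral>\<^sup>+l. emeasure lborel (D \<inter> {x. l *s x \<in> K}) \<partial>lborel)"
    by (rule slice_integral_eq) measurable
  also have "\<dots> \<le> (\<integral>\<^sup>+l. ennreal (min d (k / norm l ^ (2 * ?n))) \<partial>complex_lborel)"
  proof (rule nn_integral_mono_AE, use AE_lborel_singleton[of "0::complex"] in eventually_elim)
    fix l :: complex assume l: "l \<noteq> 0"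
    have m: "{x. l *s x \<in> K} \<in> sets lborel" by measurable
    have "emeasure lborel (D \<inter> {x. l *s x \<in> K}) \<le> emeasure lborel D"
      by (intro emeasure_mono) auto
    moreover have "emeasure lborel (D \<inter> {x. l *s x \<in> K}) \<le> emeasure lborel {x. l *s x \<in> K}"
      using m by (intro emeasure_mono) auto
    then have "emeasure lborel (D \<inter> {x. l *s x \<in> K}) \<le> ennreal (k / norm l ^ (2 * ?n))"
      using k by (simp add: emeasure_complex_scale_vimage l flip: ennreal_mult)
    ultimately show "emeasure lborel (D \<inter> {x. l *s x \<in> K}) \<le> ennreal (min d (k / norm l ^ (2 * ?n)))"
      by (auto simp: d min_def)
  qed
  also have "\<dots> = ennreal (s ^ DIM(complex)) * (\<integral>\<^sup>+l. ennreal (min d (k / norm (s *\<^sub>R l) ^ (2 * ?n))) \<partial>complex_lborel)"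
    by (rule nn_integral_lborel_scaleR[OF _ s]) measurable
  also have "\<dots> \<le> ennreal (s\<^sup>2) * (\<integral>\<^sup>+l. ennreal d * ennreal (1 / max 1 (norm l ^ (2 * ?n))) \<partial>complex_lborel)"
  proof (intro mult_mono nn_integral_mono)
    fix l :: complex
    have "norm (s *\<^sub>R l) ^ (2 * ?n) = s ^ (2 * ?n) * norm l ^ (2 * ?n)" using s by (simp add: power_mult_distrib)
    then have "k / norm (s *\<^sub>R l) ^ (2 * ?n) = d / norm l ^ (2 * ?n)"
      unfolding sn using k d by simp
    then have "min d (k / norm (s *\<^sub>R l) ^ (2 * ?n)) \<le> d * (1 / max 1 (norm l ^ (2 * ?n)))"
      by (cases "norm l ^ (2 * ?n) \<le> 1") (auto simp: max_def)
    then show "ennreal (min d (k / norm (s *\<^sub>R l) ^ (2 * ?n))) \<le> ennreal d * ennreal (1 / max 1 (norm l ^ (2 * ?n)))"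
      using d by (subst ennreal_mult[symmetric]) (auto intro: ennreal_leI)
  qed auto
  also have "\<dots> = ennreal (s\<^sup>2) * (ennreal d * slice_constant ?n)"
    unfolding slice_constant_def by (simp add: nn_integral_cmult)
  also have "\<dots> = ennreal (s\<^sup>2 * d) * slice_constant ?n"
    using d by (simp add: ennreal_mult mult.assoc)
  finally show ?thesis unfolding s2 .
qed

text \<open>
  For \<open>D = K\<close> the two sets \<open>K\<close> and \<open>l\<^sup>-\<^sup>1 K\<close> are nested, so their intersection has the smaller of the two volumes.
\<close>

lemma slice_integral_self:
  fixes K :: "(complex ^ 'n) set"
  assumes [measurable]: "K \<in> sets borel"
    and circ: "\<And>l x. norm l \<le> 1 \<Longrightarrow> x \<in> K \<Longrightarrow> l *s x \<in> K"
  shows "slice_integral K K = emeasure lborel K * slice_constant CARD('n)"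
proof -
  let ?n = "CARD('n)"
  have "slice_integral K K = (\<integral>\<^sup>+l. emeasure lborel (K \<inter> {x. l *s x \<in> K}) \<partial>lborel)"
    by (rule slice_integral_eq) measurable
  also have "\<dots> = (\<integral>\<^sup>+l. emeasure lborel K * ennreal (1 / max 1 (norm l ^ (2 * ?n))) \<partial>complex_lborel)"
  proof (intro nn_integral_cong)
    fix l :: complex
    show "emeasure lborel (K \<inter> {x. l *s x \<in> K}) = emeasure lborel K * ennreal (1 / max 1 (norm l ^ (2 * ?n)))"
    proof (cases "norm l \<le> 1")
      case True
      then have "K \<inter> {x. l *s x \<in> K} = K" using circ by auto
      moreover have "max 1 (norm l ^ (2 * ?n)) = 1" using True by (simp add: power_le_one max_absorb1)
      ultimately show ?thesis by simp
    next
      case False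
      then have l: "l \<noteq> 0" by auto
      have "x \<in> K" if "l *s x \<in> K" for x
      proof -
        have "norm (inverse l) \<le> 1" using False by (simp add: norm_inverse inverse_le_1_iff)
        then have "inverse l *s (l *s x) \<in> K" using that by (rule circ)
        also have "inverse l *s (l *s x) = x" using l by (simp add: vec_eq_iff)
        finally show ?thesis .
      qed
      then have "K \<inter> {x. l *s x \<in> K} = {x. l *s x \<in> K}" by auto
      moreover have "max 1 (norm l ^ (2 * ?n)) = norm l ^ (2 * ?n)" using False by (intro max_absorb2) (simp add: one_le_power)
      ultimately show ?thesis by (simp add: emeasure_complex_scale_vimage l mult.commute)
    qed
  qed
  also have "\<dots> = emeasure lborel K * slice_constant ?n"
    unfolding slice_constant_def by (simp add: nn_integral_cmult)
  finally show ?thesis .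
qed

lemma volume_comparison:
  fixes K :: "(complex ^ 'n) set"
  assumes K: "K \<in> sets borel" "\<And>l x. norm l \<le> 1 \<Longrightarrow> x \<in> K \<Longrightarrow> l *s x \<in> K"
    and n: "CARD('n) \<ge> 2"
    and k: "emeasure lborel K = ennreal k" "k > 0" and a: "a \<ge> 0"
    and le: "slice_integral K K \<le> ennreal (a * k powr (1 / real CARD('n))) * slice_constant CARD('n)"
  shows "k powr ((real CARD('n) - 1) / real CARD('n)) \<le> a"
proof -
  let ?n = "CARD('n)"
  have "slice_integral K K = slice_constant ?n * ennreal k"
    unfolding k(1)[symmetric] by (subst mult.commute) (rule slice_integral_self[OF K])
  then have "slice_constant ?n * ennreal k \<le> slice_constant ?n * ennreal (a * k powr (1 / real ?n))"
    using le by (simp add: mult.commute)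
  then have "ennreal k \<le> ennreal (a * k powr (1 / real ?n))"
    using slice_constant_bounds[OF n] by (simp add: ennreal_mult_le_mult_iff)
  then have "k powr 1 \<le> a * k powr (1 / real ?n)"
    using a k by (subst (asm) ennreal_le_iff) auto
  then have "k powr 1 / k powr (1 / real ?n) \<le> a" using k by (simp add: pos_divide_le_eq)
  also have "k powr 1 / k powr (1 / real ?n) = k powr (1 - 1 / real ?n)" by (rule powr_diff[symmetric])
  also have "1 - 1 / real ?n = (real ?n - 1) / real ?n" by (simp add: field_simps)
  finally show ?thesis .
qed

section \<open>Convex bodies and the stability theorem\<close>

lemma symmetric_convex_body_props:
  assumes "convex_body K" "origin_symmetric K"
  shows "K \<in> sets borel" "convex K" "bounded K" "\<forall>x\<in>K. - x \<in> K" "\<exists>r>0. cball 0 r \<subseteq> K"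
proof -
  have K: "compact K" "convex K" "interior K \<noteq> {}" using assms(1) by (auto simp: convex_body_def)
  show "K \<in> sets borel" "convex K" "bounded K"
    using K by (auto intro: borel_compact compact_imp_bounded)
  show sym: "\<forall>x\<in>K. - x \<in> K" using assms(2) by (auto simp: origin_symmetric_def)
  obtain x e where x: "e > 0" "ball x e \<subseteq> K" using K(3) by (auto simp: mem_interior)
  have "y \<in> K" if "norm y < e" for y
  proof -
    have xy: "x + y \<in> K" "x - y \<in> K" using x that by (auto simp: dist_norm)
    then have "- (x - y) \<in> K" using sym by blast
    then have "(1/2) *\<^sub>R (x + y) + (1/2) *\<^sub>R (- (x - y)) \<in> K" using K(2) xy(1) by (intro convexD) auto
    then show ?thesis by (simp add: algebra_simps flip: scaleR_add_left)
  qed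
  then show "\<exists>r>0. cball 0 r \<subseteq> K" using x(1) by (intro exI[of _ "e / 2"]) (auto simp: subset_eq)
qed

text \<open>
  If the infimum is at most 1, convexity puts \<open>s x\<close> into \<open>K\<close> for every \<open>s < 1\<close>, and \<open>K\<close> is closed.
\<close>

lemma body_norm_le_1_iff:
  assumes K: "compact K" "convex K" and r: "r > 0" "cball 0 r \<subseteq> K"
  shows "body_norm K x \<le> 1 \<longleftrightarrow> x \<in> K"
proof -
  let ?S = "{t. t \<ge> 0 \<and> x \<in> (\<lambda>y. t *\<^sub>R y) ` K}"
  have bdd: "bdd_below ?S" by (rule bdd_belowI[of _ 0]) auto
  have "0 \<in> K" using r by auto
  have mem: "t *\<^sub>R y \<in> K" if "0 \<le> t" "t \<le> 1" "y \<in> K" for t y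
    using convexD_alt[OF K(2) \<open>0 \<in> K\<close> that(3,1,2)] by simp
  show ?thesis
  proof
    assume "x \<in> K"
    then show "body_norm K x \<le> 1" unfolding body_norm_def by (intro cInf_lower bdd) auto
  next
    assume le: "body_norm K x \<le> 1"
    define T where "T = norm x / r + 1"
    have T: "T > 0" using r by (simp add: T_def add_nonneg_pos)
    have "norm x \<le> T * r" using r by (simp add: T_def algebra_simps)
    then have "(1 / T) *\<^sub>R x \<in> K" using r T by (intro subsetD[OF r(2)]) (simp add: pos_divide_le_eq mult.commute)
    then have "T \<in> ?S" using T by (auto intro!: image_eqI[of _ _ "(1 / T) *\<^sub>R x"])
    then have ne: "?S \<noteq> {}" by blast
    have s: "s *\<^sub>R x \<in> K" if "0 < s" "s < 1" for s
    proof -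
      have "Inf ?S < 1 / s" using le that unfolding body_norm_def by (intro le_less_trans[OF le[unfolded body_norm_def]]) auto
      then obtain t where t: "t \<in> ?S" "t < 1 / s" using cInf_lessD[OF ne] by blast
      then obtain y where y: "y \<in> K" "x = t *\<^sub>R y" "t \<ge> 0" by auto
      have "(s * t) *\<^sub>R y \<in> K" using y t that by (intro mem) (auto simp: field_simps)
      then show ?thesis by (simp add: y(2))
    qed
    show "x \<in> K"
    proof (rule Lim_in_closed_set)
      show "closed K" using K(1) by (rule compact_imp_closed)
      show "\<forall>\<^sub>F s in at_left 1. s *\<^sub>R x \<in> K"
        using s by (auto simp: eventually_at_left_field intro!: exI[of _ 0])
      have "((\<lambda>s. s *\<^sub>R x) \<longlongrightarrow> 1 *\<^sub>R x) (at_left 1)" by (intro tendsto_intros)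
      then show "((\<lambda>s. s *\<^sub>R x) \<longlongrightarrow> x) (at_left 1)" by simp
    qed simp
  qed
qed

text \<open>
  A complex number of modulus at most 1 is a rotation followed by a contraction towards the origin.
\<close>

lemma rotation_invariant_scale_mem:
  assumes K: "convex_body K" "origin_symmetric K" "rotation_invariant K" and l: "norm l \<le> 1" and x: "x \<in> K"
  shows "l *s x \<in> K"
proof -
  have cK: "compact K" "convex K" using K(1) by (auto simp: convex_body_def)
  obtain r where r: "r > 0" "cball 0 r \<subseteq> K" using symmetric_convex_body_props(5)[OF K(1,2)] by auto
  define \<theta> where "\<theta> = Arg2pi l"
  have \<theta>: "\<theta> \<in> {0..2*pi}" "l = of_real (norm l) * cis \<theta>"
    using Arg2pi[of l] by (auto simp: \<theta>_def cis_conv_exp is_Arg_def)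
  have "body_norm K (\<chi> k. rotation \<theta> (x $ k)) \<le> 1"
  proof -
    have "body_norm K x = body_norm K (\<chi> k. rotation \<theta> (x $ k))"
      using K(3) \<theta>(1) unfolding rotation_invariant_def by blast
    moreover have "body_norm K x \<le> 1" using body_norm_le_1_iff[OF cK r, of x] x by blast
    ultimately show ?thesis by (simp only:)
  qed
  then have "(\<chi> k. rotation \<theta> (x $ k)) \<in> K" by (rule body_norm_le_1_iff[OF cK r, THEN iffD1])
  also have "(\<chi> k. rotation \<theta> (x $ k)) = cis \<theta> *s x" by (simp add: vec_eq_iff rotation_eq_cis)
  finally have 1: "cis \<theta> *s x \<in> K" .
  have "0 \<in> K" using r by auto
  from convexD_alt[OF cK(2) this 1, of "norm l"] l have "norm l *\<^sub>R (cis \<theta> *s x) \<in> K" by simp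
  also have "norm l *\<^sub>R (cis \<theta> *s x) = (of_real (norm l) * cis \<theta>) *s x"
    by (simp add: vec_eq_iff) (simp add: scaleR_conv_of_real)
  finally show ?thesis by (simp only: \<theta>(2)[symmetric])
qed

definition central_sections_le :: "(complex ^ 'n) set \<Rightarrow> (complex ^ 'n) set \<Rightarrow> real \<Rightarrow> bool" where
  "central_sections_le K L \<epsilon> \<longleftrightarrow> (\<forall>\<xi>\<in>sphere 0 1. measure (subspace_lebesgue (complex_hyperplane \<xi>)) (K \<inter> complex_hyperplane \<xi>)
       \<le> measure (subspace_lebesgue (complex_hyperplane \<xi>)) (L \<inter> complex_hyperplane \<xi>) + \<epsilon>)"

lemma complex_hyperplane_scaleR:
  "c \<noteq> 0 \<Longrightarrow> complex_hyperplane (c *\<^sub>R \<xi>) = complex_hyperplane \<xi>"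
proof -
  assume "c \<noteq> 0"
  moreover have "(\<Sum>k\<in>UNIV. z $ k * cnj ((c *\<^sub>R \<xi>) $ k)) = c *\<^sub>R (\<Sum>k\<in>UNIV. z $ k * cnj (\<xi> $ k))" for z
    by (simp add: scaleR_sum_right)
  ultimately show ?thesis by (simp add: complex_hyperplane_def)
qed

text \<open>
  The additive error \<open>\<epsilon>\<close> becomes the section of a ball; then all three terms carry the same factor between
  intrinsic volume and Lebesgue measure in the parameter space of \<open>g\<close>.
\<close>

lemma section_comparison:
  fixes g :: "'e::euclidean_space \<Rightarrow> complex ^ 'n"
  assumes g: "linear g" "inj g" "range g = complex_hyperplane \<xi>" and \<xi>: "\<xi> \<noteq> 0"
    and K: "K \<in> sets borel" "bounded K" and L: "L \<in> sets borel" "bounded L"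
    and r: "r > 0" and \<epsilon>: "\<epsilon> = unit_ball_vol DIM('e) * r ^ DIM('e)"
    and le: "central_sections_le K L \<epsilon>"
  shows "(\<integral>\<^sup>+q. indicator K (g q) \<partial>lborel) \<le> (\<integral>\<^sup>+q. indicator L (g q) \<partial>lborel) + (\<integral>\<^sup>+q. indicator (cball 0 r) (g q) \<partial>lborel)"
proof -
  let ?H = "complex_hyperplane \<xi>"
  obtain c where c: "c > 0" "\<And>S. S \<in> sets borel \<Longrightarrow> emeasure (subspace_lborel ?H) S = ennreal c * (\<integral>\<^sup>+q. indicator S (g q) \<partial>lborel)"
    using emeasure_subspace_lborel_range(1)[OF g(1,2)] g(3) by auto
  have ball: "emeasure (subspace_lborel ?H) (cball 0 s) = ennreal (unit_ball_vol DIM('e) * s ^ DIM('e))" if "s > 0" for s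
    using emeasure_subspace_lborel_range(2)[OF g(1,2) that] g(3) by simp
  have sets[simp]: "sets (subspace_lborel ?H) = sets borel" by (simp add: subspace_lborel_def Let_def)
  have "subspace ?H" using g(3) linear_subspace_image[OF g(1) subspace_UNIV] by metis
  then have H: "?H \<in> sets borel" by (intro borel_closed closed_subspace)
  have m: "ennreal (measure (subspace_lebesgue ?H) (S \<inter> ?H)) = ennreal c * (\<integral>\<^sup>+q. indicator S (g q) \<partial>lborel)"
    if S: "S \<in> sets borel" "bounded S" for S
  proof -
    have "emeasure (subspace_lborel ?H) (S \<inter> ?H) = ennreal c * (\<integral>\<^sup>+q. indicator (S \<inter> ?H) (g q) \<partial>lborel)"
      using S H by (intro c) auto
    also have "(\<integral>\<^sup>+q. indicator (S \<inter> ?H) (g q) \<partial>lborel) = (\<integral>\<^sup>+q. (indicator S (g q) :: ennreal) \<partial>lborel)"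
      using g(3) by (intro nn_integral_cong) (auto simp: indicator_def)
    finally have e: "emeasure (subspace_lborel ?H) (S \<inter> ?H) = ennreal c * (\<integral>\<^sup>+q. indicator S (g q) \<partial>lborel)" .
    obtain s where s: "s > 0" "S \<subseteq> cball 0 s" using S(2) by (force simp: bounded_pos subset_eq)
    have "emeasure (subspace_lborel ?H) (S \<inter> ?H) \<le> emeasure (subspace_lborel ?H) (cball 0 s)"
      using s by (intro emeasure_mono) auto
    also have "\<dots> < \<infinity>" using ball[OF s(1)] by simp
    finally have "emeasure (subspace_lborel ?H) (S \<inter> ?H) = ennreal (measure (subspace_lborel ?H) (S \<inter> ?H))"
      by (intro emeasure_eq_ennreal_measure) (auto simp: less_top)
    moreover have "measure (subspace_lebesgue ?H) (S \<inter> ?H) = measure (subspace_lborel ?H) (S \<inter> ?H)"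
      using S H by (intro measure_completion) auto
    ultimately show ?thesis using e by simp
  qed
  have "?H = complex_hyperplane ((1 / norm \<xi>) *\<^sub>R \<xi>)" "(1 / norm \<xi>) *\<^sub>R \<xi> \<in> sphere 0 1"
    using \<xi> by (simp_all add: complex_hyperplane_scaleR)
  then have leH: "measure (subspace_lebesgue ?H) (K \<inter> ?H) \<le> measure (subspace_lebesgue ?H) (L \<inter> ?H) + \<epsilon>"
    using le unfolding central_sections_le_def by (simp only: Ball_def)
  have "ennreal c * (\<integral>\<^sup>+q. indicator K (g q) \<partial>lborel) \<le> ennreal (measure (subspace_lebesgue ?H) (L \<inter> ?H) + \<epsilon>)"
    unfolding m[OF K, symmetric] by (intro ennreal_leI leH)
  also have "\<dots> = ennreal (measure (subspace_lebesgue ?H) (L \<inter> ?H)) + ennreal \<epsilon>"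
    using \<epsilon> r by (intro ennreal_plus) auto
  also have "\<dots> = ennreal c * (\<integral>\<^sup>+q. indicator L (g q) \<partial>lborel) + ennreal c * (\<integral>\<^sup>+q. indicator (cball 0 r) (g q) \<partial>lborel)"
    unfolding m[OF L] \<epsilon> ball[OF r, symmetric] by (subst c) auto
  also have "\<dots> = ennreal c * ((\<integral>\<^sup>+q. indicator L (g q) \<partial>lborel) + (\<integral>\<^sup>+q. indicator (cball 0 r) (g q) \<partial>lborel))"
    by (simp add: distrib_left)
  finally show ?thesis using c(1) by (simp add: ennreal_mult_le_mult_iff)
qed

text \<open>
  The line spanned by \<open>x\<close> is the hyperplane perpendicular to \<open>(- cnj x\<^sub>2, cnj x\<^sub>1)\<close>, so slices are sections and the
  hypothesis applies pointwise.
\<close>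

lemma slice_comparison_dim_2:
  fixes K L :: "(complex ^ 'n) set"
  assumes n: "CARD('n) = 2"
    and K: "K \<in> sets borel" "bounded K" and L: "L \<in> sets borel" "bounded L"
    and r: "r > 0" and \<epsilon>: "\<epsilon> = unit_ball_vol 2 * r ^ 2"
    and le: "central_sections_le K L \<epsilon>"
  shows "slice_integral K K \<le> slice_integral L K + slice_integral (cball 0 r) K"
proof -
  note [measurable] = K(1) L(1)
  obtain i j :: 'n where ij: "UNIV = {i, j}" "i \<noteq> j" using n unfolding card_2_iff by auto
  have *: "slice_area K x \<le> slice_area L x + slice_area (cball 0 r) x" if x: "x \<noteq> 0" for x
  proof -
    define \<xi> :: "complex ^ 'n" where "\<xi> = (\<chi> k. if k = i then - cnj (x $ j) else cnj (x $ i))"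
    have x': "x $ i \<noteq> 0 \<or> x $ j \<noteq> 0"
    proof (rule ccontr)
      assume "\<not> ?thesis"
      then have "x $ k = 0" for k using ij(1) by (metis UNIV_I insertE singletonD)
      then show False using x by (simp add: vec_eq_iff)
    qed
    then have \<xi>: "\<xi> \<noteq> 0" using ij(2) by (auto simp: \<xi>_def vec_eq_iff)
    have "linear (\<lambda>l. l *s x)" by (rule linear_complex_scale_left)
    moreover have "inj (\<lambda>l. l *s x)" using x by (auto simp: inj_def vec_eq_iff)
    moreover have "range (\<lambda>l. l *s x) = complex_hyperplane \<xi>"
    proof -
      have "z \<in> complex_hyperplane \<xi> \<longleftrightarrow> z $ j * x $ i = z $ i * x $ j" for z
        using ij(2) by (simp add: complex_hyperplane_def \<xi>_def ij(1) eq_neg_iff_add_eq_0 neg_eq_iff_add_eq_0)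
      moreover have "z \<in> range (\<lambda>l. l *s x)" if "z $ j * x $ i = z $ i * x $ j" for z
      proof -
        \<comment> \<open>One of the two coordinates of \<open>x\<close> may vanish.\<close>
        define l where "l = (if x $ i \<noteq> 0 then z $ i / x $ i else z $ j / x $ j)"
        have "z $ k = l * x $ k" if "k = i \<or> k = j" for k
          using that x' \<open>z $ j * x $ i = z $ i * x $ j\<close> by (auto simp: l_def field_simps)
        then have "z = l *s x" using ij(1) by (simp add: vec_eq_iff) (metis UNIV_I insertE singletonD)
        then show ?thesis by (rule range_eqI)
      qed
      ultimately show ?thesis by (auto simp: mult_ac)
    qed
    ultimately show ?thesis
      unfolding slice_area_def using \<epsilon> le \<xi> by (intro section_comparison[OF _ _ _ \<xi> K L r]) auto
  qed
  have "slice_integral K K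
      \<le> (\<integral>\<^sup>+x. indicator K x * slice_area L x + indicator K x * slice_area (cball 0 r) x \<partial>lborel)"
    unfolding slice_integral_def distrib_left[symmetric]
  proof (rule nn_integral_mono_AE, use AE_lborel_singleton[of "0::complex ^ 'n"] in eventually_elim)
    fix x :: "complex ^ 'n" assume "x \<noteq> 0"
    then show "indicator K x * slice_area K x \<le> indicator K x * (slice_area L x + slice_area (cball 0 r) x)"
      using * by (simp add: mult_left_mono)
  qed
  also have "\<dots> = slice_integral L K + slice_integral (cball 0 r) K"
    unfolding slice_integral_def by (rule nn_integral_add) measurable
  finally show ?thesis .
qed

text \<open>
  Numbering the three coordinates gives an isometry from triples of complex numbers; the plane \<open>v = m u + b w\<close>
  becomes the hyperplane perpendicular to \<open>(- cnj m, 1, - cnj b)\<close>.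
\<close>

lemma slice_comparison_dim_3:
  fixes K L :: "(complex ^ 'n) set"
  assumes n: "CARD('n) = 3"
    and K: "K \<in> sets borel" "convex K" "bounded K" "\<forall>x\<in>K. - x \<in> K" and R: "R > 0" "cball 0 R \<subseteq> K"
    and L: "L \<in> sets borel" "bounded L"
    and r: "r > 0" and \<epsilon>: "\<epsilon> = unit_ball_vol 4 * r ^ 4"
    and le: "central_sections_le K L \<epsilon>"
  shows "slice_integral K K \<le> slice_integral K L + slice_integral K (cball 0 r)"
proof -
  obtain i j h :: 'n where ijh: "UNIV = {i, j, h}" "i \<noteq> j" "j \<noteq> h" "i \<noteq> h" using n unfolding card_3_iff by auto
  define \<Phi> where "\<Phi> = (\<lambda>(u, v, w). (\<chi> k. if k = i then u else if k = j then v else w) :: complex ^ 'n)"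
  have comp: "\<Phi> (u, v, w) $ i = u" "\<Phi> (u, v, w) $ j = v" "\<Phi> (u, v, w) $ h = w" for u v w
    using ijh by (auto simp: \<Phi>_def)
  have all: "P i \<Longrightarrow> P j \<Longrightarrow> P h \<Longrightarrow> P k" for P and k :: 'n
    using ijh(1) by (metis UNIV_I insertE singletonD)
  have lin: "linear \<Phi>" by (rule linearI) (auto simp: \<Phi>_def vec_eq_iff)
  have iso: "norm (\<Phi> q) = norm q" for q
    using ijh by (cases q) (simp add: norm_vec_def L2_set_def ijh(1) comp norm_Pair add.assoc)
  have dim: "DIM(complex \<times> complex \<times> complex) = DIM(complex ^ 'n)" by (simp add: n)
  have [measurable]: "\<Phi> \<in> borel_measurable borel"
    using lin by (intro borel_measurable_continuous_onI linear_continuous_on) (simp add: linear_linear)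
  have pre: "\<Phi> -` S \<in> sets borel" if "S \<in> sets borel" for S
    using measurable_sets_borel[of \<Phi> borel S] that by simp
  have scale: "\<Phi> (l * u, l * v, l * w) = l *s \<Phi> (u, v, w)" for l u v w
    by (simp add: \<Phi>_def vec_eq_iff)
  have disc: "disc_integral (\<Phi> -` S) (\<Phi> -` D) = slice_integral S D" if [measurable]: "S \<in> sets borel" "D \<in> sets borel" for S D
  proof -
    have "slice_integral S D = (\<integral>\<^sup>+q. indicator D (\<Phi> q) * slice_area S (\<Phi> q) \<partial>lborel)"
      unfolding slice_integral_def by (rule nn_integral_lborel_isometry[OF lin iso dim, symmetric]) measurable
    also have "\<dots> = (\<integral>\<^sup>+u. \<integral>\<^sup>+p. indicator D (\<Phi> (u, p)) * slice_area S (\<Phi> (u, p)) \<partial>lborel \<partial>lborel)"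
      by (rule nn_integral_lborel_pair) measurable
    also have "\<dots> = (\<integral>\<^sup>+u. \<integral>\<^sup>+v. \<integral>\<^sup>+w. indicator D (\<Phi> (u, v, w)) * slice_area S (\<Phi> (u, v, w)) \<partial>lborel \<partial>lborel \<partial>lborel)"
      by (intro nn_integral_cong nn_integral_lborel_pair) measurable
    also have "\<dots> = disc_integral (\<Phi> -` S) (\<Phi> -` D)"
      by (simp add: disc_integral_def disc_area_def slice_area_def scale indicator_def)
    finally show ?thesis ..
  qed
  have plane: "plane_area (\<Phi> -` K) m b \<le> plane_area (\<Phi> -` L) m b + plane_area (\<Phi> -` cball 0 r) m b" for m b
  proof -
    define g where "g = (\<lambda>q. \<Phi> (fst q, m * fst q + b * snd q, snd q))"
    define \<xi> :: "complex ^ 'n" where "\<xi> = \<Phi> (- cnj m, 1, - cnj b)"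
    have g: "linear g" unfolding g_def
      by (rule linear_compose[OF _ lin, unfolded comp_def]) (auto intro!: linearI simp: algebra_simps)
    have gc: "g q $ i = fst q" "g q $ j = m * fst q + b * snd q" "g q $ h = snd q" for q
      by (simp_all add: g_def comp)
    have inj: "inj g"
    proof (rule injI)
      fix p q assume "g p = g q"
      then show "p = q" using gc(1)[of p] gc(1)[of q] gc(3)[of p] gc(3)[of q] by (intro prod_eqI) simp_all
    qed
    have \<xi>: "\<xi> \<noteq> 0" using comp(2)[of "- cnj m" 1 "- cnj b"] by (auto simp: \<xi>_def)
    have "z \<in> complex_hyperplane \<xi> \<longleftrightarrow> z $ j = m * z $ i + b * z $ h" for z
    proof -
      have "(\<Sum>k\<in>UNIV. z $ k * cnj (\<xi> $ k)) = z $ j - (m * z $ i + b * z $ h)"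
        unfolding \<xi>_def ijh(1) using ijh(2-4) by (simp add: comp algebra_simps)
      then show ?thesis by (simp add: complex_hyperplane_def)
    qed
    moreover have "z \<in> range g" if "z $ j = m * z $ i + b * z $ h" for z
    proof -
      have "z $ k = g (z $ i, z $ h) $ k" for k by (rule all) (simp_all add: gc that)
      then have "z = g (z $ i, z $ h)" unfolding vec_eq_iff by blast
      then show ?thesis by blast
    qed
    ultimately have range: "range g = complex_hyperplane \<xi>" by (auto simp: gc)
    have pl: "(\<integral>\<^sup>+q. indicator S (g q) \<partial>lborel) = plane_area (\<Phi> -` S) m b" if [measurable]: "S \<in> sets borel" for S
    proof -
      have [measurable]: "g \<in> borel_measurable borel"
        using g by (intro borel_measurable_continuous_onI linear_continuous_on) (simp add: linear_linear)
      have "(\<integral>\<^sup>+q. indicator S (g q) \<partial>lborel) = (\<integral>\<^sup>+u. \<integral>\<^sup>+w. indicator S (g (u, w)) \<partial>lborel \<partial>lborel)"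
        by (rule nn_integral_lborel_pair) measurable
      then show ?thesis by (simp add: plane_area_def g_def indicator_def)
    qed
    have "\<epsilon> = unit_ball_vol DIM(complex \<times> complex) * r ^ DIM(complex \<times> complex)" using \<epsilon> by simp
    from section_comparison[OF g inj range \<xi> K(1,3) L r this le] show ?thesis
      by (simp add: pl K(1) L(1))
  qed
  have "disc_integral (\<Phi> -` K) (\<Phi> -` K) \<le> disc_integral (\<Phi> -` K) (\<Phi> -` L) + disc_integral (\<Phi> -` K) (\<Phi> -` cball 0 r)"
  proof (rule disc_integral_comparison[OF pre[OF K(1)] _ _ _ R(1) _ pre[OF L(1)] pre plane])
    show "convex (\<Phi> -` K)" by (rule convex_linear_vimage[OF lin K(2)])
    obtain M where "\<And>x. x \<in> K \<Longrightarrow> norm x \<le> M" using K(3) by (auto simp: bounded_iff)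
    then show "bounded (\<Phi> -` K)" using iso unfolding bounded_iff by (metis vimageE)
    show "\<forall>x\<in>\<Phi> -` K. - x \<in> \<Phi> -` K" using K(4) linear_neg[OF lin] by auto
    show "cball 0 R \<subseteq> \<Phi> -` K" using R(2) iso by (auto simp: subset_eq)
  qed simp
  then show ?thesis using disc K(1) L(1) by simp
qed

theorem theorem1:
  fixes K L :: "(complex ^ 'n) set" and \<epsilon> :: real
  assumes "CARD('n) = 2 \<or> CARD('n) = 3"
    and "\<epsilon> > 0"
    and "convex_body K" and "origin_symmetric K" and "rotation_invariant K"
    and "convex_body L" and "origin_symmetric L" and "rotation_invariant L"
    and "\<forall>\<xi>\<in>sphere 0 1.
           measure (subspace_lebesgue (complex_hyperplane \<xi>)) (K \<inter> complex_hyperplane \<xi>)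
           \<le> measure (subspace_lebesgue (complex_hyperplane \<xi>)) (L \<inter> complex_hyperplane \<xi>) + \<epsilon>"
  shows "measure lebesgue K powr ((real CARD('n) - 1) / real CARD('n))
         \<le> measure lebesgue L powr ((real CARD('n) - 1) / real CARD('n)) + \<epsilon>"
proof -
  let ?n = "CARD('n)"
  let ?e = "(real ?n - 1) / real ?n"
  note K = symmetric_convex_body_props[OF assms(3,4)] and L = symmetric_convex_body_props[OF assms(6,7)]
  have sections: "central_sections_le K L \<epsilon>" unfolding central_sections_le_def by (rule assms(9))
  have vol: "\<exists>k. measure lebesgue S = k \<and> emeasure lborel S = ennreal k \<and> k > 0"
    if S: "S \<in> sets borel" "bounded S" "\<exists>r>0. cball 0 r \<subseteq> S" for S :: "(complex ^ 'n) set"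
  proof -
    obtain r where r: "r > 0" "cball 0 r \<subseteq> S" using S(3) by auto
    have fin: "emeasure lborel S < \<infinity>" by (rule emeasure_bounded_finite[OF S(2)])
    have "0 < emeasure lborel (cball 0 r :: (complex ^ 'n) set)"
      using r(1) unit_ball_vol_pos[of "real DIM(complex ^ 'n)"] by (simp add: emeasure_cball del: unit_ball_vol_pos)
    also have "\<dots> \<le> emeasure lborel S" using r S(1) by (intro emeasure_mono) auto
    finally have pos: "0 < emeasure lborel S" .
    have "measure lebesgue S = measure lborel S" using S(1) by (intro measure_completion) simp
    moreover have eq: "emeasure lborel S = ennreal (measure lborel S)"
      using fin by (intro emeasure_eq_ennreal_measure) (auto simp: less_top)
    moreover have "measure lborel S > 0" using pos unfolding eq by (rule ennreal_less_zero_iff[THEN iffD1])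
    ultimately show ?thesis by auto
  qed
  obtain k where k: "measure lebesgue K = k" "emeasure lborel K = ennreal k" "k > 0" using vol[OF K(1,3,5)] by auto
  obtain l where l: "measure lebesgue L = l" "emeasure lborel L = ennreal l" "l > 0" using vol[OF L(1,3,5)] by auto
  obtain R where R: "R > 0" "cball 0 R \<subseteq> K" using K(5) by auto
  have circ: "\<And>l x. norm l \<le> 1 \<Longrightarrow> x \<in> K \<Longrightarrow> l *s x \<in> K"
    by (rule rotation_invariant_scale_mem[OF assms(3-5)])
  have n: "?n \<ge> 2" using assms(1) by auto
  \<comment> \<open>The ball \<open>?B\<close> of radius \<open>r\<close> has hyperplane sections of volume \<open>v * r ^ (2 * ?n - 2) = \<epsilon>\<close>.\<close>
  define v where "v = unit_ball_vol (2 * real ?n - 2)"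
  have v: "v > 0" unfolding v_def using n by (intro unit_ball_vol_pos) auto
  define r where "r = (\<epsilon> / v) powr (1 / (2 * real ?n - 2))"
  have r: "r > 0" using assms(2) v by (simp add: r_def)
  have r\<epsilon>: "\<epsilon> = v * r ^ (2 * ?n - 2)"
  proof -
    have "real (2 * ?n - 2) = 2 * real ?n - 2" using n by (simp add: of_nat_diff)
    then have "r ^ (2 * ?n - 2) = r powr (2 * real ?n - 2)" using powr_realpow[OF r, of "2 * ?n - 2"] by simp
    also have "\<dots> = (\<epsilon> / v) powr 1" unfolding r_def powr_powr using n by simp
    finally show ?thesis using assms(2) v by simp
  qed
  let ?B = "cball 0 r :: (complex ^ 'n) set"
  define b where "b = unit_ball_vol (2 * real ?n) * r ^ (2 * ?n)"
  have b: "emeasure lborel ?B = ennreal b" "b > 0"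
    using r by (simp_all add: b_def emeasure_cball mult.commute)
  have b\<epsilon>: "b powr ?e \<le> \<epsilon>"
  proof -
    have "b powr ?e = unit_ball_vol (2 * real ?n) powr ?e * r ^ (2 * ?n - 2)"
    proof -
      have "(r ^ (2 * ?n)) powr ?e = r powr (real (2 * ?n) * ?e)"
        using r by (simp only: powr_realpow[symmetric] powr_powr)
      also have "real (2 * ?n) * ?e = real (2 * ?n - 2)" using n by (simp add: of_nat_diff field_simps)
      also have "r powr \<dots> = r ^ (2 * ?n - 2)" by (rule powr_realpow[OF r])
      finally show ?thesis using r by (simp add: b_def powr_mult)
    qed
    also have "\<dots> \<le> v * r ^ (2 * ?n - 2)"
    proof (rule mult_right_mono)
      show "unit_ball_vol (2 * real ?n) powr ?e \<le> v"
        using assms(1)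
      proof
        assume n2: "?n = 2"
        have "unit_ball_vol 4 powr (1 / 2) \<le> (pi\<^sup>2) powr (1 / 2)"
          by (intro powr_mono2) (auto simp: eval_unit_ball_vol)
        also have "\<dots> = pi" by (simp add: powr_half_sqrt)
        finally show ?thesis by (simp add: n2 v_def unit_ball_vol_2)
      next
        assume n3: "?n = 3"
        have "unit_ball_vol 6 powr (2 / 3) \<le> ((pi\<^sup>2 / 2) powr (3 / 2)) powr (2 / 3)"
        proof (intro powr_mono2)
          have "(pi\<^sup>2 / 2) powr (3 / 2) = sqrt ((pi\<^sup>2 / 2) ^ 3)"
          proof -
            have "(pi\<^sup>2 / 2) powr (3 / 2) = ((pi\<^sup>2 / 2) powr 3) powr (1 / 2)" unfolding powr_powr by simp
            also have "(pi\<^sup>2 / 2) powr 3 = (pi\<^sup>2 / 2) ^ 3" using powr_realpow[of "pi\<^sup>2 / 2" 3] by simp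
            finally show ?thesis by (simp add: powr_half_sqrt)
          qed
          moreover have "pi ^ 3 / 6 \<le> sqrt ((pi\<^sup>2 / 2) ^ 3)"
          proof (rule real_le_rsqrt)
            have "(pi ^ 3 / 6)\<^sup>2 = pi ^ 6 / 36" by (simp add: power_divide flip: power_mult)
            moreover have "(pi\<^sup>2 / 2) ^ 3 = pi ^ 6 / 8" by (simp add: power_divide flip: power_mult)
            moreover have "pi ^ 6 / 36 \<le> pi ^ 6 / 8" by (intro divide_left_mono) auto
            ultimately show "(pi ^ 3 / 6)\<^sup>2 \<le> (pi\<^sup>2 / 2) ^ 3" by (simp only:)
          qed
          ultimately show "unit_ball_vol 6 \<le> (pi\<^sup>2 / 2) powr (3 / 2)" by (simp add: eval_unit_ball_vol)
        qed (auto simp: eval_unit_ball_vol)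
        also have "\<dots> = pi\<^sup>2 / 2" by (simp add: powr_powr)
        finally show ?thesis by (simp add: n3 v_def eval_unit_ball_vol)
      qed
    qed (use r in simp)
    finally show ?thesis using r\<epsilon> by simp
  qed
  have le: "slice_integral K K \<le> ennreal ((l powr ?e + b powr ?e) * k powr (1 / real ?n)) * slice_constant ?n"
  proof -
    have combine: "ennreal (l powr ?e * k powr (1 / real ?n)) * slice_constant ?n
        + ennreal (b powr ?e * k powr (1 / real ?n)) * slice_constant ?n
      = ennreal ((l powr ?e + b powr ?e) * k powr (1 / real ?n)) * slice_constant ?n"
      unfolding distrib_right[symmetric] by (subst ennreal_plus[symmetric]) (simp_all add: distrib_right)
    from assms(1) show ?thesis
    proof
      assume n2: "?n = 2"
      have "\<epsilon> = unit_ball_vol 2 * r ^ 2" using r\<epsilon> by (simp add: n2 v_def)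
      from slice_comparison_dim_2[OF n2 K(1,3) L(1,3) r this sections]
      have "slice_integral K K \<le> slice_integral L K + slice_integral ?B K" .
      also have "\<dots> \<le> ennreal (k powr ?e * l powr (1 / real ?n)) * slice_constant ?n
          + ennreal (k powr ?e * b powr (1 / real ?n)) * slice_constant ?n"
        using K(1) L(1) k l b by (intro add_mono slice_integral_le) auto
      also have "\<dots> = ennreal ((l powr ?e + b powr ?e) * k powr (1 / real ?n)) * slice_constant ?n"
        unfolding combine[symmetric] by (simp add: n2 mult.commute)
      finally show ?thesis .
    next
      assume n3: "?n = 3"
      have "\<epsilon> = unit_ball_vol 4 * r ^ 4" using r\<epsilon> by (simp add: n3 v_def)
      from slice_comparison_dim_3[OF n3 K(1-4) R L(1,3) r this sections]
      have "slice_integral K K \<le> slice_integral K L + slice_integral K ?B" .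
      also have "\<dots> \<le> ennreal (l powr ?e * k powr (1 / real ?n)) * slice_constant ?n
          + ennreal (b powr ?e * k powr (1 / real ?n)) * slice_constant ?n"
        using K(1) L(1) k l b by (intro add_mono slice_integral_le) auto
      finally show ?thesis unfolding combine .
    qed
  qed
  have "k powr ?e \<le> l powr ?e + b powr ?e"
    by (rule volume_comparison[OF K(1) circ n k(2,3) _ le]) simp_all
  then show ?thesis using b\<epsilon> by (simp add: k l)
qed

end
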